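(* Let $\langle V,\mathcal{V},\in\rangle$ be a model of $\mathsf{BG}$ such that $V$ is a well-ordered model universe. Then $V$ satisfies "there is no measurable cardinal".
   Context: $\mathsf{BG}$ is Bernays–Gödel class theory; $V$ is the collection of sets and $\mathcal{V}$ the collection of classes. An inner model of a model $N$ of $\mathsf{ZFC}$ is a transitive class of $N$ containing all ordinals of $N$ which is a model of $\mathsf{ZFC}$. A model $N\subseteq V$ of $\mathsf{ZFC}$ is a well-ordered model universe if there exist classes (in $\mathcal{V}$) $\mathbb{M}\subseteq I\times N$ and a well-ordered class $I$ such that: $M$ is a proper inner model of $N$ if and only if there is a unique $a\in I$ with $M=M_a:=\{x\mid(a,x)\in\mathbb{M}\}$; and $a<_Ib$ implies $M_a\subseteq M_b$. *)

theory Defs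
  imports Main
begin

text \<open>
  A structure for the language of set theory is a domain \<open>M :: 'a set\<close> with a relation \<open>E\<close>, where
  \<open>E x y\<close> is read as ``x is an element of y''. The relation is arbitrary (it need not be
  well-founded), and all internal notions below quantify over \<open>M\<close> only.

  A structure for class theory is a triple \<open>(V, C, E)\<close> in which \<open>(V, E)\<close> interprets the sets and
  \<open>C :: 'a set set\<close> the classes. By extensionality a class is identified with the
  collection of the sets that belong to it, so \<open>C \<subseteq> Pow V\<close> and membership of a set in a class is
  the HOL membership; the class corresponding to a set \<open>x\<close> is \<open>elts V E x\<close>.
\<close>

definition elts :: "'a set \<Rightarrow> ('a \<Rightarrow> 'a \<Rightarrow> bool) \<Rightarrow> 'a \<Rightarrow> 'a set" where
  "elts M E x = {y \<in> M. E y x}"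

section \<open>Formulas and satisfaction\<close>

text \<open>
  Formulas with named set variables, quantifiers over sets only, and class parameters:
  \<open>MemC i X\<close> says that the \<open>i\<close>-th variable belongs to the class \<open>X\<close>. The function \<open>class_params\<close>
  collects the class parameters of a formula; those without class parameters are the formulas of the
  language of set theory.
\<close>

datatype (class_params: 'c) fm =
    Mem nat nat
  | Eq nat nat
  | MemC nat 'c
  | Neg "'c fm"
  | Conj "'c fm" "'c fm"
  | Forall nat "'c fm"

primrec sat :: "'a set \<Rightarrow> ('a \<Rightarrow> 'a \<Rightarrow> bool) \<Rightarrow> (nat \<Rightarrow> 'a) \<Rightarrow> 'a set fm \<Rightarrow> bool" where
  "sat M E v (Mem i j) \<longleftrightarrow> E (v i) (v j)"
| "sat M E v (Eq i j) \<longleftrightarrow> v i = v j"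
| "sat M E v (MemC i X) \<longleftrightarrow> v i \<in> X"
| "sat M E v (Neg p) \<longleftrightarrow> \<not> sat M E v p"
| "sat M E v (Conj p q) \<longleftrightarrow> sat M E v p \<and> sat M E v q"
| "sat M E v (Forall i p) \<longleftrightarrow> (\<forall>x\<in>M. sat M E (v(i := x)) p)"

section \<open>Axioms on sets\<close>

definition ax_extensionality :: "'a set \<Rightarrow> ('a \<Rightarrow> 'a \<Rightarrow> bool) \<Rightarrow> bool" where
  "ax_extensionality M E \<longleftrightarrow> (\<forall>x\<in>M. \<forall>y\<in>M. elts M E x = elts M E y \<longrightarrow> x = y)"

definition ax_pairing :: "'a set \<Rightarrow> ('a \<Rightarrow> 'a \<Rightarrow> bool) \<Rightarrow> bool" where
  "ax_pairing M E \<longleftrightarrow> (\<forall>x\<in>M. \<forall>y\<in>M. \<exists>z\<in>M. elts M E z = {x, y})"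

definition ax_union :: "'a set \<Rightarrow> ('a \<Rightarrow> 'a \<Rightarrow> bool) \<Rightarrow> bool" where
  "ax_union M E \<longleftrightarrow> (\<forall>x\<in>M. \<exists>u\<in>M. elts M E u = (\<Union>y\<in>elts M E x. elts M E y))"

definition ax_power :: "'a set \<Rightarrow> ('a \<Rightarrow> 'a \<Rightarrow> bool) \<Rightarrow> bool" where
  "ax_power M E \<longleftrightarrow> (\<forall>x\<in>M. \<exists>p\<in>M. elts M E p = {y \<in> M. elts M E y \<subseteq> elts M E x})"

definition ax_infinity :: "'a set \<Rightarrow> ('a \<Rightarrow> 'a \<Rightarrow> bool) \<Rightarrow> bool" where
  "ax_infinity M E \<longleftrightarrow>
    (\<exists>w\<in>M. (\<exists>e\<in>elts M E w. elts M E e = {}) \<and>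
       (\<forall>y\<in>elts M E w. \<exists>z\<in>elts M E w. elts M E z = insert y (elts M E y)))"

definition ax_foundation :: "'a set \<Rightarrow> ('a \<Rightarrow> 'a \<Rightarrow> bool) \<Rightarrow> bool" where
  "ax_foundation M E \<longleftrightarrow>
    (\<forall>x\<in>M. elts M E x \<noteq> {} \<longrightarrow> (\<exists>y\<in>elts M E x. elts M E y \<inter> elts M E x = {}))"

text \<open>Every set of nonempty, pairwise disjoint sets has a transversal.\<close>

definition ax_choice :: "'a set \<Rightarrow> ('a \<Rightarrow> 'a \<Rightarrow> bool) \<Rightarrow> bool" where
  "ax_choice M E \<longleftrightarrow>
    (\<forall>x\<in>M. (\<forall>y\<in>elts M E x. elts M E y \<noteq> {}) \<and>
       (\<forall>y\<in>elts M E x. \<forall>z\<in>elts M E x. y \<noteq> z \<longrightarrow> elts M E y \<inter> elts M E z = {}) \<longrightarrow>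
       (\<exists>c\<in>M. \<forall>y\<in>elts M E x. \<exists>!z. z \<in> elts M E c \<inter> elts M E y))"

text \<open>
  In the schemata, variable 0 (and 1) are the active ones and the remaining values of \<open>v\<close> are set
  parameters.
\<close>

definition separation_schema :: "'a set \<Rightarrow> ('a \<Rightarrow> 'a \<Rightarrow> bool) \<Rightarrow> bool" where
  "separation_schema M E \<longleftrightarrow>
    (\<forall>p v. class_params p = {} \<and> range v \<subseteq> M \<longrightarrow>
       (\<forall>a\<in>M. \<exists>b\<in>M. elts M E b = {x \<in> elts M E a. sat M E (v(0 := x)) p}))"

definition replacement_schema :: "'a set \<Rightarrow> ('a \<Rightarrow> 'a \<Rightarrow> bool) \<Rightarrow> bool" where
  "replacement_schema M E \<longleftrightarrow>
    (\<forall>p v. class_params p = {} \<and> range v \<subseteq> M \<longrightarrow>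
       (\<forall>a\<in>M. (\<forall>x\<in>elts M E a. \<exists>!y. y \<in> M \<and> sat M E (v(0 := x, 1 := y)) p) \<longrightarrow>
          (\<exists>b\<in>M. elts M E b = {y \<in> M. \<exists>x\<in>elts M E a. sat M E (v(0 := x, 1 := y)) p})))"

definition ZFC_model :: "'a set \<Rightarrow> ('a \<Rightarrow> 'a \<Rightarrow> bool) \<Rightarrow> bool" where
  "ZFC_model M E \<longleftrightarrow>
    ax_extensionality M E \<and> ax_pairing M E \<and> ax_union M E \<and> ax_power M E \<and>
    ax_infinity M E \<and> ax_foundation M E \<and> ax_choice M E \<and>
    separation_schema M E \<and> replacement_schema M E"

section \<open>Pairs, relations and functions\<close>

text \<open>\<open>p\<close> is the Kuratowski pair \<open>{{x}, {x, y}}\<close> in the sense of the structure.\<close>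

definition is_pair :: "'a set \<Rightarrow> ('a \<Rightarrow> 'a \<Rightarrow> bool) \<Rightarrow> 'a \<Rightarrow> 'a \<Rightarrow> 'a \<Rightarrow> bool" where
  "is_pair M E p x y \<longleftrightarrow> p \<in> M \<and> x \<in> M \<and> y \<in> M \<and>
    (\<exists>a\<in>M. \<exists>b\<in>M. elts M E a = {x} \<and> elts M E b = {x, y} \<and> elts M E p = {a, b})"

text \<open>
  The argument \<open>R\<close> ranges over collections of elements of \<open>M\<close>; it is instantiated with classes and,
  for a set \<open>f\<close>, with \<open>elts M E f\<close>.
\<close>

definition rel :: "'a set \<Rightarrow> ('a \<Rightarrow> 'a \<Rightarrow> bool) \<Rightarrow> 'a set \<Rightarrow> 'a \<Rightarrow> 'a \<Rightarrow> bool" where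
  "rel M E R x y \<longleftrightarrow> (\<exists>p\<in>R. is_pair M E p x y)"

definition rel_between :: "'a set \<Rightarrow> ('a \<Rightarrow> 'a \<Rightarrow> bool) \<Rightarrow> 'a set \<Rightarrow> 'a set \<Rightarrow> 'a set \<Rightarrow> bool" where
  "rel_between M E R A B \<longleftrightarrow> (\<forall>p\<in>R. \<exists>x\<in>A. \<exists>y\<in>B. is_pair M E p x y)"

definition class_function :: "'a set \<Rightarrow> ('a \<Rightarrow> 'a \<Rightarrow> bool) \<Rightarrow> 'a set \<Rightarrow> bool" where
  "class_function M E F \<longleftrightarrow> rel_between M E F M M \<and>
    (\<forall>x y z. rel M E F x y \<and> rel M E F x z \<longrightarrow> y = z)"

definition function_from_to :: "'a set \<Rightarrow> ('a \<Rightarrow> 'a \<Rightarrow> bool) \<Rightarrow> 'a \<Rightarrow> 'a \<Rightarrow> 'a \<Rightarrow> bool" where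
  "function_from_to M E f a b \<longleftrightarrow> f \<in> M \<and>
    rel_between M E (elts M E f) (elts M E a) (elts M E b) \<and>
    (\<forall>x\<in>elts M E a. \<exists>!y. rel M E (elts M E f) x y)"

definition bijection_from_to :: "'a set \<Rightarrow> ('a \<Rightarrow> 'a \<Rightarrow> bool) \<Rightarrow> 'a \<Rightarrow> 'a \<Rightarrow> 'a \<Rightarrow> bool" where
  "bijection_from_to M E f a b \<longleftrightarrow> function_from_to M E f a b \<and>
    (\<forall>y\<in>elts M E b. \<exists>!x. rel M E (elts M E f) x y)"

section \<open>Models of Bernays--Goedel class theory\<close>

text \<open>
  Predicative comprehension: only set variables are quantified, but class and set parameters are
  allowed.
\<close>

definition class_comprehension ::
    "'a set \<Rightarrow> 'a set set \<Rightarrow> ('a \<Rightarrow> 'a \<Rightarrow> bool) \<Rightarrow> bool" where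
  "class_comprehension V C E \<longleftrightarrow>
    (\<forall>p v. class_params p \<subseteq> C \<and> range v \<subseteq> V \<longrightarrow> {x \<in> V. sat V E (v(0 := x)) p} \<in> C)"

definition class_replacement ::
    "'a set \<Rightarrow> 'a set set \<Rightarrow> ('a \<Rightarrow> 'a \<Rightarrow> bool) \<Rightarrow> bool" where
  "class_replacement V C E \<longleftrightarrow>
    (\<forall>F\<in>C. class_function V E F \<longrightarrow>
       (\<forall>a\<in>V. \<exists>b\<in>V. elts V E b = {y \<in> V. \<exists>x\<in>elts V E a. rel V E F x y}))"

definition class_foundation ::
    "'a set \<Rightarrow> 'a set set \<Rightarrow> ('a \<Rightarrow> 'a \<Rightarrow> bool) \<Rightarrow> bool" where
  "class_foundation V C E \<longleftrightarrow> (\<forall>X\<in>C. X \<noteq> {} \<longrightarrow> (\<exists>y\<in>X. elts V E y \<inter> X = {}))"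

text \<open>
  No choice axiom (in particular no global choice) is included in BG. Extensionality for classes
  holds by the representation of classes.
\<close>

definition BG_model :: "'a set \<Rightarrow> 'a set set \<Rightarrow> ('a \<Rightarrow> 'a \<Rightarrow> bool) \<Rightarrow> bool" where
  "BG_model V C E \<longleftrightarrow>
    C \<subseteq> Pow V \<and> (\<forall>x\<in>V. elts V E x \<in> C) \<and>
    ax_extensionality V E \<and> ax_pairing V E \<and> ax_union V E \<and> ax_power V E \<and>
    ax_infinity V E \<and> class_foundation V C E \<and>
    class_comprehension V C E \<and> class_replacement V C E"

section \<open>Ordinals and measurable cardinals in a structure\<close>

definition transitive_set :: "'a set \<Rightarrow> ('a \<Rightarrow> 'a \<Rightarrow> bool) \<Rightarrow> 'a \<Rightarrow> bool" where
  "transitive_set M E x \<longleftrightarrow> (\<forall>y\<in>elts M E x. elts M E y \<subseteq> elts M E x)"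

definition strict_linear_order_on :: "'a set \<Rightarrow> ('a \<Rightarrow> 'a \<Rightarrow> bool) \<Rightarrow> bool" where
  "strict_linear_order_on A R \<longleftrightarrow>
    (\<forall>x\<in>A. \<not> R x x) \<and>
    (\<forall>x\<in>A. \<forall>y\<in>A. \<forall>z\<in>A. R x y \<and> R y z \<longrightarrow> R x z) \<and>
    (\<forall>x\<in>A. \<forall>y\<in>A. x = y \<or> R x y \<or> R y x)"

text \<open>\<open>x\<close> is transitive and well-ordered by membership, all in the sense of the structure.\<close>

definition ordinal :: "'a set \<Rightarrow> ('a \<Rightarrow> 'a \<Rightarrow> bool) \<Rightarrow> 'a \<Rightarrow> bool" where
  "ordinal M E x \<longleftrightarrow> x \<in> M \<and> transitive_set M E x \<and>
    strict_linear_order_on (elts M E x) E \<and>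
    (\<forall>s\<in>M. elts M E s \<subseteq> elts M E x \<and> elts M E s \<noteq> {} \<longrightarrow>
       (\<exists>m\<in>elts M E s. \<forall>y\<in>elts M E s. m = y \<or> E m y))"

definition limit_ordinal :: "'a set \<Rightarrow> ('a \<Rightarrow> 'a \<Rightarrow> bool) \<Rightarrow> 'a \<Rightarrow> bool" where
  "limit_ordinal M E x \<longleftrightarrow> ordinal M E x \<and> elts M E x \<noteq> {} \<and>
    (\<forall>y\<in>elts M E x. \<exists>z\<in>elts M E x. E y z)"

definition is_omega :: "'a set \<Rightarrow> ('a \<Rightarrow> 'a \<Rightarrow> bool) \<Rightarrow> 'a \<Rightarrow> bool" where
  "is_omega M E w \<longleftrightarrow> limit_ordinal M E w \<and> (\<forall>y\<in>elts M E w. \<not> limit_ordinal M E y)"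

definition cardinal :: "'a set \<Rightarrow> ('a \<Rightarrow> 'a \<Rightarrow> bool) \<Rightarrow> 'a \<Rightarrow> bool" where
  "cardinal M E k \<longleftrightarrow> ordinal M E k \<and>
    (\<forall>a\<in>elts M E k. \<not> (\<exists>f\<in>M. bijection_from_to M E f a k))"

definition uncountable_cardinal :: "'a set \<Rightarrow> ('a \<Rightarrow> 'a \<Rightarrow> bool) \<Rightarrow> 'a \<Rightarrow> bool" where
  "uncountable_cardinal M E k \<longleftrightarrow> cardinal M E k \<and> (\<exists>w\<in>elts M E k. is_omega M E w)"

text \<open>The (external) family of the extensions of the members of \<open>u\<close>.\<close>

definition family :: "'a set \<Rightarrow> ('a \<Rightarrow> 'a \<Rightarrow> bool) \<Rightarrow> 'a \<Rightarrow> 'a set set" where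
  "family M E u = elts M E ` elts M E u"

definition ultrafilter_on :: "'a set \<Rightarrow> ('a \<Rightarrow> 'a \<Rightarrow> bool) \<Rightarrow> 'a \<Rightarrow> 'a \<Rightarrow> bool" where
  "ultrafilter_on M E k u \<longleftrightarrow> u \<in> M \<and>
    family M E u \<subseteq> Pow (elts M E k) \<and>
    elts M E k \<in> family M E u \<and> {} \<notin> family M E u \<and>
    (\<forall>X\<in>family M E u. \<forall>Y\<in>family M E u. X \<inter> Y \<in> family M E u) \<and>
    (\<forall>X\<in>family M E u. \<forall>y\<in>M. X \<subseteq> elts M E y \<and> elts M E y \<subseteq> elts M E k \<longrightarrow>
       elts M E y \<in> family M E u) \<and>
    (\<forall>x\<in>M. elts M E x \<subseteq> elts M E k \<longrightarrow>
       elts M E x \<in> family M E u \<or> elts M E k - elts M E x \<in> family M E u)"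

definition nonprincipal :: "'a set \<Rightarrow> ('a \<Rightarrow> 'a \<Rightarrow> bool) \<Rightarrow> 'a \<Rightarrow> 'a \<Rightarrow> bool" where
  "nonprincipal M E k u \<longleftrightarrow> (\<forall>x\<in>elts M E k. {x} \<notin> family M E u)"

text \<open>
  \<open>u\<close> is closed under intersections of sequences (in \<open>M\<close>) of length \<open>a < k\<close>; for \<open>a = 0\<close> the
  intersection is read as \<open>k\<close>.
\<close>

definition complete_filter :: "'a set \<Rightarrow> ('a \<Rightarrow> 'a \<Rightarrow> bool) \<Rightarrow> 'a \<Rightarrow> 'a \<Rightarrow> bool" where
  "complete_filter M E k u \<longleftrightarrow>
    (\<forall>a\<in>elts M E k. \<forall>f\<in>M. function_from_to M E f a u \<longrightarrow>
       {x \<in> elts M E k. \<forall>i\<in>elts M E a. \<forall>s. rel M E (elts M E f) i s \<longrightarrow> E x s} \<in> family M E u)"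

definition measurable_cardinal :: "'a set \<Rightarrow> ('a \<Rightarrow> 'a \<Rightarrow> bool) \<Rightarrow> 'a \<Rightarrow> bool" where
  "measurable_cardinal M E k \<longleftrightarrow> uncountable_cardinal M E k \<and>
    (\<exists>u\<in>M. ultrafilter_on M E k u \<and> nonprincipal M E k u \<and> complete_filter M E k u)"

section \<open>Inner models and well-ordered model universes\<close>

definition inner_model ::
    "'a set set \<Rightarrow> ('a \<Rightarrow> 'a \<Rightarrow> bool) \<Rightarrow> 'a set \<Rightarrow> 'a set \<Rightarrow> bool" where
  "inner_model C E N M \<longleftrightarrow> M \<in> C \<and> M \<subseteq> N \<and>
    (\<forall>x\<in>M. elts N E x \<subseteq> M) \<and> (\<forall>a. ordinal N E a \<longrightarrow> a \<in> M) \<and> ZFC_model M E"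

definition proper_inner_model ::
    "'a set set \<Rightarrow> ('a \<Rightarrow> 'a \<Rightarrow> bool) \<Rightarrow> 'a set \<Rightarrow> 'a set \<Rightarrow> bool" where
  "proper_inner_model C E N M \<longleftrightarrow> inner_model C E N M \<and> M \<noteq> N"

text \<open>The class \<open>I\<close> is (strictly) well-ordered by the class \<open>L\<close> of ordered pairs.\<close>

definition well_ordered_class ::
    "'a set \<Rightarrow> 'a set set \<Rightarrow> ('a \<Rightarrow> 'a \<Rightarrow> bool) \<Rightarrow> 'a set \<Rightarrow> 'a set \<Rightarrow> bool" where
  "well_ordered_class V C E I L \<longleftrightarrow> I \<in> C \<and> L \<in> C \<and> rel_between V E L I I \<and>
    strict_linear_order_on I (rel V E L) \<and>
    (\<forall>X\<in>C. X \<subseteq> I \<and> X \<noteq> {} \<longrightarrow> (\<exists>m\<in>X. \<forall>y\<in>X. m = y \<or> rel V E L m y))"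

definition slice :: "'a set \<Rightarrow> ('a \<Rightarrow> 'a \<Rightarrow> bool) \<Rightarrow> 'a set \<Rightarrow> 'a \<Rightarrow> 'a set" where
  "slice V E MM a = {x. rel V E MM a x}"

definition well_ordered_model_universe ::
    "'a set \<Rightarrow> 'a set set \<Rightarrow> ('a \<Rightarrow> 'a \<Rightarrow> bool) \<Rightarrow> 'a set \<Rightarrow> bool" where
  "well_ordered_model_universe V C E N \<longleftrightarrow> N \<subseteq> V \<and> ZFC_model N E \<and>
    (\<exists>MM\<in>C. \<exists>I L. well_ordered_class V C E I L \<and> rel_between V E MM I N \<and>
       (\<forall>M\<in>C. proper_inner_model C E N M \<longleftrightarrow> (\<exists>!a. a \<in> I \<and> M = slice V E MM a)) \<and>
       (\<forall>a\<in>I. \<forall>b\<in>I. rel V E L a b \<longrightarrow> slice V E MM a \<subseteq> slice V E MM b))"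

end

(*
  Let m be the least index of a (uniquely indexed) proper inner model with a measurable cardinal; if
  V has a measurable cardinal, then its ultrapower shows that there is such an index. Inside N = M_m
  take the least measurable cardinal k and the transitive collapse M of the ultrapower of N by a
  measure on k. By Los's theorem M is an inner model in which j(k) is the least measurable cardinal.
  Moreover M is not N: otherwise j(k) = k, hence d = [id] < j(k) = k and j(d) < [id] = d, whereas j
  never moves a set below itself. So M = M_b for some b < m, contrary to the choice of m.
*)

theory Submission
  imports Defs
begin

section \<open>Definable predicates\<close>

text \<open>The relation \<open>E\<close> need not be well-founded from outside, so recursion,
  collapse and the proof that the ultrapower is well-founded take place inside the model, and a
  predicate may enter separation, replacement or induction only once it is shown definable. This is
  the purpose of \<open>dfn\<close> and \<open>dtm\<close>. One formula must often be read in
  several structures, in Los's theorem for instance in \<open>N\<close> and in its ultrapower; hence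
  definability is uniform over a collection \<open>K\<close> of structures. The choice of the least
  index is the other obstacle. The well-order of \<open>I\<close> has least elements only for
  classes in \<open>C\<close>, and being a model of ZFC is a schema, not a formula that
  comprehension could take. The indexing hypothesis removes this: being the only index of one's
  slice is a predicative condition, and it is equivalent to the slice being a proper inner model.
  The measurable cardinal is taken least because leastness is first-order without parameters: if the
  ultrapower were all of \<open>N\<close>, then \<open>j(k)\<close> would satisfy the definition of
  \<open>k\<close>.\<close>

text \<open>The second sequence has two uses: in \<open>dfn\<close> it is arbitrary filler that
  leaves fresh variables, in \<open>elim_class_params\<close> it holds set parameters.\<close>

definition mix :: "(nat \<Rightarrow> 'a) \<Rightarrow> (nat \<Rightarrow> 'a) \<Rightarrow> nat \<Rightarrow> 'a" where
  "mix v w i = (if even i then v (i div 2) else w (i div 2))"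

lemma range_mix: "range v \<subseteq> M \<Longrightarrow> range w \<subseteq> M \<Longrightarrow> range (mix v w) \<subseteq> M"
  by (auto simp: mix_def)

lemma mix_upd: "(mix v w)(2 * i := x) = mix (v(i := x)) w"
  by (auto simp: mix_def fun_eq_iff)

primrec ren :: "(nat \<Rightarrow> nat) \<Rightarrow> 'c fm \<Rightarrow> 'c fm" where
  "ren f (Mem i j) = Mem (f i) (f j)"
| "ren f (Eq i j) = Eq (f i) (f j)"
| "ren f (MemC i X) = MemC (f i) X"
| "ren f (Neg p) = Neg (ren f p)"
| "ren f (Conj p q) = Conj (ren f p) (ren f q)"
| "ren f (Forall i p) = Forall (f i) (ren f p)"

lemma class_params_ren [simp]: "class_params (ren f p) = class_params p"
  by (induction p) auto

text \<open>Injectivity prevents capture: assigning to \<open>f i\<close> must change no variable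
  other than \<open>i\<close>.\<close>

lemma sat_ren:
  assumes "inj f"
  shows "sat M E v (ren f p) \<longleftrightarrow> sat M E (\<lambda>i. v (f i)) p"
proof (induction p arbitrary: v)
  case (Forall i p)
  have "(\<lambda>j. (v(f i := x)) (f j)) = (\<lambda>j. v (f j))(i := x)" for x
    using assms by (auto simp: fun_eq_iff inj_eq)
  then show ?case by (simp add: Forall)
qed auto

lemma range_case_nat: "x \<in> M \<Longrightarrow> range v \<subseteq> M \<Longrightarrow> range (case_nat x v) \<subseteq> M"
  by (auto simp: image_subset_iff split: nat.split)

text \<open>
  The formula sees the arguments \<open>v\<close> at even positions and does not depend on the odd ones, which
  thus provide fresh variables. The domain ranges over \<open>K\<close>, so that one formula may define a
  predicate in several structures; \<open>D\<close> is the supply of class parameters.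
\<close>

definition dfn ::
    "'a set set \<Rightarrow> 'a set set \<Rightarrow> ('a \<Rightarrow> 'a \<Rightarrow> bool) \<Rightarrow> ('a set \<Rightarrow> (nat \<Rightarrow> 'a) \<Rightarrow> bool) \<Rightarrow> bool" where
  "dfn K D E P \<longleftrightarrow> (\<exists>p. class_params p \<subseteq> D \<and>
     (\<forall>M\<in>K. \<forall>v w. range v \<subseteq> M \<and> range w \<subseteq> M \<longrightarrow> (P M v \<longleftrightarrow> sat M E (mix v w) p)))"

text \<open>The language has no function symbols, so a term is given by its graph: position 0 holds
  the value and the arguments are shifted up by one. Totality on each structure lets a term be
  traded for an existential quantifier in \<open>dfn_subst\<close>.\<close>

definition dtm ::
    "'a set set \<Rightarrow> 'a set set \<Rightarrow> ('a \<Rightarrow> 'a \<Rightarrow> bool) \<Rightarrow> ('a set \<Rightarrow> (nat \<Rightarrow> 'a) \<Rightarrow> 'a) \<Rightarrow> bool" where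
  "dtm K D E t \<longleftrightarrow> (\<forall>M\<in>K. \<forall>v. range v \<subseteq> M \<longrightarrow> t M v \<in> M) \<and>
     dfn K D E (\<lambda>M v. v 0 = t M (\<lambda>i. v (Suc i)))"

lemma dfnI:
  assumes "class_params p \<subseteq> D"
    and "\<And>M v w. M \<in> K \<Longrightarrow> range v \<subseteq> M \<Longrightarrow> range w \<subseteq> M \<Longrightarrow> P M v \<longleftrightarrow> sat M E (mix v w) p"
  shows "dfn K D E P"
  using assms unfolding dfn_def by blast

lemma dfnE:
  assumes "dfn K D E P"
  obtains p where "class_params p \<subseteq> D"
    and "\<And>M v w. M \<in> K \<Longrightarrow> range v \<subseteq> M \<Longrightarrow> range w \<subseteq> M \<Longrightarrow> P M v \<longleftrightarrow> sat M E (mix v w) p"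
proof -
  from assms obtain p where p: "class_params p \<subseteq> D"
      "\<forall>M\<in>K. \<forall>v w. range v \<subseteq> M \<and> range w \<subseteq> M \<longrightarrow> (P M v \<longleftrightarrow> sat M E (mix v w) p)"
    unfolding dfn_def by auto
  show ?thesis
    by (rule that[OF p(1)]) (use p(2) in blast)
qed

lemma dfn_cong:
  assumes "\<And>M v. M \<in> K \<Longrightarrow> range v \<subseteq> M \<Longrightarrow> P M v \<longleftrightarrow> Q M v"
  shows "dfn K D E P \<longleftrightarrow> dfn K D E Q"
  unfolding dfn_def using assms by (metis (no_types, lifting))

lemma dfn_mono:
  assumes "dfn K D E P" "K' \<subseteq> K" "D \<subseteq> D'"
  shows "dfn K' D' E P"
  using assms unfolding dfn_def by (meson subset_iff subset_trans)

lemma dfn_Mem_var: "dfn K D E (\<lambda>M v. E (v i) (v j))"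
  by (rule dfnI[of "Mem (2 * i) (2 * j)"]) (auto simp: mix_def)

lemma dfn_Eq_var: "dfn K D E (\<lambda>M v. v i = v j)"
  by (rule dfnI[of "Eq (2 * i) (2 * j)"]) (auto simp: mix_def)

lemma dfn_MemC_var: "X \<in> D \<Longrightarrow> dfn K D E (\<lambda>M v. v i \<in> X)"
  by (rule dfnI[of "MemC (2 * i) X"]) (auto simp: mix_def)

lemma dfn_not: "dfn K D E P \<Longrightarrow> dfn K D E (\<lambda>M v. \<not> P M v)"
  unfolding dfn_def by (metis fm.set(4) sat.simps(4))

lemma dfn_conj:
  assumes "dfn K D E P" "dfn K D E Q"
  shows "dfn K D E (\<lambda>M v. P M v \<and> Q M v)"
proof -
  obtain p where p: "class_params p \<subseteq> D"
      "\<And>M v w. M \<in> K \<Longrightarrow> range v \<subseteq> M \<Longrightarrow> range w \<subseteq> M \<Longrightarrow> P M v \<longleftrightarrow> sat M E (mix v w) p"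
    by (rule dfnE[OF assms(1)]) blast
  obtain q where q: "class_params q \<subseteq> D"
      "\<And>M v w. M \<in> K \<Longrightarrow> range v \<subseteq> M \<Longrightarrow> range w \<subseteq> M \<Longrightarrow> Q M v \<longleftrightarrow> sat M E (mix v w) q"
    by (rule dfnE[OF assms(2)]) blast
  show ?thesis
    by (rule dfnI[of "Conj p q"]) (simp_all add: p(1) q(1) p(2)[symmetric] q(2)[symmetric])
qed

lemma dfn_disj:
  assumes "dfn K D E P" "dfn K D E Q"
  shows "dfn K D E (\<lambda>M v. P M v \<or> Q M v)"
proof -
  have "dfn K D E (\<lambda>M v. \<not> (\<not> P M v \<and> \<not> Q M v))"
    by (intro dfn_not dfn_conj assms)
  then show ?thesis by simp
qed

lemma dfn_imp:
  assumes "dfn K D E P" "dfn K D E Q"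
  shows "dfn K D E (\<lambda>M v. P M v \<longrightarrow> Q M v)"
proof -
  have "dfn K D E (\<lambda>M v. \<not> P M v \<or> Q M v)"
    by (intro dfn_not dfn_disj assms)
  then show ?thesis by simp
qed

lemma dfn_iff:
  assumes "dfn K D E P" "dfn K D E Q"
  shows "dfn K D E (\<lambda>M v. P M v \<longleftrightarrow> Q M v)"
proof -
  have "dfn K D E (\<lambda>M v. (P M v \<longrightarrow> Q M v) \<and> (Q M v \<longrightarrow> P M v))"
    by (intro dfn_imp dfn_conj assms)
  moreover have "(\<lambda>M v. (P M v \<longrightarrow> Q M v) \<and> (Q M v \<longrightarrow> P M v)) = (\<lambda>M v. P M v \<longleftrightarrow> Q M v)"
    by blast
  ultimately show ?thesis by simp
qed

lemma dfn_const: "dfn K D E (\<lambda>M v. b)"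
  using dfn_Eq_var[of K D E 0 0] dfn_not[OF dfn_Eq_var[of K D E 0 0]] by (cases b) auto

text \<open>The quantified variable is moved to position 1, which \<open>P\<close> does not use.\<close>

lemma dfn_all:
  assumes "dfn K D E (\<lambda>M v. P M (\<lambda>i. v (Suc i)) (v 0))"
  shows "dfn K D E (\<lambda>M v. \<forall>x\<in>M. P M v x)"
proof -
  obtain p where p: "class_params p \<subseteq> D"
      "\<And>M v w. M \<in> K \<Longrightarrow> range v \<subseteq> M \<Longrightarrow> range w \<subseteq> M \<Longrightarrow>
        P M (\<lambda>i. v (Suc i)) (v 0) \<longleftrightarrow> sat M E (mix v w) p"
    by (rule dfnE[OF assms]) blast
  define g :: "nat \<Rightarrow> nat" where
    "g i = (if i = 0 then 1 else if even i then i - 2 else i + 2)" for i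
  have "inj g"
    unfolding g_def inj_def by (auto split: if_splits) presburger+
  have *: "(\<lambda>i. ((mix v w)(Suc 0 := x)) (g i)) = mix (case_nat x v) (\<lambda>i. w (Suc i))" for v w and x :: 'a
  proof
    fix i
    consider "i = 0" | k where "i = 2 * Suc k" | k where "i = 2 * k + 1"
      by (metis even_Suc evenE gr0_implies_Suc mult_0_right neq0_conv oddE)
    then show "((mix v w)(Suc 0 := x)) (g i) = mix (case_nat x v) (\<lambda>i. w (Suc i)) i"
      by cases (auto simp: mix_def g_def)
  qed
  show ?thesis
  proof (rule dfnI[of "Forall 1 (ren g p)"])
    show "class_params (Forall 1 (ren g p)) \<subseteq> D" using p by simp
    fix M and v w :: "nat \<Rightarrow> 'a" assume M: "M \<in> K" "range v \<subseteq> M" "range w \<subseteq> M"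
    then have "range (\<lambda>i. w (Suc i)) \<subseteq> M" by auto
    then show "(\<forall>x\<in>M. P M v x) \<longleftrightarrow> sat M E (mix v w) (Forall 1 (ren g p))"
      using p(2)[OF M(1) range_case_nat[OF _ M(2)], of _ "\<lambda>i. w (Suc i)"]
      by (simp add: sat_ren[OF \<open>inj g\<close>] * del: fun_upd_apply)
  qed
qed

lemma dfn_ex:
  assumes "dfn K D E (\<lambda>M v. P M (\<lambda>i. v (Suc i)) (v 0))"
  shows "dfn K D E (\<lambda>M v. \<exists>x\<in>M. P M v x)"
  using dfn_not[OF dfn_all, of K D E "\<lambda>M v x. \<not> P M v x"] dfn_not[OF assms] by simp

section \<open>Substitution of definable terms\<close>

lemma dtm_range: "dtm K D E t \<Longrightarrow> M \<in> K \<Longrightarrow> range v \<subseteq> M \<Longrightarrow> t M v \<in> M"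
  by (simp add: dtm_def)

lemma dtm_var: "dtm K D E (\<lambda>M v. v i)"
  unfolding dtm_def by (auto intro: dfn_Eq_var)

text \<open>Here \<open>f\<close> need not be injective, so \<open>sat_ren\<close> does not apply.
  The formula is rebuilt by recursion instead: a quantified variable is read from the new position 0
  and all others move up, as with de Bruijn indices.\<close>

lemma sat_dfn_var:
  assumes "class_params p \<subseteq> D"
  shows "dfn K D E (\<lambda>M v. sat M E (\<lambda>i. v (f i)) p)"
  using assms
proof (induction p arbitrary: f)
  case (Forall i p)
  have *: "(\<lambda>j. v (if j = i then 0 else Suc (f j))) = (\<lambda>j. v (Suc (f j)))(i := v 0)"
    for v :: "nat \<Rightarrow> 'a" by auto
  have "dfn K D E (\<lambda>M v. sat M E (\<lambda>j. v (if j = i then 0 else Suc (f j))) p)"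
    by (rule Forall.IH) (use Forall.prems in simp)
  then show ?case
    unfolding * sat.simps by (rule dfn_all)
qed (auto intro: dfn_Mem_var dfn_Eq_var dfn_MemC_var dfn_not dfn_conj)

lemma dfn_ren:
  assumes "dfn K D E P"
  shows "dfn K D E (\<lambda>M v. P M (\<lambda>i. v (f i)))"
proof -
  obtain p where p: "class_params p \<subseteq> D"
      "\<And>M v w. M \<in> K \<Longrightarrow> range v \<subseteq> M \<Longrightarrow> range w \<subseteq> M \<Longrightarrow> P M v \<longleftrightarrow> sat M E (mix v w) p"
    by (rule dfnE[OF assms(1)]) blast
  let ?f = "\<lambda>i. if even i then f (i div 2) else 0"
  have "P M (\<lambda>i. v (f i)) \<longleftrightarrow> sat M E (\<lambda>i. v (?f i)) p" if "M \<in> K" "range v \<subseteq> M" for M v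
  proof -
    have "(\<lambda>i. v (?f i)) = mix (\<lambda>i. v (f i)) (\<lambda>i. v 0)"
      by (auto simp: mix_def)
    then show ?thesis using p(2)[of M "\<lambda>i. v (f i)" "\<lambda>i. v 0"] that by auto
  qed
  then show ?thesis
    using sat_dfn_var[OF p(1), of K E ?f] by (subst dfn_cong) auto
qed

lemma dtm_shift: "dtm K D E t \<Longrightarrow> dtm K D E (\<lambda>M v. t M (\<lambda>i. v (Suc i)))"
  unfolding dtm_def
  by (auto simp: image_subset_iff
      dest: dfn_ren[where f = "\<lambda>i. case i of 0 \<Rightarrow> 0 | Suc j \<Rightarrow> Suc (Suc j)"])

lemma dfn_subst:
  assumes "dtm K D E t" and "dfn K D E (\<lambda>M v. P M (\<lambda>i. v (Suc i)) (v 0))"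
  shows "dfn K D E (\<lambda>M v. P M v (t M v))"
proof -
  have "dfn K D E (\<lambda>M v. \<exists>x\<in>M. x = t M v \<and> P M v x)"
    by (rule dfn_ex[OF dfn_conj]) (use assms in \<open>simp_all add: dtm_def\<close>)
  moreover have "(\<exists>x\<in>M. x = t M v \<and> P M v x) \<longleftrightarrow> P M v (t M v)"
    if "M \<in> K" "range v \<subseteq> M" for M v
    using dtm_range[OF assms(1) that] by blast
  ultimately show ?thesis
    by (subst (asm) dfn_cong) auto
qed

lemma sat_dfn:
  assumes "class_params p \<subseteq> D" and "\<And>i. dtm K D E (t i)"
  shows "dfn K D E (\<lambda>M v. sat M E (\<lambda>i. t i M v) p)"
  using assms
proof (induction p arbitrary: t)
  case (Mem i j)
  have "dfn K D E (\<lambda>M v. E (v 0) (t j M (\<lambda>i. v (Suc i))))"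
    using dfn_Mem_var by (rule dfn_subst[OF dtm_shift[OF Mem(2)]])
  then show ?case
    unfolding sat.simps by (rule dfn_subst[OF Mem(2)])
next
  case (Eq i j)
  have "dfn K D E (\<lambda>M v. v 0 = t j M (\<lambda>i. v (Suc i)))"
    using Eq by (simp add: dtm_def)
  then show ?case
    unfolding sat.simps by (rule dfn_subst[OF Eq(2)])
next
  case (MemC i X)
  have "dfn K D E (\<lambda>M v. v 0 \<in> X)"
    using MemC by (simp add: dfn_MemC_var)
  then show ?case
    unfolding sat.simps by (rule dfn_subst[OF MemC(2)])
next
  case (Forall i p)
  let ?t = "\<lambda>j. if j = i then (\<lambda>M v. v 0) else (\<lambda>M v. t j M (\<lambda>i. v (Suc i)))"
  have "dfn K D E (\<lambda>M v. sat M E (\<lambda>j. ?t j M v) p)"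
    by (rule Forall.IH) (use Forall.prems in \<open>auto intro: dtm_var dtm_shift\<close>)
  moreover have "(\<lambda>j. ?t j M v) = (\<lambda>j. t j M (\<lambda>i. v (Suc i)))(i := v 0)" for M v
    by auto
  ultimately have "dfn K D E (\<lambda>M v. sat M E ((\<lambda>j. t j M (\<lambda>i. v (Suc i)))(i := v 0)) p)"
    by (simp only:)
  then show ?case
    unfolding sat.simps by (rule dfn_all)
qed (auto intro: dfn_not dfn_conj)

text \<open>Iterating \<open>dfn_subst\<close> reaches only finitely many arguments. Going through a
  formula for \<open>P\<close> and \<open>sat_dfn\<close> substitutes for all of them together; the
  odd positions receive an arbitrary term, here \<open>t 0\<close>.\<close>

lemma dfn_subst_all:
  assumes "dfn K D E P" "\<And>i. dtm K D E (t i)"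
  shows "dfn K D E (\<lambda>M v. P M (\<lambda>i. t i M v))"
proof -
  obtain p where p: "class_params p \<subseteq> D"
      "\<And>M v w. M \<in> K \<Longrightarrow> range v \<subseteq> M \<Longrightarrow> range w \<subseteq> M \<Longrightarrow> P M v \<longleftrightarrow> sat M E (mix v w) p"
    by (rule dfnE[OF assms(1)]) blast
  let ?t = "\<lambda>i. if even i then t (i div 2) else t 0"
  have "P M (\<lambda>i. t i M v) \<longleftrightarrow> sat M E (\<lambda>i. ?t i M v) p" if "M \<in> K" "range v \<subseteq> M" for M v
  proof -
    have "(\<lambda>i. ?t i M v) = mix (\<lambda>i. t i M v) (\<lambda>i. t 0 M v)"
      by (auto simp: mix_def)
    then show ?thesis
      using p(2)[of M "\<lambda>i. t i M v" "\<lambda>i. t 0 M v"] that dtm_range[OF assms(2) that] by auto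
  qed
  moreover have "dfn K D E (\<lambda>M v. sat M E (\<lambda>i. ?t i M v) p)"
    by (rule sat_dfn) (use p assms in auto)
  ultimately show ?thesis
    by (subst dfn_cong) auto
qed

lemma dfn_subst1:
  assumes "dfn K D E (\<lambda>M v. P M (v 0))" "dtm K D E s"
  shows "dfn K D E (\<lambda>M v. P M (s M v))"
  using dfn_subst_all[OF assms(1), of "\<lambda>i. s"] assms(2) by simp

lemma dfn_subst2:
  assumes "dfn K D E (\<lambda>M v. P M (v 0) (v 1))" "dtm K D E s" "dtm K D E t"
  shows "dfn K D E (\<lambda>M v. P M (s M v) (t M v))"
  using dfn_subst_all[OF assms(1), of "\<lambda>i. if i = 0 then s else t"] assms by simp

lemma dfn_subst3:
  assumes "dfn K D E (\<lambda>M v. P M (v 0) (v 1) (v 2))" "dtm K D E s" "dtm K D E t" "dtm K D E u"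
  shows "dfn K D E (\<lambda>M v. P M (s M v) (t M v) (u M v))"
  using dfn_subst_all[OF assms(1), of "\<lambda>i. if i = 0 then s else if i = 1 then t else u"] assms
  by simp

lemma dfn_Mem: "dtm K D E s \<Longrightarrow> dtm K D E t \<Longrightarrow> dfn K D E (\<lambda>M v. E (s M v) (t M v))"
  by (rule dfn_subst2[where P = "\<lambda>M. E", OF dfn_Mem_var[of K D E 0 1]])

lemma dfn_Eq: "dtm K D E s \<Longrightarrow> dtm K D E t \<Longrightarrow> dfn K D E (\<lambda>M v. s M v = t M v)"
  by (rule dfn_subst2[where P = "\<lambda>M. (=)", OF dfn_Eq_var[of K D E 0 1]])

lemma dfn_MemC: "X \<in> D \<Longrightarrow> dtm K D E s \<Longrightarrow> dfn K D E (\<lambda>M v. s M v \<in> X)"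
  by (rule dfn_subst1[where P = "\<lambda>M x. x \<in> X", OF dfn_MemC_var[of X D K E 0]])

section \<open>Set theory inside a model\<close>

text \<open>Minimal elements can be expected only for predicates definable in the model. The
  admissible class parameters are the extensions of sets, so parameters from \<open>N\<close> are
  allowed. For inner models the scheme comes from class foundation, see
  \<open>inner_model_zfc\<close>.\<close>

locale zfc =
  fixes N :: "'a set" and E :: "'a \<Rightarrow> 'a \<Rightarrow> bool"
  assumes ZFC: "ZFC_model N E"
    and foundation: "\<And>P x. dfn {N} (elts N E ` N) E (\<lambda>_ v. P (v 0)) \<Longrightarrow> x \<in> N \<Longrightarrow> P x \<Longrightarrow>
      \<exists>y\<in>N. P y \<and> (\<forall>z\<in>N. E z y \<longrightarrow> \<not> P z)"
begin

abbreviation df :: "((nat \<Rightarrow> 'a) \<Rightarrow> bool) \<Rightarrow> bool" where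
  "df P \<equiv> dfn {N} (elts N E ` N) E (\<lambda>_. P)"

abbreviation dt :: "((nat \<Rightarrow> 'a) \<Rightarrow> 'a) \<Rightarrow> bool" where
  "dt t \<equiv> dtm {N} (elts N E ` N) E (\<lambda>_. t)"

abbreviation el :: "'a \<Rightarrow> 'a set" where
  "el \<equiv> elts N E"

section \<open>Codes of small collections\<close>

definition small :: "'a set \<Rightarrow> bool" where
  "small X \<longleftrightarrow> (\<exists>a\<in>N. el a = X)"

definition cd :: "'a set \<Rightarrow> 'a" where
  "cd X = (THE a. a \<in> N \<and> el a = X)"

lemma mem_el: "y \<in> el x \<longleftrightarrow> y \<in> N \<and> E y x"
  by (auto simp: elts_def)

lemma el_N: "y \<in> el x \<Longrightarrow> y \<in> N"
  by (simp add: mem_el)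

lemma el_inj: "x \<in> N \<Longrightarrow> y \<in> N \<Longrightarrow> el x = el y \<Longrightarrow> x = y"
  using ZFC by (auto simp: ZFC_model_def ax_extensionality_def)

lemma small_el [simp]: "a \<in> N \<Longrightarrow> small (el a)"
  by (auto simp: small_def)

lemma cd_el: "a \<in> N \<Longrightarrow> cd (el a) = a"
  unfolding cd_def by (rule the_equality) (auto intro: el_inj)

lemma cd_N [simp]: "small X \<Longrightarrow> cd X \<in> N"
  by (auto simp: small_def cd_el)

lemma el_cd [simp]: "small X \<Longrightarrow> el (cd X) = X"
  by (auto simp: small_def cd_el)

lemma E_cd: "small X \<Longrightarrow> y \<in> N \<Longrightarrow> E y (cd X) \<longleftrightarrow> y \<in> X"
  using mem_el[of y "cd X"] by simp

lemma small_N: "small X \<Longrightarrow> X \<subseteq> N"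
  by (auto simp: small_def mem_el)

text \<open>The source of the definability of \<open>cd\<close>: extensionality expresses its graph
  through membership.\<close>

lemma eq_cd: "small X \<Longrightarrow> a \<in> N \<Longrightarrow> a = cd X \<longleftrightarrow> (\<forall>y\<in>N. E y a \<longleftrightarrow> y \<in> X)"
  using el_inj[of a "cd X"] small_N[of X] by (auto simp: mem_el E_cd set_eq_iff)

lemma df_cong: "(\<And>v. range v \<subseteq> N \<Longrightarrow> P v \<longleftrightarrow> Q v) \<Longrightarrow> df P \<longleftrightarrow> df Q"
  by (rule dfn_cong) simp

lemma df_all:
  assumes "df (\<lambda>v. P (\<lambda>i. v (Suc i)) (v 0))"
  shows "df (\<lambda>v. \<forall>x\<in>N. P v x)"
  using dfn_all[of "{N}" "el ` N" E "\<lambda>_. P"] assms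
    dfn_cong[of "{N}" "\<lambda>M v. \<forall>x\<in>M. P v x" "\<lambda>_ v. \<forall>x\<in>N. P v x"] by simp

lemma df_ex:
  assumes "df (\<lambda>v. P (\<lambda>i. v (Suc i)) (v 0))"
  shows "df (\<lambda>v. \<exists>x\<in>N. P v x)"
  using dfn_not[OF df_all[OF dfn_not[OF assms]]] by simp

text \<open>Formulas have no constant symbols, but \<open>el c\<close> is an admissible class
  parameter and determines \<open>c\<close> by extensionality.\<close>

lemma dt_const: "c \<in> N \<Longrightarrow> dt (\<lambda>v. c)"
proof -
  assume c: "c \<in> N"
  have "df (\<lambda>v. \<forall>z\<in>N. E z (v 0) \<longleftrightarrow> z \<in> el c)"
    by (intro df_all dfn_iff dfn_Mem dtm_var dfn_MemC) (use c in auto)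
  moreover have "(\<forall>z\<in>N. E z (v 0) \<longleftrightarrow> z \<in> el c) \<longleftrightarrow> v 0 = c" if "range v \<subseteq> N" for v
    using eq_cd[of "el c" "v 0"] c that by (auto simp: cd_el)
  ultimately have "df (\<lambda>v. v 0 = c)"
    by (subst (asm) df_cong) auto
  then show ?thesis using c by (simp add: dtm_def)
qed

lemma df_bex_el:
  assumes "dt t" "df (\<lambda>v. P (\<lambda>i. v (Suc i)) (v 0))"
  shows "df (\<lambda>v. \<exists>x\<in>el (t v). P v x)"
proof -
  have "df (\<lambda>v. \<exists>x\<in>N. E x (t v) \<and> P v x)"
    by (intro df_ex dfn_conj dfn_Mem dtm_var dtm_shift assms)
  moreover have "(\<exists>x\<in>N. E x (t v) \<and> P v x) \<longleftrightarrow> (\<exists>x\<in>el (t v). P v x)" for v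
    by (auto simp: elts_def)
  ultimately show ?thesis by (rule iffD1[OF df_cong, rotated])
qed

lemma df_ball_el:
  assumes "dt t" "df (\<lambda>v. P (\<lambda>i. v (Suc i)) (v 0))"
  shows "df (\<lambda>v. \<forall>x\<in>el (t v). P v x)"
  using dfn_not[OF df_bex_el[OF assms(1) dfn_not[OF assms(2)]]] by simp

lemmas df_intros0 = df_bex_el df_ball_el dfn_not dfn_conj dfn_disj dfn_imp dfn_iff dfn_const df_all df_ex
  dfn_Mem dfn_Eq dtm_var dt_const

lemma dtI:
  assumes "\<And>v. range v \<subseteq> N \<Longrightarrow> t v \<in> N" "df (\<lambda>v. v 0 = t (\<lambda>i. v (Suc i)))"
  shows "dt t"
  using assms by (simp add: dtm_def)

lemma dt_fun1:
  assumes "\<And>x. x \<in> N \<Longrightarrow> F x \<in> N" "df (\<lambda>v. v 0 = F (v 1))" "dt s"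
  shows "dt (\<lambda>v. F (s v))"
proof (rule dtI)
  show "F (s v) \<in> N" if "range v \<subseteq> N" for v
    using assms(1) dtm_range[OF assms(3), of N v] that by simp
  show "df (\<lambda>v. v 0 = F (s (\<lambda>i. v (Suc i))))"
    by (rule dfn_subst2[where P = "\<lambda>_ y x. y = F x", OF assms(2) dtm_var dtm_shift[OF assms(3)]])
qed

lemma dt_fun2:
  assumes "\<And>x y. x \<in> N \<Longrightarrow> y \<in> N \<Longrightarrow> F x y \<in> N" "df (\<lambda>v. v 0 = F (v 1) (v 2))" "dt s" "dt t"
  shows "dt (\<lambda>v. F (s v) (t v))"
proof (rule dtI)
  show "F (s v) (t v) \<in> N" if "range v \<subseteq> N" for v
    using assms(1) dtm_range[OF assms(3), of N v] dtm_range[OF assms(4), of N v] that by simp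
  show "df (\<lambda>v. v 0 = F (s (\<lambda>i. v (Suc i))) (t (\<lambda>i. v (Suc i))))"
    by (rule dfn_subst3[where P = "\<lambda>_ z x y. z = F x y",
          OF assms(2) dtm_var dtm_shift[OF assms(3)] dtm_shift[OF assms(4)]])
qed

lemma dt_cd1:
  assumes "\<And>x. x \<in> N \<Longrightarrow> small {y \<in> N. Q x y}" "df (\<lambda>v. Q (v 0) (v 1))" "dt s"
  shows "dt (\<lambda>v. cd {y \<in> N. Q (s v) y})"
proof (rule dt_fun1[where F = "\<lambda>x. cd {y \<in> N. Q x y}", OF _ _ assms(3)])
  have "df (\<lambda>v. \<forall>y\<in>N. E y (v 0) \<longleftrightarrow> Q (v 1) y)"
    by (intro df_intros0 dfn_subst2[where P = "\<lambda>_. Q", OF assms(2)])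
  then show "df (\<lambda>v. v 0 = cd {y \<in> N. Q (v 1) y})"
    by (subst df_cong) (auto simp: eq_cd assms image_subset_iff)
qed (use assms in auto)

lemma dt_cd2:
  assumes "\<And>x x'. x \<in> N \<Longrightarrow> x' \<in> N \<Longrightarrow> small {y \<in> N. Q x x' y}"
    "df (\<lambda>v. Q (v 0) (v 1) (v 2))" "dt s" "dt t"
  shows "dt (\<lambda>v. cd {y \<in> N. Q (s v) (t v) y})"
proof (rule dt_fun2[where F = "\<lambda>x x'. cd {y \<in> N. Q x x' y}", OF _ _ assms(3,4)])
  have "df (\<lambda>v. \<forall>y\<in>N. E y (v 0) \<longleftrightarrow> Q (v 1) (v 2) y)"
    by (intro df_intros0 dfn_subst3[where P = "\<lambda>_. Q", OF assms(2)])
  then show "df (\<lambda>v. v 0 = cd {y \<in> N. Q (v 1) (v 2) y})"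
    by (subst df_cong) (auto simp: eq_cd assms image_subset_iff)
qed (use assms in auto)

lemma N_nonempty: "\<exists>c. c \<in> N"
  using ZFC by (auto simp: ZFC_model_def ax_infinity_def)

section \<open>Elimination of class parameters\<close>

text \<open>The schemata in \<open>ZFC_model\<close> admit no class parameters. Each parameter here
  is the extension of some \<open>c\<close>, so membership in it becomes \<open>Mem\<close> with a
  further variable that is assigned \<open>c\<close>; the odd positions of \<open>mix u w\<close>
  hold these values.\<close>

lemma elim_class_params:
  assumes "class_params p \<subseteq> el ` N"
  shows "\<exists>q w. class_params q = {} \<and> range w \<subseteq> N \<and>
    (\<forall>u. range u \<subseteq> N \<longrightarrow> (sat N E u p \<longleftrightarrow> sat N E (mix u w) q))"
  using assms
proof (induction p)
  case (Mem i j)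
  obtain c where "c \<in> N" using N_nonempty by blast
  then show ?case
    by (intro exI[of _ "Mem (2 * i) (2 * j)"] exI[of _ "\<lambda>_. c"]) (auto simp: mix_def)
next
  case (Eq i j)
  obtain c where "c \<in> N" using N_nonempty by blast
  then show ?case
    by (intro exI[of _ "Eq (2 * i) (2 * j)"] exI[of _ "\<lambda>_. c"]) (auto simp: mix_def)
next
  case (MemC i X)
  then obtain c where "c \<in> N" "X = el c" by auto
  then show ?case
    by (intro exI[of _ "Mem (2 * i) 1"] exI[of _ "\<lambda>_. c"])
      (auto simp: mix_def mem_el image_subset_iff)
next
  case (Neg p)
  then obtain q w where "class_params q = {}" "range w \<subseteq> N"
    "\<And>u. range u \<subseteq> N \<Longrightarrow> sat N E u p \<longleftrightarrow> sat N E (mix u w) q"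
    by auto
  then show ?case
    by (intro exI[of _ "Neg q"] exI[of _ w]) auto
next
  case (Conj p1 p2)
  obtain q1 w1 where 1: "class_params q1 = {}" "range w1 \<subseteq> N"
    "\<And>u. range u \<subseteq> N \<Longrightarrow> sat N E u p1 \<longleftrightarrow> sat N E (mix u w1) q1"
    using Conj by auto
  obtain q2 w2 where 2: "class_params q2 = {}" "range w2 \<subseteq> N"
    "\<And>u. range u \<subseteq> N \<Longrightarrow> sat N E u p2 \<longleftrightarrow> sat N E (mix u w2) q2"
    using Conj by auto
  \<comment> \<open>The parameter at position \<open>2 * b + 1\<close> moves to
    \<open>4 * b + 1\<close> or \<open>4 * b + 3\<close>, where \<open>mix w1 w2\<close> interleaves
    the two parameter lists.\<close>
  define f1 :: "nat \<Rightarrow> nat" where "f1 i = (if even i then i else 4 * (i div 2) + 1)" for i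
  define f2 :: "nat \<Rightarrow> nat" where "f2 i = (if even i then i else 4 * (i div 2) + 3)" for i
  have inj: "inj f1" "inj f2"
    unfolding f1_def f2_def inj_def by (auto split: if_splits) presburger+
  have "(\<lambda>i. mix u (mix w1 w2) (f1 i)) = mix u w1" "(\<lambda>i. mix u (mix w1 w2) (f2 i)) = mix u w2"
    for u :: "nat \<Rightarrow> 'a"
  proof -
    have "(4 * b + 1) div 2 = 2 * b" "(4 * b + 3) div 2 = Suc (2 * b)" for b :: nat
      by presburger+
    then show "(\<lambda>i. mix u (mix w1 w2) (f1 i)) = mix u w1"
        "(\<lambda>i. mix u (mix w1 w2) (f2 i)) = mix u w2" for u :: "nat \<Rightarrow> 'a"
      by (auto simp: fun_eq_iff mix_def f1_def f2_def elim!: oddE)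
  qed
  then show ?case
    using 1 2 inj
    by (intro exI[of _ "Conj (ren f1 q1) (ren f2 q2)"] exI[of _ "mix w1 w2"])
      (simp add: sat_ren range_mix)
next
  case (Forall i p)
  then obtain q w where q: "class_params q = {}" "range w \<subseteq> N"
    "\<And>u. range u \<subseteq> N \<Longrightarrow> sat N E u p \<longleftrightarrow> sat N E (mix u w) q"
    by auto
  have "range (u(i := x)) \<subseteq> N" if "range u \<subseteq> N" "x \<in> N" for u x
    using that by (auto simp: image_subset_iff)
  then show ?case
    using q by (intro exI[of _ "Forall (2 * i) q"] exI[of _ w]) (auto simp: mix_upd)
qed

lemma df_schema:
  assumes "df (\<lambda>v. Q (v 0) (v 1))"
  obtains q w where "class_params q = {}" "range w \<subseteq> N"
    "\<And>x y. x \<in> N \<Longrightarrow> y \<in> N \<Longrightarrow> Q x y \<longleftrightarrow> sat N E (w(0 := x, 1 := y)) q"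
proof -
  obtain p where p: "class_params p \<subseteq> el ` N"
      "\<And>v w. range v \<subseteq> N \<Longrightarrow> range w \<subseteq> N \<Longrightarrow> Q (v 0) (v 1) \<longleftrightarrow> sat N E (mix v w) p"
    using dfnE[OF assms] by (metis singletonI)
  obtain q w where q: "class_params q = {}" "range w \<subseteq> N"
    "\<And>u. range u \<subseteq> N \<Longrightarrow> sat N E u p \<longleftrightarrow> sat N E (mix u w) q"
    using elim_class_params[OF p(1)] by auto
  obtain c where c: "c \<in> N" using N_nonempty by blast
  \<comment> \<open>Interleaving twice puts the second argument at position 4, while the schemata
    expect it at 1; so 1 and 4 are exchanged.\<close>
  define f :: "nat \<Rightarrow> nat" where "f i = (if i = 1 then 4 else if i = 4 then 1 else i)" for i
  have "inj f" by (auto simp: f_def inj_def split: if_splits)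
  define w' where "w' = (\<lambda>i. mix (mix (\<lambda>_. c) (\<lambda>_. c)) w (f i))"
  have *: "(\<lambda>i. (w'(0 := x, 1 := y)) (f i)) = mix (mix ((\<lambda>_. c)(0 := x, 1 := y)) (\<lambda>_. c)) w" for x y
  proof -
    have "i = 4" if "i div 2 div 2 = Suc 0" "even (i div 2)" "even i" for i :: nat
      using that by presburger
    then show ?thesis by (auto simp: fun_eq_iff w'_def f_def mix_def)
  qed
  show ?thesis
  proof (rule that[of "ren f q" w'])
    show "range w' \<subseteq> N" using q(2) c by (auto simp: w'_def mix_def)
    fix x y assume "x \<in> N" "y \<in> N"
    then have "range ((\<lambda>_::nat. c)(0 := x, 1 := y)) \<subseteq> N" using c by auto
    then have "Q x y \<longleftrightarrow> sat N E (mix (mix ((\<lambda>_. c)(0 := x, 1 := y)) (\<lambda>_. c)) w) q"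
      using p(2)[of "(\<lambda>_. c)(0 := x, 1 := y)" "\<lambda>_. c"] c
        q(3)[OF range_mix[of "(\<lambda>_. c)(0 := x, 1 := y)" N "\<lambda>_. c"]] by auto
    then show "Q x y \<longleftrightarrow> sat N E (w'(0 := x, 1 := y)) (ren f q)"
      by (simp only: sat_ren[OF \<open>inj f\<close>] *)
  qed (use q in simp)
qed

section \<open>Separation, replacement and basic set operations\<close>

lemma small_Sep:
  assumes "small X" "df (\<lambda>v. P (v 0))"
  shows "small {x \<in> X. P x}"
proof -
  obtain q w where q: "class_params q = {}" "range w \<subseteq> N"
    "\<And>x y. x \<in> N \<Longrightarrow> y \<in> N \<Longrightarrow> P x \<longleftrightarrow> sat N E (w(0 := x, 1 := y)) q"
    by (rule df_schema[of "\<lambda>x y. P x", OF assms(2)]) blast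
  have q': "P x \<longleftrightarrow> sat N E (w(0 := x)) q" if "x \<in> N" for x
    using q(3)[of x "w 1"] q(2) that by (auto simp: image_subset_iff fun_upd_idem)
  obtain a where a: "a \<in> N" "el a = X" using assms(1) by (auto simp: small_def)
  then obtain b where "b \<in> N" "el b = {x \<in> el a. sat N E (w(0 := x)) q}"
    using ZFC q(1,2) unfolding ZFC_model_def separation_schema_def by blast
  moreover have "{x \<in> el a. sat N E (w(0 := x)) q} = {x \<in> X. P x}"
    using q' a(2) by (auto simp: mem_el)
  ultimately show ?thesis by (auto simp: small_def)
qed

lemma small_image_total:
  assumes "small X" "df (\<lambda>v. Q (v 0) (v 1))" "\<And>x. x \<in> X \<Longrightarrow> \<exists>!y. y \<in> N \<and> Q x y"
  shows "small {y \<in> N. \<exists>x\<in>X. Q x y}"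
proof -
  obtain q w where q: "class_params q = {}" "range w \<subseteq> N"
    "\<And>x y. x \<in> N \<Longrightarrow> y \<in> N \<Longrightarrow> Q x y \<longleftrightarrow> sat N E (w(0 := x, 1 := y)) q"
    by (rule df_schema[OF assms(2)]) blast
  obtain a where a: "a \<in> N" "el a = X" using assms(1) by (auto simp: small_def)
  have *: "y \<in> N \<and> sat N E (w(0 := x, 1 := y)) q \<longleftrightarrow> y \<in> N \<and> Q x y" if "x \<in> X" for x y
    using that q(3) a(2) by (auto simp: mem_el)
  have "\<forall>x\<in>el a. \<exists>!y. y \<in> N \<and> sat N E (w(0 := x, 1 := y)) q"
    using assms(3) * a(2) by simp
  then obtain b where "b \<in> N" "el b = {y \<in> N. \<exists>x\<in>el a. sat N E (w(0 := x, 1 := y)) q}"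
    using ZFC q(1,2) a(1) unfolding ZFC_model_def replacement_schema_def by blast
  moreover have "{y \<in> N. \<exists>x\<in>el a. sat N E (w(0 := x, 1 := y)) q} = {y \<in> N. \<exists>x\<in>X. Q x y}"
    using * a(2) by blast
  ultimately show ?thesis by (auto simp: small_def)
qed

text \<open>Replacement asks for a value at every point, so the domain is first cut down to the
  points where \<open>Q\<close> has one.\<close>

lemma small_image:
  assumes "small X" "df (\<lambda>v. Q (v 0) (v 1))"
    "\<And>x y z. x \<in> X \<Longrightarrow> y \<in> N \<Longrightarrow> z \<in> N \<Longrightarrow> Q x y \<Longrightarrow> Q x z \<Longrightarrow> y = z"
  shows "small {y \<in> N. \<exists>x\<in>X. Q x y}"
proof -
  have "small {x \<in> X. \<exists>y\<in>N. Q x y}"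
    by (rule small_Sep[OF assms(1)])
      (intro df_intros0 dfn_subst2[where P = "\<lambda>_. Q", OF assms(2)])
  then have "small {y \<in> N. \<exists>x\<in>{x \<in> X. \<exists>y\<in>N. Q x y}. Q x y}"
    by (rule small_image_total[OF _ assms(2)]) (use assms(3) in blast)
  moreover have "{y \<in> N. \<exists>x\<in>{x \<in> X. \<exists>y\<in>N. Q x y}. Q x y} = {y \<in> N. \<exists>x\<in>X. Q x y}"
    by blast
  ultimately show ?thesis by simp
qed

lemma small_Union:
  assumes "small X"
  shows "small (\<Union>x\<in>X. el x)"
proof -
  obtain a where "a \<in> N" "el a = X" using assms by (auto simp: small_def)
  then show ?thesis using ZFC by (auto simp: ZFC_model_def ax_union_def small_def)
qed

text \<open>Replacement maps each \<open>x\<close> to the code of its section of \<open>Q\<close>;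
  then the axiom of union applies.\<close>

lemma small_UN:
  assumes "small X" "df (\<lambda>v. Q (v 0) (v 1))" "\<And>x. x \<in> X \<Longrightarrow> small {y \<in> N. Q x y}"
  shows "small {y \<in> N. \<exists>x\<in>X. Q x y}"
proof -
  let ?R = "\<lambda>x z. \<forall>y\<in>N. E y z \<longleftrightarrow> Q x y"
  have R: "?R x z \<longleftrightarrow> z = cd {y \<in> N. Q x y}" if "x \<in> X" "z \<in> N" for x z
    using eq_cd[OF assms(3)[OF that(1)] that(2)] by auto
  have "small {z \<in> N. \<exists>x\<in>X. ?R x z}"
    by (rule small_image[OF assms(1)])
      (use R in \<open>auto intro!: df_intros0 dfn_subst2[where P = "\<lambda>_. Q", OF assms(2)]\<close>)
  then have "small (\<Union>z\<in>{z \<in> N. \<exists>x\<in>X. ?R x z}. el z)"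
    by (rule small_Union)
  moreover have "(\<Union>z\<in>{z \<in> N. \<exists>x\<in>X. ?R x z}. el z) = {y \<in> N. \<exists>x\<in>X. Q x y}"
  proof (intro equalityI subsetI)
    fix y assume "y \<in> {y \<in> N. \<exists>x\<in>X. Q x y}"
    then obtain x where x: "x \<in> X" "y \<in> N" "Q x y" by blast
    have "cd {y \<in> N. Q x y} \<in> N" using assms(3) x by simp
    moreover have "?R x (cd {y \<in> N. Q x y})" using R x(1) calculation by blast
    ultimately show "y \<in> (\<Union>z\<in>{z \<in> N. \<exists>x\<in>X. ?R x z}. el z)"
      using x by (auto simp: mem_el)
  qed (auto simp: mem_el)
  ultimately show ?thesis by simp
qed

lemma small_Pow:
  assumes "small X"
  shows "small {y \<in> N. el y \<subseteq> X}"
proof -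
  obtain a where "a \<in> N" "el a = X" using assms by (auto simp: small_def)
  then show ?thesis using ZFC by (auto simp: ZFC_model_def ax_power_def small_def)
qed

lemma small_pair: "x \<in> N \<Longrightarrow> y \<in> N \<Longrightarrow> small {z \<in> N. z = x \<or> z = y}"
proof -
  assume "x \<in> N" "y \<in> N"
  moreover from this have "{z \<in> N. z = x \<or> z = y} = {x, y}" by auto
  ultimately show ?thesis using ZFC by (simp add: ZFC_model_def ax_pairing_def small_def)
qed

lemma small_Un:
  assumes "small X" "small Y"
  shows "small (X \<union> Y)"
proof -
  have XY: "cd X \<in> N" "cd Y \<in> N" using assms by auto
  have "{z \<in> N. z = cd X \<or> z = cd Y} = {cd X, cd Y}"
    using XY by auto
  then have "X \<union> Y = (\<Union>x\<in>{z \<in> N. z = cd X \<or> z = cd Y}. el x)"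
    using assms by simp
  then show ?thesis using small_Union[OF small_pair[OF XY]] by simp
qed

lemma small_empty: "small {}"
proof -
  obtain c where "c \<in> N" using N_nonempty by blast
  then show ?thesis
    using small_Sep[OF small_el[of c], of "\<lambda>_. False"] by (simp add: dfn_const)
qed

lemma small_single: "x \<in> N \<Longrightarrow> small {x}"
  using small_pair[of x x] by (simp add: conj_commute cong: conj_cong)

lemma small_insert: "x \<in> N \<Longrightarrow> small X \<Longrightarrow> small (insert x X)"
  using small_Un[OF small_single] by fastforce

section \<open>Ordered pairs and coded functions\<close>

definition up :: "'a \<Rightarrow> 'a \<Rightarrow> 'a" where
  "up x y = cd {z \<in> N. z = x \<or> z = y}"

definition pr :: "'a \<Rightarrow> 'a \<Rightarrow> 'a" where
  "pr x y = up (up x x) (up x y)"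

lemma el_up: "x \<in> N \<Longrightarrow> y \<in> N \<Longrightarrow> el (up x y) = {x, y}"
  unfolding up_def using small_pair by auto

lemma up_N: "x \<in> N \<Longrightarrow> y \<in> N \<Longrightarrow> up x y \<in> N"
  unfolding up_def using small_pair by auto

lemma pr_N: "x \<in> N \<Longrightarrow> y \<in> N \<Longrightarrow> pr x y \<in> N"
  by (simp add: pr_def up_N)

lemma dt_up: "dt s \<Longrightarrow> dt t \<Longrightarrow> dt (\<lambda>v. up (s v) (t v))"
  unfolding up_def by (rule dt_cd2) (auto intro: small_pair intro!: df_intros0)

lemma dt_pr: "dt s \<Longrightarrow> dt t \<Longrightarrow> dt (\<lambda>v. pr (s v) (t v))"
  unfolding pr_def by (intro dt_up)

lemma is_pair_iff: "is_pair N E p x y \<longleftrightarrow> x \<in> N \<and> y \<in> N \<and> p = pr x y"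
proof
  assume "is_pair N E p x y"
  then obtain a b where *: "p \<in> N" "x \<in> N" "y \<in> N" "a \<in> N" "b \<in> N"
    "el a = {x}" "el b = {x, y}" "el p = {a, b}"
    unfolding is_pair_def by blast
  then have "a = up x x" "b = up x y"
    using el_inj[of a "up x x"] el_inj[of b "up x y"] by (simp_all add: el_up up_N)
  then show "x \<in> N \<and> y \<in> N \<and> p = pr x y"
    using * el_inj[of p "pr x y"] by (simp add: el_up up_N pr_def)
next
  assume "x \<in> N \<and> y \<in> N \<and> p = pr x y"
  then show "is_pair N E p x y"
    unfolding is_pair_def
    by (intro conjI bexI[of _ "up x x"] bexI[of _ "up x y"]) (auto simp: pr_def el_up up_N)
qed

lemma pr_inj:
  assumes "x \<in> N" "y \<in> N" "x' \<in> N" "y' \<in> N"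
  shows "pr x y = pr x' y' \<longleftrightarrow> x = x' \<and> y = y'"
proof
  assume "pr x y = pr x' y'"
  then have "{up x x, up x y} = {up x' x', up x' y'}"
    using assms by (metis el_up pr_def up_N)
  then have "el ` {up x x, up x y} = el ` {up x' x', up x' y'}" by simp
  then have "{{x}, {x, y}} = {{x'}, {x', y'}}"
    using assms by (simp add: el_up)
  then show "x = x' \<and> y = y'"
    by (metis doubleton_eq_iff insert_absorb2 singleton_insert_inj_eq)
qed auto

lemma dt_fun:
  assumes "dt (\<lambda>v. F (v 0))" "dt s"
  shows "dt (\<lambda>v. F (s v))"
proof (rule dt_fun1[where F = F])
  show "F x \<in> N" if "x \<in> N" for x
    using dtm_range[OF assms(1), of N "\<lambda>_. x"] that by auto
  show "df (\<lambda>v. v 0 = F (v 1))"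
    using assms(1) by (simp add: dtm_def)
qed (rule assms(2))

lemma dt_fun_N: "dt (\<lambda>v. F (v 0)) \<Longrightarrow> x \<in> N \<Longrightarrow> F x \<in> N"
  using dtm_range[of "{N}" _ _ "\<lambda>_ v. F (v 0)" N "\<lambda>_. x"] by auto

lemma small_dt_image:
  assumes "small X" "dt (\<lambda>v. F (v 0))"
  shows "small (F ` X)"
proof -
  note F = dt_fun_N[OF assms(2)]
  have "small {y \<in> N. \<exists>x\<in>X. y = F x}"
  proof (rule small_image[OF assms(1)])
    show "df (\<lambda>v. v 1 = F (v 0))"
      by (intro df_intros0 dt_fun[OF assms(2)])
  qed auto
  moreover have "{y \<in> N. \<exists>x\<in>X. y = F x} = F ` X"
    using F small_N[OF assms(1)] by auto
  ultimately show ?thesis by simp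
qed

lemma small_rel_image: "f \<in> N \<Longrightarrow> x \<in> N \<Longrightarrow> small {y \<in> N. E (pr x y) f}"
proof -
  assume fx: "f \<in> N" "x \<in> N"
  have "small {y \<in> N. \<exists>p\<in>el f. p = pr x y}"
    by (rule small_image) (use fx in \<open>auto intro!: df_intros0 dt_pr simp: pr_inj\<close>)
  moreover have "{y \<in> N. \<exists>p\<in>el f. p = pr x y} = {y \<in> N. E (pr x y) f}"
    using fx by (auto simp: mem_el pr_N)
  ultimately show ?thesis by simp
qed

text \<open>With this reading every element of the model codes a total function.\<close>

definition app :: "'a \<Rightarrow> 'a \<Rightarrow> 'a" where
  "app f x = cd {y \<in> N. E (pr x y) f}"

lemma app_N: "f \<in> N \<Longrightarrow> x \<in> N \<Longrightarrow> app f x \<in> N"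
  unfolding app_def using small_rel_image by auto

lemma E_app: "f \<in> N \<Longrightarrow> x \<in> N \<Longrightarrow> y \<in> N \<Longrightarrow> E y (app f x) \<longleftrightarrow> E (pr x y) f"
  unfolding app_def using small_rel_image by (auto simp: E_cd)

lemma dt_app: "dt s \<Longrightarrow> dt t \<Longrightarrow> dt (\<lambda>v. app (s v) (t v))"
  unfolding app_def
  by (rule dt_cd2[where Q = "\<lambda>f x y. E (pr x y) f"])
    (auto intro: small_rel_image intro!: df_intros0 dt_pr)

lemmas df_intros1 = df_intros0 dt_pr dt_up dt_app

text \<open>In the reading of \<open>app\<close>, the code of \<open>F\<close> on \<open>X\<close>
  consists of the pairs of some \<open>x\<close> in \<open>X\<close> with an element of
  \<open>F x\<close>. That the code contains nothing else yields the normal form \<open>nrm\<close>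
  later.\<close>

lemma lambda_ex:
  assumes "small X" "dt (\<lambda>v. F (v 0))"
  shows "\<exists>f\<in>N. (\<forall>x\<in>X. app f x = F x) \<and> (\<forall>p\<in>el f. \<exists>x\<in>X. \<exists>y\<in>N. p = pr x y)"
proof -
  note FN = dt_fun_N[OF assms(2)]
  have XN: "x \<in> N" if "x \<in> X" for x using small_N[OF assms(1)] that by auto
  let ?Q = "\<lambda>x p. \<exists>y\<in>N. E y (F x) \<and> p = pr x y"
  have "small {p \<in> N. \<exists>x\<in>X. ?Q x p}"
  proof (rule small_UN[OF assms(1)])
    show "df (\<lambda>v. ?Q (v 0) (v 1))"
      by (intro df_intros1 dt_fun[OF assms(2)])
    fix x assume "x \<in> X"
    then have x: "x \<in> N" by (rule XN)
    have "small (pr x ` el (F x))"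
      by (rule small_dt_image) (use x FN in \<open>auto intro!: df_intros1\<close>)
    moreover have "pr x ` el (F x) = {p \<in> N. ?Q x p}"
      using x by (auto simp: mem_el pr_N)
    ultimately show "small {p \<in> N. ?Q x p}" by simp
  qed
  then obtain f where f: "f \<in> N" "el f = {p \<in> N. \<exists>x\<in>X. ?Q x p}"
    by (auto simp: small_def)
  have "app f x = F x" if x: "x \<in> X" for x
  proof (rule el_inj)
    have "y \<in> el (app f x) \<longleftrightarrow> y \<in> el (F x)" for y
    proof (cases "y \<in> N")
      case True
      then have "y \<in> el (app f x) \<longleftrightarrow> pr x y \<in> el f"
        using E_app[OF f(1) XN[OF x] True] pr_N[OF XN[OF x] True] by (simp add: mem_el)
      also have "\<dots> \<longleftrightarrow> y \<in> el (F x)"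
        using True XN x by (auto simp: f(2) pr_N pr_inj mem_el)
      finally show ?thesis .
    qed (simp add: mem_el)
    then show "el (app f x) = el (F x)" by blast
  qed (use XN x f FN app_N in auto)
  moreover have "\<forall>p\<in>el f. \<exists>x\<in>X. \<exists>y\<in>N. p = pr x y"
    unfolding f(2) by blast
  ultimately show ?thesis using f(1) by blast
qed

section \<open>Induction along membership\<close>

lemma E_induct [consumes 2, case_names step]:
  assumes "df (\<lambda>v. P (v 0))" "x \<in> N"
    and "\<And>x. x \<in> N \<Longrightarrow> (\<And>y. y \<in> N \<Longrightarrow> E y x \<Longrightarrow> P y) \<Longrightarrow> P x"
  shows "P x"
proof (rule ccontr)
  assume "\<not> P x"
  then obtain y where "y \<in> N" "\<not> P y" "\<forall>z\<in>N. E z y \<longrightarrow> \<not> \<not> P z"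
    using foundation[OF dfn_not[OF assms(1)] assms(2)] by blast
  then show False using assms(3)[of y] by blast
qed

lemma E_irrefl: "x \<in> N \<Longrightarrow> \<not> E x x"
proof -
  have "df (\<lambda>v. \<not> E (v 0) (v 0))" by (intro df_intros1)
  then show "x \<in> N \<Longrightarrow> \<not> E x x" by (rule E_induct) blast+
qed

lemma E_asym: "x \<in> N \<Longrightarrow> y \<in> N \<Longrightarrow> E x y \<Longrightarrow> \<not> E y x"
proof -
  have "df (\<lambda>v. \<forall>y\<in>N. E (v 0) y \<longrightarrow> \<not> E y (v 0))" by (intro df_intros1)
  then have "x \<in> N \<Longrightarrow> \<forall>y\<in>N. E x y \<longrightarrow> \<not> E y x" by (rule E_induct) blast+
  then show "x \<in> N \<Longrightarrow> y \<in> N \<Longrightarrow> E x y \<Longrightarrow> \<not> E y x" by blast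
qed

end

section \<open>Recursion, ordinals, collection and choice\<close>

context zfc
begin

lemma dt_fun_2:
  assumes "dt (\<lambda>v. G (v 0) (v 1))" "dt s" "dt t"
  shows "dt (\<lambda>v. G (s v) (t v))"
proof (rule dt_fun2[where F = G])
  show "G x y \<in> N" if "x \<in> N" "y \<in> N" for x y
    using dtm_range[OF assms(1), of N "(\<lambda>_. x)(1 := y)"] that by (auto simp: image_subset_iff)
  show "df (\<lambda>v. v 0 = G (v 1) (v 2))"
    using assms(1) by (simp add: dtm_def numeral_2_eq_2)
qed (rule assms)+

lemma dt_fun_2_N: "dt (\<lambda>v. G (v 0) (v 1)) \<Longrightarrow> x \<in> N \<Longrightarrow> y \<in> N \<Longrightarrow> G x y \<in> N"
  using dtm_range[of "{N}" _ _ "\<lambda>_ v. G (v 0) (v 1)" N "(\<lambda>_. x)(1 := y)"]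
  by (auto simp: image_subset_iff)

section \<open>Recursion along a set-like relation\<close>

lemma recursion:
  assumes dR: "df (\<lambda>v. R (v 0) (v 1))"
    and clos: "\<And>x. x \<in> N \<Longrightarrow> \<exists>d. small d \<and> x \<in> d \<and> (\<forall>z\<in>d. \<forall>y\<in>N. R y z \<longrightarrow> y \<in> d)"
    and ind: "\<And>P x. df (\<lambda>v. P (v 0)) \<Longrightarrow>
      (\<And>x. x \<in> N \<Longrightarrow> (\<And>y. y \<in> N \<Longrightarrow> R y x \<Longrightarrow> P y) \<Longrightarrow> P x) \<Longrightarrow> x \<in> N \<Longrightarrow> P x"
    and dG: "dt (\<lambda>v. G (v 0) (v 1))"
  shows "\<exists>F. dt (\<lambda>v. F (v 0)) \<and>
    (\<forall>x\<in>N. \<exists>u\<in>N. el u = {p. \<exists>y\<in>N. R y x \<and> p = pr y (F y)} \<and> F x = G x u)"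
proof -
  define App where "App t \<longleftrightarrow> (\<forall>x\<in>N. \<forall>z\<in>N. E (pr x z) t \<longrightarrow>
      (\<forall>y\<in>N. R y x \<longrightarrow> (\<exists>w\<in>N. E (pr y w) t)) \<and>
      (\<exists>u\<in>N. (\<forall>p\<in>N. E p u \<longleftrightarrow> (\<exists>y\<in>N. \<exists>w\<in>N. p = pr y w \<and> R y x \<and> E (pr y w) t)) \<and> z = G x u))"
    for t
  define V where "V x z \<longleftrightarrow> (\<exists>t\<in>N. App t \<and> E (pr x z) t)" for x z
  have dApp: "df (\<lambda>v. App (v 0))"
    unfolding App_def
    by (intro df_intros1 dfn_subst2[where P = "\<lambda>_. R", OF dR] dt_fun_2[OF dG])
  have dV: "df (\<lambda>v. V (v 0) (v 1))"
    unfolding V_def by (intro df_intros1 dfn_subst1[where P = "\<lambda>_. App", OF dApp])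
  note dV' = dfn_subst2[where P = "\<lambda>_. V", OF dV]
  have AppD: "\<exists>u\<in>N. el u = {p. \<exists>y\<in>N. \<exists>w\<in>N. p = pr y w \<and> R y x \<and> E (pr y w) t} \<and> z = G x u"
      "\<forall>y\<in>N. R y x \<longrightarrow> (\<exists>w\<in>N. E (pr y w) t)"
    if "App t" "x \<in> N" "z \<in> N" "E (pr x z) t" for t x z
  proof -
    note * = that(1)[unfolded App_def, THEN bspec, OF that(2), THEN bspec, OF that(3), THEN mp, OF that(4)]
    then obtain u where u: "u \<in> N" "z = G x u"
      "\<forall>p\<in>N. E p u \<longleftrightarrow> (\<exists>y\<in>N. \<exists>w\<in>N. p = pr y w \<and> R y x \<and> E (pr y w) t)"
      by auto
    have "el u = {p. \<exists>y\<in>N. \<exists>w\<in>N. p = pr y w \<and> R y x \<and> E (pr y w) t}"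
      unfolding set_eq_iff mem_el using u(3) pr_N by blast
    then show "\<exists>u\<in>N. el u = {p. \<exists>y\<in>N. \<exists>w\<in>N. p = pr y w \<and> R y x \<and> E (pr y w) t} \<and> z = G x u"
      using u by blast
    show "\<forall>y\<in>N. R y x \<longrightarrow> (\<exists>w\<in>N. E (pr y w) t)"
      using * by (rule conjunct1)
  qed
  have uniq: "\<forall>z\<in>N. \<forall>z'\<in>N. V x z \<longrightarrow> V x z' \<longrightarrow> z = z'" if "x \<in> N" for x
    using _ _ that
  proof (rule ind)
    show "df (\<lambda>v. \<forall>z\<in>N. \<forall>z'\<in>N. V (v 0) z \<longrightarrow> V (v 0) z' \<longrightarrow> z = z')"
      by (intro df_intros1 dV')
    fix x assume x: "x \<in> N"
      and IH: "\<And>y. y \<in> N \<Longrightarrow> R y x \<Longrightarrow> \<forall>z\<in>N. \<forall>z'\<in>N. V y z \<longrightarrow> V y z' \<longrightarrow> z = z'"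
    have sub: "{p. \<exists>y\<in>N. \<exists>w\<in>N. p = pr y w \<and> R y x \<and> E (pr y w) t} \<subseteq>
        {p. \<exists>y\<in>N. \<exists>w\<in>N. p = pr y w \<and> R y x \<and> E (pr y w) s}"
      if ts: "t \<in> N" "App t" "s \<in> N" "App s" "z \<in> N" "E (pr x z) s" for t s z
    proof safe
      fix y w assume y: "y \<in> N" "w \<in> N" "R y x" "E (pr y w) t"
      then obtain w' where w': "w' \<in> N" "E (pr y w') s"
        using AppD(2)[OF ts(4) x ts(5,6)] by blast
      then have "w = w'" using IH[OF y(1,3)] y ts unfolding V_def by blast
      then show "\<exists>y'\<in>N. \<exists>w'\<in>N. pr y w = pr y' w' \<and> R y' x \<and> E (pr y' w') s"
        using y w' by blast
    qed
    show "\<forall>z\<in>N. \<forall>z'\<in>N. V x z \<longrightarrow> V x z' \<longrightarrow> z = z'"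
    proof (intro ballI impI)
      fix z z' assume z: "z \<in> N" "z' \<in> N" "V x z" "V x z'"
      obtain t where t: "t \<in> N" "App t" "E (pr x z) t" using z unfolding V_def by blast
      obtain s where s: "s \<in> N" "App s" "E (pr x z') s" using z unfolding V_def by blast
      obtain u where u: "u \<in> N" "z = G x u"
        "el u = {p. \<exists>y\<in>N. \<exists>w\<in>N. p = pr y w \<and> R y x \<and> E (pr y w) t}"
        using AppD(1)[OF t(2) x z(1) t(3)] by blast
      obtain u' where u': "u' \<in> N" "z' = G x u'"
        "el u' = {p. \<exists>y\<in>N. \<exists>w\<in>N. p = pr y w \<and> R y x \<and> E (pr y w) s}"
        using AppD(1)[OF s(2) x z(2) s(3)] by blast
      have "el u = el u'"
        unfolding u(3) u'(3) using sub[OF t(1,2) s(1,2) z(2) s(3)] sub[OF s(1,2) t(1,2) z(1) t(3)]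
        by (rule subset_antisym)
      then show "z = z'" using u(2) u'(2) el_inj[OF u(1) u'(1)] by simp
    qed
  qed
  have ex: "\<exists>z\<in>N. V x z" if "x \<in> N" for x
    using _ _ that
  proof (rule ind)
    show "df (\<lambda>v. \<exists>z\<in>N. V (v 0) z)"
      by (intro df_intros1 dV')
    fix x assume x: "x \<in> N" and IH: "\<And>y. y \<in> N \<Longrightarrow> R y x \<Longrightarrow> \<exists>z\<in>N. V y z"
    show "\<exists>z\<in>N. V x z"
    proof (rule ccontr)
      \<comment> \<open>The aim is that \<open>V\<close> on \<open>d\<close>, together with the new
        pair \<open>(x, z)\<close>, is an approximation. As long as \<open>V\<close> has no value at
        \<open>x\<close>, a predecessor with a value differs from \<open>x\<close>, so the new pair
        does not disturb the values below.\<close>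
      assume no: "\<not> (\<exists>z\<in>N. V x z)"
      obtain d where d: "small d" "x \<in> d" "\<forall>z\<in>d. \<forall>y\<in>N. R y z \<longrightarrow> y \<in> d"
        using clos[OF x] by blast
      have dN: "d \<subseteq> N" using small_N d by blast
      let ?Q = "\<lambda>y p. \<exists>w\<in>N. V y w \<and> p = pr y w"
      have sm: "small {p \<in> N. \<exists>y\<in>D. ?Q y p}" if "small D" for D
      proof (rule small_image[OF that])
        show "df (\<lambda>v. ?Q (v 0) (v 1))" by (intro df_intros1 dV')
        show "p = q" if "y \<in> D" "p \<in> N" "q \<in> N" "?Q y p" "?Q y q" for y p q
          using that uniq[of y] small_N[OF \<open>small D\<close>] by blast
      qed
      define u where "u = {p \<in> N. \<exists>y\<in>{y \<in> d. R y x}. ?Q y p}"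
      have u: "small u"
        unfolding u_def
        by (intro sm small_Sep d(1) dfn_subst2[where P = "\<lambda>_. R", OF dR] dtm_var dt_const x)
      define z where "z = G x (cd u)"
      have z: "z \<in> N" unfolding z_def by (intro dt_fun_2_N[OF dG] x cd_N u)
      define t where "t = cd (insert (pr x z) {p \<in> N. \<exists>y\<in>d. ?Q y p})"
      have sm_t: "small (insert (pr x z) {p \<in> N. \<exists>y\<in>d. ?Q y p})"
        by (intro small_insert sm d(1) pr_N x z)
      then have tN: "t \<in> N" unfolding t_def by (rule cd_N)
      have t: "E (pr a b) t \<longleftrightarrow> a = x \<and> b = z \<or> a \<in> d \<and> V a b" if "a \<in> N" "b \<in> N" for a b
        unfolding t_def E_cd[OF sm_t pr_N[OF that]]
        using pr_N that x z dN by (auto simp: pr_inj subset_iff)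
      have t_pred: "E (pr a b) t \<longleftrightarrow> V a b" if "a \<in> N" "b \<in> N" "R a c" "c \<in> d" "\<exists>w\<in>N. V a w" for a b c
        using t[OF that(1,2)] that d(3) no by blast
      have "App t"
        unfolding App_def
      proof (intro ballI impI)
        fix a b assume ab: "a \<in> N" "b \<in> N" "E (pr a b) t"
        show "(\<forall>y\<in>N. R y a \<longrightarrow> (\<exists>w\<in>N. E (pr y w) t)) \<and>
          (\<exists>u\<in>N. (\<forall>p\<in>N. E p u \<longleftrightarrow> (\<exists>y\<in>N. \<exists>w\<in>N. p = pr y w \<and> R y a \<and> E (pr y w) t)) \<and> b = G a u)"
        proof (cases "a = x \<and> b = z")
          case True
          then have a: "a = x" "b = z" by auto
          have tV: "E (pr y w) t \<longleftrightarrow> V y w" if "y \<in> N" "w \<in> N" "R y x" for y w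
            using t_pred[OF that d(2)] IH that by blast
          have 1: "\<forall>y\<in>N. R y x \<longrightarrow> (\<exists>w\<in>N. E (pr y w) t)"
            using IH tV by blast
          have 2: "E p (cd u) \<longleftrightarrow> (\<exists>y\<in>N. \<exists>w\<in>N. p = pr y w \<and> R y x \<and> E (pr y w) t)" if "p \<in> N" for p
          proof -
            have "{y \<in> d. R y x} = {y \<in> N. R y x}" using d(2,3) dN by blast
            then have "p \<in> u \<longleftrightarrow> (\<exists>y\<in>N. \<exists>w\<in>N. p = pr y w \<and> R y x \<and> V y w)"
              using that unfolding u_def by auto
            then have "E p (cd u) \<longleftrightarrow> (\<exists>y\<in>N. \<exists>w\<in>N. p = pr y w \<and> R y x \<and> V y w)"
              by (simp only: E_cd[OF u that])
            also have "\<dots> \<longleftrightarrow> (\<exists>y\<in>N. \<exists>w\<in>N. p = pr y w \<and> R y x \<and> E (pr y w) t)"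
              using tV by (intro bex_cong) auto
            finally show ?thesis .
          qed
          show ?thesis
            unfolding a using 1 2 cd_N[OF u] z_def by blast
        next
          case False
          then have a: "a \<in> d" "V a b" using t[OF ab(1,2)] ab(3) by auto
          \<comment> \<open>An old pair comes from some approximation \<open>s\<close>. Below
            \<open>a\<close> the sets \<open>s\<close> and \<open>t\<close> contain the same pairs,
            so the clause for \<open>s\<close> carries over to \<open>t\<close>.\<close>
          obtain s where s: "s \<in> N" "App s" "E (pr a b) s"
            using a(2) unfolding V_def by blast
          have sV: "V y w \<longleftrightarrow> E (pr y w) s" if yw: "y \<in> N" "w \<in> N" "R y a" for y w
          proof
            assume "V y w"
            obtain w' where "w' \<in> N" "E (pr y w') s"
              using AppD(2)[OF s(2) ab(1,2) s(3)] yw by blast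
            moreover from this have "V y w'" using s unfolding V_def by blast
            ultimately show "E (pr y w) s" using uniq[OF yw(1)] yw(2) \<open>V y w\<close> by blast
          qed (use s in \<open>auto simp: V_def\<close>)
          have exw: "\<exists>w\<in>N. V y w" if "y \<in> N" "R y a" for y
            using AppD(2)[OF s(2) ab(1,2) s(3)] that sV by blast
          have tV: "E (pr y w) t \<longleftrightarrow> E (pr y w) s" if "y \<in> N" "w \<in> N" "R y a" for y w
            using t_pred[OF that a(1) exw[OF that(1,3)]] sV[OF that] by simp
          note * = s(2)[unfolded App_def, THEN bspec, OF ab(1), THEN bspec, OF ab(2), THEN mp, OF s(3)]
          then obtain u where u: "u \<in> N" "b = G a u"
            "\<forall>p\<in>N. E p u \<longleftrightarrow> (\<exists>y\<in>N. \<exists>w\<in>N. p = pr y w \<and> R y a \<and> E (pr y w) s)"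
            by (elim conjE bexE)
          have "(\<exists>y\<in>N. \<exists>w\<in>N. p = pr y w \<and> R y a \<and> E (pr y w) s) \<longleftrightarrow>
              (\<exists>y\<in>N. \<exists>w\<in>N. p = pr y w \<and> R y a \<and> E (pr y w) t)" for p
            using tV by blast
          then have "\<forall>p\<in>N. E p u \<longleftrightarrow> (\<exists>y\<in>N. \<exists>w\<in>N. p = pr y w \<and> R y a \<and> E (pr y w) t)"
            using u(3) by simp
          moreover have "\<forall>y\<in>N. R y a \<longrightarrow> (\<exists>w\<in>N. E (pr y w) t)"
            using conjunct1[OF *] tV by (meson)
          ultimately show ?thesis using u(1,2) by blast
        qed
      qed
      then have "V x z" using tN t[OF x z] unfolding V_def by blast
      then show False using no z by blast
    qed
  qed
  define F where "F x = (THE z. z \<in> N \<and> V x z)" for x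
  have F: "z = F x \<longleftrightarrow> V x z" "F x \<in> N" if "x \<in> N" "z \<in> N" for x z
  proof -
    have "\<exists>!z. z \<in> N \<and> V x z" using ex[OF that(1)] uniq[OF that(1)] by blast
    then have *: "F x \<in> N \<and> V x (F x)" unfolding F_def by (rule theI')
    then show "F x \<in> N" by simp
    show "z = F x \<longleftrightarrow> V x z" using * uniq[OF that(1)] that(2) by blast
  qed
  have "dt (\<lambda>v. F (v 0))"
  proof (rule dtI)
    have "df (\<lambda>v. V (v 1) (v 0))" by (intro dV' dtm_var)
    then show "df (\<lambda>v. v 0 = F (v (Suc 0)))"
      by (subst df_cong) (auto simp: F image_subset_iff)
  qed (use F(2) in \<open>auto simp: image_subset_iff\<close>)
  moreover have "\<exists>u\<in>N. el u = {p. \<exists>y\<in>N. R y x \<and> p = pr y (F y)} \<and> F x = G x u" if x: "x \<in> N" for x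
  proof -
    have FN: "F x \<in> N" "\<And>y. y \<in> N \<Longrightarrow> F y \<in> N" using F(2) x by auto
    obtain t where t: "t \<in> N" "App t" "E (pr x (F x)) t"
      using F(1)[OF x FN(1)] unfolding V_def by blast
    have tV: "E (pr y w) t \<longleftrightarrow> w = F y" if yw: "y \<in> N" "w \<in> N" "R y x" for y w
    proof
      show "E (pr y w) t \<Longrightarrow> w = F y"
        unfolding F(1)[OF yw(1,2)] V_def using t by blast
      obtain w' where w': "w' \<in> N" "E (pr y w') t"
        using AppD(2)[OF t(2) x FN(1) t(3)] yw by blast
      then have "w' = F y" unfolding F(1)[OF yw(1) w'(1)] V_def using t by blast
      then show "w = F y \<Longrightarrow> E (pr y w) t" using w' by simp
    qed
    have "{p. \<exists>y\<in>N. \<exists>w\<in>N. p = pr y w \<and> R y x \<and> E (pr y w) t} = {p. \<exists>y\<in>N. R y x \<and> p = pr y (F y)}"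
      using tV FN by blast
    then show ?thesis using AppD(1)[OF t(2) x FN(1) t(3)] by simp
  qed
  ultimately show ?thesis by blast
qed

section \<open>Transitive sets\<close>

definition tr :: "'a \<Rightarrow> bool" where
  "tr x \<longleftrightarrow> (\<forall>y\<in>N. E y x \<longrightarrow> (\<forall>z\<in>N. E z y \<longrightarrow> E z x))"

lemma df_tr: "dt s \<Longrightarrow> df (\<lambda>v. tr (s v))"
proof -
  have "df (\<lambda>v. tr (v 0))" unfolding tr_def by (intro df_intros1)
  then show "dt s \<Longrightarrow> df (\<lambda>v. tr (s v))" by (rule dfn_subst1[where P = "\<lambda>_. tr"])
qed

text \<open>By induction the elements \<open>y\<close> of \<open>x\<close> have transitive
  supersets. To collect one for each \<open>y\<close> without choice it must be canonical, so the
  intersection \<open>tc y\<close> of all of them is taken. These intersections together with the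
  elements \<open>y\<close> themselves form a transitive set.\<close>

lemma transitive_superset: "x \<in> N \<Longrightarrow> \<exists>t\<in>N. tr t \<and> (\<forall>y\<in>N. E y x \<longrightarrow> E y t)"
proof -
  define tc where "tc x y \<longleftrightarrow> (\<forall>t\<in>N. tr t \<and> (\<forall>y\<in>N. E y x \<longrightarrow> E y t) \<longrightarrow> E y t)" for x y
  have dtc: "df (\<lambda>v. tc (v 0) (v 1))"
    unfolding tc_def by (intro df_intros1 df_tr)
  have "df (\<lambda>v. \<exists>t\<in>N. tr t \<and> (\<forall>y\<in>N. E y (v 0) \<longrightarrow> E y t))"
    by (intro df_intros1 df_tr)
  then show "x \<in> N \<Longrightarrow> \<exists>t\<in>N. tr t \<and> (\<forall>y\<in>N. E y x \<longrightarrow> E y t)"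
  proof (rule E_induct)
    fix x assume x: "x \<in> N"
      and IH: "\<And>y. y \<in> N \<Longrightarrow> E y x \<Longrightarrow> \<exists>t\<in>N. tr t \<and> (\<forall>z\<in>N. E z y \<longrightarrow> E z t)"
    let ?Q = "\<lambda>y z. z = y \<or> tc y z"
    have "small {z \<in> N. \<exists>y\<in>el x. ?Q y z}"
    proof (rule small_UN)
      show "df (\<lambda>v. ?Q (v 0) (v 1))"
        by (intro df_intros1 dfn_subst2[where P = "\<lambda>_. tc", OF dtc])
      fix y assume "y \<in> el x"
      then have y: "y \<in> N" "E y x" by (auto simp: mem_el)
      obtain t where t: "t \<in> N" "tr t" "\<forall>z\<in>N. E z y \<longrightarrow> E z t" using IH[OF y] by blast
      have "small {z \<in> el t. tc y z}"
        by (intro small_Sep small_el t(1) dfn_subst2[where P = "\<lambda>_. tc", OF dtc] dt_const y dtm_var)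
      moreover have "{z \<in> N. ?Q y z} = insert y {z \<in> el t. tc y z}"
        using t y unfolding tc_def by (auto simp: mem_el)
      ultimately show "small {z \<in> N. ?Q y z}"
        using small_insert[OF y(1)] by simp
    qed (use x in simp)
    then obtain t where t: "t \<in> N" "el t = {z \<in> N. \<exists>y\<in>el x. ?Q y z}" by (auto simp: small_def)
    have tE: "E z t \<longleftrightarrow> (\<exists>y\<in>el x. ?Q y z)" if "z \<in> N" for z
      using t(2) that mem_el[of z t] by auto
    have "tr t"
      unfolding tr_def
    proof (intro ballI impI)
      fix z w assume z: "z \<in> N" "E z t" "w \<in> N" "E w z"
      then obtain y where y: "y \<in> el x" "z = y \<or> tc y z" using tE by blast
      have "tc y w"
        using y(2) z unfolding tc_def tr_def by blast
      then show "E w t" using tE[OF z(3)] y(1) by blast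
    qed
    moreover have "E y t" if "y \<in> N" "E y x" for y
      using tE[OF that(1)] that by (auto simp: mem_el)
    ultimately show "\<exists>t\<in>N. tr t \<and> (\<forall>y\<in>N. E y x \<longrightarrow> E y t)"
      using t(1) by blast
  qed
qed

lemma transitive_closed_ex:
  assumes "x \<in> N"
  shows "\<exists>d. small d \<and> x \<in> d \<and> (\<forall>z\<in>d. \<forall>y\<in>N. E y z \<longrightarrow> y \<in> d)"
proof -
  obtain t where t: "t \<in> N" "tr t" "\<forall>y\<in>N. E y x \<longrightarrow> E y t"
    using transitive_superset[OF assms] by blast
  have "small (insert x (el t))"
    using assms t(1) by (simp add: small_insert)
  moreover have "y \<in> insert x (el t)" if "z \<in> insert x (el t)" "y \<in> N" "E y z" for y z
    using that t(2,3) unfolding tr_def insert_iff mem_el by blast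
  ultimately show ?thesis by blast
qed

lemma E_recursion:
  assumes "dt (\<lambda>v. G (v 0) (v 1))"
  shows "\<exists>F. dt (\<lambda>v. F (v 0)) \<and>
    (\<forall>x\<in>N. \<exists>u\<in>N. el u = {p. \<exists>y\<in>N. E y x \<and> p = pr y (F y)} \<and> F x = G x u)"
proof (rule recursion[OF _ transitive_closed_ex _ assms])
  show "df (\<lambda>v. E (v 0) (v 1))" by (intro df_intros1)
  show "P x" if "df (\<lambda>v. P (v 0))" "\<And>x. x \<in> N \<Longrightarrow> (\<And>y. y \<in> N \<Longrightarrow> E y x \<Longrightarrow> P y) \<Longrightarrow> P x" "x \<in> N"
    for P x
    using that(1,3,2) by (rule E_induct)
qed

section \<open>Successors and ordinals\<close>

definition su :: "'a \<Rightarrow> 'a" where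
  "su x = cd {z \<in> N. E z x \<or> z = x}"

lemma su: "x \<in> N \<Longrightarrow> su x \<in> N" "x \<in> N \<Longrightarrow> z \<in> N \<Longrightarrow> E z (su x) \<longleftrightarrow> E z x \<or> z = x"
  and small_su: "x \<in> N \<Longrightarrow> small {z \<in> N. E z x \<or> z = x}"
proof -
  have "small {z \<in> N. E z x \<or> z = x}" if "x \<in> N"
  proof -
    have "{z \<in> N. E z x \<or> z = x} = insert x (el x)" using that by (auto simp: mem_el)
    then show ?thesis using that by (simp add: small_insert)
  qed
  then show "x \<in> N \<Longrightarrow> small {z \<in> N. E z x \<or> z = x}" "x \<in> N \<Longrightarrow> su x \<in> N"
      "x \<in> N \<Longrightarrow> z \<in> N \<Longrightarrow> E z (su x) \<longleftrightarrow> E z x \<or> z = x"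
    unfolding su_def by (auto simp: E_cd)
qed

lemma dt_su: "dt s \<Longrightarrow> dt (\<lambda>v. su (s v))"
  unfolding su_def by (rule dt_cd1[where Q = "\<lambda>x z. E z x \<or> z = x"]) (auto intro!: df_intros1 small_su)

lemma su_inj: "x \<in> N \<Longrightarrow> y \<in> N \<Longrightarrow> su x = su y \<Longrightarrow> x = y"
  using su(2) E_asym by metis

text \<open>Under foundation the hereditarily transitive sets are exactly the ordinals, see
  \<open>ordinal_iff\<close>. Every quantifier is bounded by membership, so the notion is absolute
  for transitive classes, as \<open>Ult_ordinals\<close> exploits.\<close>

definition ordn :: "'a \<Rightarrow> bool" where
  "ordn x \<longleftrightarrow> tr x \<and> (\<forall>y\<in>N. E y x \<longrightarrow> tr y)"

lemma df_ordn: "dt s \<Longrightarrow> df (\<lambda>v. ordn (s v))"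
proof -
  have "df (\<lambda>v. ordn (v 0))" unfolding ordn_def by (intro df_intros1 df_tr)
  then show "dt s \<Longrightarrow> df (\<lambda>v. ordn (s v))" by (rule dfn_subst1[where P = "\<lambda>_. ordn"])
qed

lemma ordn_mem: "ordn x \<Longrightarrow> y \<in> N \<Longrightarrow> E y x \<Longrightarrow> ordn y"
  unfolding ordn_def tr_def by blast

lemma ordn_trans: "ordn x \<Longrightarrow> y \<in> N \<Longrightarrow> z \<in> N \<Longrightarrow> E y x \<Longrightarrow> E z y \<Longrightarrow> E z x"
  unfolding ordn_def tr_def by blast

text \<open>In a minimal incomparable pair every element of one member is an element of the other,
  so extensionality makes them equal. The induction is on \<open>x\<close> for all \<open>y\<close>
  at once, and then on \<open>y\<close>.\<close>

lemma ordn_linear: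
  assumes "x \<in> N" "y \<in> N" "ordn x" "ordn y"
  shows "E x y \<or> x = y \<or> E y x"
proof -
  let ?C = "\<lambda>x y. E x y \<or> x = y \<or> E y x"
  have "ordn x \<longrightarrow> (\<forall>y\<in>N. ordn y \<longrightarrow> ?C x y)"
    using _ assms(1)
  proof (rule E_induct)
    show "df (\<lambda>v. ordn (v 0) \<longrightarrow> (\<forall>y\<in>N. ordn y \<longrightarrow> ?C (v 0) y))"
      by (intro df_intros1 df_ordn)
    fix x assume x: "x \<in> N"
      and IHx: "\<And>z. z \<in> N \<Longrightarrow> E z x \<Longrightarrow> ordn z \<longrightarrow> (\<forall>y\<in>N. ordn y \<longrightarrow> ?C z y)"
    show "ordn x \<longrightarrow> (\<forall>y\<in>N. ordn y \<longrightarrow> ?C x y)"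
    proof (intro impI ballI)
      fix y assume ox: "ordn x" and y: "y \<in> N" and oy: "ordn y"
      have "ordn y \<longrightarrow> ?C x y"
        using _ y
      proof (rule E_induct)
        show "df (\<lambda>v. ordn (v 0) \<longrightarrow> ?C x (v 0))"
          by (intro df_intros1 df_ordn x)
        fix y assume y: "y \<in> N"
          and IHy: "\<And>z. z \<in> N \<Longrightarrow> E z y \<Longrightarrow> ordn z \<longrightarrow> ?C x z"
        show "ordn y \<longrightarrow> ?C x y"
        proof (intro impI, rule ccontr)
          assume oy: "ordn y" and no: "\<not> ?C x y"
          have "E z y" if z: "z \<in> N" "E z x" for z
            using IHx[OF z] ordn_mem[OF ox z] y oy no ordn_trans[OF ox z(1) y z(2)] z by blast
          moreover have "E z x" if z: "z \<in> N" "E z y" for z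
            using IHy[OF z] ordn_mem[OF oy z] x no ordn_trans[OF oy z(1) x z(2)] z by blast
          ultimately have "x = y"
            using el_inj[OF x y] unfolding set_eq_iff mem_el by blast
          then show False using no by simp
        qed
      qed
      then show "?C x y" using oy by simp
    qed
  qed
  then show ?thesis using assms by simp
qed

lemma ordinal_iff: "ordinal N E x \<longleftrightarrow> x \<in> N \<and> ordn x"
proof
  assume x: "ordinal N E x"
  have "tr y" if y: "y \<in> N" "E y x" for y
    unfolding tr_def
  proof (intro ballI impI)
    fix z w assume z: "z \<in> N" "E z y" "w \<in> N" "E w z"
    have sub: "el a \<subseteq> el x" if "a \<in> el x" for a
      using x that unfolding ordinal_def transitive_set_def by blast
    have "y \<in> el x" using y by (simp add: mem_el)
    moreover from this have "z \<in> el x" using sub z by (meson mem_el subsetD)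
    moreover from this have "w \<in> el x" using sub z by (meson mem_el subsetD)
    ultimately have "z \<in> el x" "w \<in> el x" "y \<in> el x" by auto
    then show "E w y"
      using x z unfolding ordinal_def strict_linear_order_on_def by blast
  qed
  then show "x \<in> N \<and> ordn x"
    using x unfolding ordn_def ordinal_def transitive_set_def tr_def[of x] subset_iff Ball_def mem_el
    by blast
next
  assume x: "x \<in> N \<and> ordn x"
  have "\<exists>m\<in>el s. \<forall>y\<in>el s. m = y \<or> E m y"
    if s: "s \<in> N" "el s \<subseteq> el x" "el s \<noteq> {}" for s
  proof -
    obtain y where "y \<in> N" "E y s" using s by (auto simp: mem_el)
    moreover have "df (\<lambda>v. E (v 0) s)" by (intro df_intros1 s)
    ultimately obtain m where m: "m \<in> N" "E m s" "\<forall>z\<in>N. E z m \<longrightarrow> \<not> E z s"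
      using foundation[of "\<lambda>y. E y s" y] by auto
    have "m = y \<or> E m y" if "y \<in> el s" for y
    proof -
      have "ordn m" "ordn y" using m s(2) that x ordn_mem by (auto simp: mem_el subset_iff)
      then show ?thesis using ordn_linear[of m y] m that by (auto simp: mem_el)
    qed
    then show ?thesis using m(1,2) mem_el[of m s] by blast
  qed
  moreover have "strict_linear_order_on (el x) E"
    unfolding strict_linear_order_on_def
  proof (intro conjI ballI impI)
    fix y z w assume "y \<in> el x" "z \<in> el x" "w \<in> el x" "E y z \<and> E z w"
    then show "E y w" using x ordn_mem ordn_trans[of w z y] by (auto simp: mem_el)
  next
    fix y z assume "y \<in> el x" "z \<in> el x"
    then show "y = z \<or> E y z \<or> E z y"
      using x ordn_mem ordn_linear[of y z] by (auto simp: mem_el)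
  qed (auto simp: mem_el E_irrefl)
  moreover have "transitive_set N E x"
    using x unfolding ordn_def tr_def transitive_set_def subset_iff Ball_def mem_el by blast
  ultimately show "ordinal N E x"
    using x unfolding ordinal_def by blast
qed

section \<open>Rank, collection and choice\<close>

lemma rank_ex: "\<exists>rk. dt (\<lambda>v. rk (v 0)) \<and>
  (\<forall>x\<in>N. \<forall>z\<in>N. E z (rk x) \<longleftrightarrow> (\<exists>y\<in>N. E y x \<and> (E z (rk y) \<or> z = rk y)))"
proof -
  let ?q = "\<lambda>p z. \<exists>y\<in>N. \<exists>w\<in>N. p = pr y w \<and> (E z w \<or> z = w)"
  let ?Q = "\<lambda>u z. \<exists>p\<in>el u. ?q p z"
  have sm: "small {z \<in> N. ?Q u z}" if "u \<in> N" for u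
  proof (rule small_UN)
    show "small {z \<in> N. ?q p z}" if "p \<in> el u" for p
    proof (cases "\<exists>y\<in>N. \<exists>w\<in>N. p = pr y w")
      case True
      then obtain y w where "y \<in> N" "w \<in> N" "p = pr y w" by blast
      then show ?thesis using small_su[of w] by (simp add: pr_inj cong: conj_cong)
    next
      case False
      then have "{z \<in> N. ?q p z} = {}" by blast
      then show ?thesis by (simp only: small_empty)
    qed
  qed (use that in \<open>auto intro!: df_intros1\<close>)
  have "df (\<lambda>v. ?Q (v 0) (v 1))"
    by (intro df_intros1)
  then have "dt (\<lambda>v. cd {z \<in> N. ?Q (v 1) z})"
    using sm by (intro dt_cd1[where Q = ?Q]) (auto intro: dtm_var)
  from E_recursion[OF this] obtain rk where rk: "dt (\<lambda>v. rk (v 0))"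
    "\<forall>x\<in>N. \<exists>u\<in>N. el u = {p. \<exists>y\<in>N. E y x \<and> p = pr y (rk y)} \<and> rk x = cd {z \<in> N. ?Q u z}"
    by blast
  note rkN = dt_fun_N[OF rk(1)]
  have "E z (rk x) \<longleftrightarrow> (\<exists>y\<in>N. E y x \<and> (E z (rk y) \<or> z = rk y))" if x: "x \<in> N" and z: "z \<in> N" for x z
  proof -
    obtain u where u: "u \<in> N" "el u = {p. \<exists>y\<in>N. E y x \<and> p = pr y (rk y)}" "rk x = cd {z \<in> N. ?Q u z}"
      using rk(2) x by blast
    have "E z (rk x) \<longleftrightarrow> ?Q u z"
      unfolding u(3) E_cd[OF sm[OF u(1)] z] using z by simp
    also have "\<dots> \<longleftrightarrow> (\<exists>y\<in>N. E y x \<and> (E z (rk y) \<or> z = rk y))"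
      unfolding u(2) using rkN pr_inj by auto
    finally show ?thesis .
  qed
  then show ?thesis using rk(1) by blast
qed

text \<open>Scott's trick: among the witnesses for \<open>x\<close> collect those of least rank.\<close>

lemma collection:
  assumes "small X" "df (\<lambda>v. Q (v 0) (v 1))" "\<And>x. x \<in> X \<Longrightarrow> \<exists>y\<in>N. Q x y"
  shows "\<exists>B. small B \<and> (\<forall>x\<in>X. \<exists>y\<in>B. Q x y)"
proof -
  obtain rk where drk: "dt (\<lambda>v. rk (v 0))" and
    rk: "\<And>x z. x \<in> N \<Longrightarrow> z \<in> N \<Longrightarrow> E z (rk x) \<longleftrightarrow> (\<exists>y\<in>N. E y x \<and> (E z (rk y) \<or> z = rk y))"
    using rank_ex by blast
  note rkN = dt_fun_N[OF drk]
  have ord: "ordn (rk x)" if "x \<in> N" for x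
    using _ that
  proof (rule E_induct)
    show "df (\<lambda>v. ordn (rk (v 0)))" by (intro df_ordn drk)
    fix x assume x: "x \<in> N" and IH: "\<And>y. y \<in> N \<Longrightarrow> E y x \<Longrightarrow> ordn (rk y)"
    have "E w (rk x)" if zw: "z \<in> N" "E z (rk x)" "w \<in> N" "E w z" for z w
    proof -
      obtain y where y: "y \<in> N" "E y x" "E z (rk y) \<or> z = rk y"
        using rk[OF x zw(1)] zw(2) by blast
      then have "E w (rk y)" using IH[OF y(1,2)] ordn_trans zw rkN by blast
      then show ?thesis using rk[OF x zw(3)] y by blast
    qed
    moreover have "tr z" if z: "z \<in> N" "E z (rk x)" for z
    proof -
      obtain y where y: "y \<in> N" "E y x" "E z (rk y) \<or> z = rk y"
        using rk[OF x z(1)] z(2) by blast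
      then show ?thesis using IH[OF y(1,2)] z(1) unfolding ordn_def by blast
    qed
    ultimately show "ordn (rk x)" unfolding ordn_def tr_def[of "rk x"] by blast
  qed
  have level: "small {x \<in> N. E (rk x) r}" if "r \<in> N" for r
  proof -
    have "\<exists>b\<in>N. \<forall>x\<in>N. E x b \<longleftrightarrow> E (rk x) r"
      using _ that
    proof (rule E_induct)
      show "df (\<lambda>v. \<exists>b\<in>N. \<forall>x\<in>N. E x b \<longleftrightarrow> E (rk x) (v 0))"
        by (intro df_intros1 dt_fun[OF drk])
      fix r assume r: "r \<in> N" and IH: "\<And>s. s \<in> N \<Longrightarrow> E s r \<Longrightarrow> \<exists>b\<in>N. \<forall>x\<in>N. E x b \<longleftrightarrow> E (rk x) s"
      \<comment> \<open>\<open>?Q s\<close> defines the power set of the level of ranks below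
        \<open>s\<close>. A set of rank below \<open>r\<close> satisfies \<open>?Q s\<close> for its
        own rank \<open>s\<close>, so these power sets cover the level of \<open>r\<close>.\<close>
      let ?Q = "\<lambda>s x. \<forall>y\<in>N. E y x \<longrightarrow> E (rk y) s"
      have "small {x \<in> N. \<exists>s\<in>el r. ?Q s x}"
      proof (rule small_UN)
        show "df (\<lambda>v. ?Q (v 0) (v 1))" by (intro df_intros1 dt_fun[OF drk])
        fix s assume "s \<in> el r"
        then obtain b where "b \<in> N" "\<forall>x\<in>N. E x b \<longleftrightarrow> E (rk x) s"
          using IH[of s] by (auto simp: mem_el)
        then have "{x \<in> N. ?Q s x} = {x \<in> N. el x \<subseteq> el b}" by (auto simp: mem_el)
        then show "small {x \<in> N. ?Q s x}" using small_Pow[OF small_el[OF \<open>b \<in> N\<close>]] by simp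
      qed (use r in simp)
      then have "small {x \<in> {x \<in> N. \<exists>s\<in>el r. ?Q s x}. E (rk x) r}"
        by (rule small_Sep) (intro df_intros1 dt_fun[OF drk] r)
      moreover have "{x \<in> {x \<in> N. \<exists>s\<in>el r. ?Q s x}. E (rk x) r} = {x \<in> N. E (rk x) r}"
      proof -
        have "\<exists>s\<in>el r. ?Q s x" if "x \<in> N" "E (rk x) r" for x
          using that rk rkN mem_el[of "rk x" r] by blast
        then show ?thesis by blast
      qed
      ultimately have "small {x \<in> N. E (rk x) r}" by simp
      then show "\<exists>b\<in>N. \<forall>x\<in>N. E x b \<longleftrightarrow> E (rk x) r"
        by (intro bexI[of _ "cd {x \<in> N. E (rk x) r}"]) (simp_all add: E_cd)
    qed
    then obtain b where "b \<in> N" "\<forall>x\<in>N. E x b \<longleftrightarrow> E (rk x) r" by blast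
    then have "el b = {x \<in> N. E (rk x) r}" by (auto simp: mem_el)
    then show ?thesis using \<open>b \<in> N\<close> by (metis small_el)
  qed
  let ?M = "\<lambda>x y. Q x y \<and> (\<forall>y'\<in>N. Q x y' \<longrightarrow> \<not> E (rk y') (rk y))"
  have dM: "df (\<lambda>v. ?M (v 0) (v 1))"
    by (intro df_intros1 dt_fun[OF drk] dfn_subst2[where P = "\<lambda>_. Q", OF assms(2)])
  have XN: "x \<in> N" if "x \<in> X" for x using small_N[OF assms(1)] that by auto
  have exM: "\<exists>y\<in>N. ?M x y" if x: "x \<in> X" for x
  proof -
    obtain y where y: "y \<in> N" "Q x y" using assms(3)[OF x] by blast
    have "df (\<lambda>v. \<exists>y\<in>N. Q x y \<and> v 0 = rk y)"
      by (intro df_intros1 dt_fun[OF drk] dfn_subst2[where P = "\<lambda>_. Q", OF assms(2)] XN x)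
    from foundation[OF this rkN[OF y(1)]] y
    obtain r where r: "r \<in> N" "\<exists>y\<in>N. Q x y \<and> r = rk y"
      "\<forall>z\<in>N. E z r \<longrightarrow> \<not> (\<exists>y\<in>N. Q x y \<and> z = rk y)" by blast
    then show ?thesis using rkN by blast
  qed
  have "small {y \<in> N. \<exists>x\<in>X. ?M x y}"
  proof (rule small_UN[OF assms(1) dM])
    fix x assume x: "x \<in> X"
    then obtain y where y: "y \<in> N" "?M x y" using exM by blast
    have s: "su (rk y) \<in> N" using y rkN su by blast
    have "E (rk z) (su (rk y))" if "z \<in> N" "?M x z" for z
      using ordn_linear[of "rk z" "rk y"] ord that y su(2)[of "rk y" "rk z"] rkN by blast
    then have "{z \<in> {z \<in> N. E (rk z) (su (rk y))}. ?M x z} = {z \<in> N. ?M x z}" by blast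
    moreover have "small {z \<in> {z \<in> N. E (rk z) (su (rk y))}. ?M x z}"
      by (intro small_Sep level s dfn_subst2[where P = "\<lambda>_. ?M", OF dM] dt_const dtm_var XN x)
    ultimately show "small {y \<in> N. ?M x y}" by simp
  qed
  then show ?thesis using exM by blast
qed

text \<open>The axiom gives transversals of disjoint families. Once \<open>collection\<close> has
  bounded the witnesses by a set, the candidates for \<open>x\<close> are tagged with
  \<open>x\<close>: the sets \<open>T x\<close> of pairs \<open>(x, y)\<close> are nonempty and
  disjoint, and a transversal picks one \<open>y\<close> for each \<open>x\<close>.\<close>

lemma choice:
  assumes "small X" "df (\<lambda>v. Q (v 0) (v 1))" "\<And>x. x \<in> X \<Longrightarrow> \<exists>y\<in>N. Q x y"
  shows "\<exists>f\<in>N. \<forall>x\<in>X. Q x (app f x)"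
proof -
  note dQ = dfn_subst2[where P = "\<lambda>_. Q", OF assms(2)]
  have XN: "x \<in> N" if "x \<in> X" for x using small_N[OF assms(1)] that by auto
  obtain B where B: "small B" "\<forall>x\<in>X. \<exists>y\<in>B. Q x y"
    using collection[OF assms] by blast
  define b where "b = cd B"
  have b: "b \<in> N" "el b = B" using B by (auto simp: b_def)
  let ?S = "\<lambda>x p. \<exists>y\<in>N. E y b \<and> Q x y \<and> p = pr x y"
  have dS: "df (\<lambda>v. ?S (v 0) (v 1))"
    by (intro df_intros1 dQ b)
  have smS: "small {p \<in> N. ?S x p}" if "x \<in> N" for x
  proof -
    have "small (pr x ` {y \<in> el b. Q x y})"
      by (intro small_dt_image small_Sep small_el b dQ dt_pr dtm_var dt_const that)
    moreover have "pr x ` {y \<in> el b. Q x y} = {p \<in> N. ?S x p}"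
      using that by (auto simp: mem_el pr_N)
    ultimately show ?thesis by simp
  qed
  have dtS: "dt (\<lambda>v. cd {p \<in> N. ?S (v 0) p})"
    by (rule dt_cd1[where Q = ?S]) (use smS dS in \<open>auto intro: dtm_var\<close>)
  define T where "T x = cd {p \<in> N. ?S x p}" for x
  have T: "T x \<in> N" "el (T x) = {p \<in> N. ?S x p}" if "x \<in> N" for x
    using smS[OF that] by (auto simp: T_def)
  have "small (T ` X)"
    using small_dt_image[OF assms(1), of T] dtS unfolding T_def by simp
  then obtain F where F: "F \<in> N" "el F = T ` X" by (auto simp: small_def)
  have ne: "\<forall>y\<in>el F. el y \<noteq> {}"
  proof -
    have "el (T x) \<noteq> {}" if x: "x \<in> X" for x
    proof -
      obtain y where "y \<in> B" "Q x y" using B x by blast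
      then have "y \<in> N" "E y b" using b(2) mem_el[of y b] by auto
      then have "pr x y \<in> el (T x)"
        unfolding T(2)[OF XN[OF x]] using pr_N[OF XN[OF x]] \<open>Q x y\<close> by blast
      then show ?thesis by blast
    qed
    then show ?thesis unfolding F(2) by (metis imageE)
  qed
  have disj: "\<forall>y\<in>el F. \<forall>z\<in>el F. y \<noteq> z \<longrightarrow> el y \<inter> el z = {}"
  proof -
    have "x = x'" if xs: "x \<in> X" "x' \<in> X" "p \<in> el (T x)" "p \<in> el (T x')" for x x' p
      using xs(3,4) pr_inj XN[OF xs(1)] XN[OF xs(2)]
      unfolding T(2)[OF XN[OF xs(1)]] T(2)[OF XN[OF xs(2)]] by auto
    then show ?thesis unfolding F(2) disjoint_iff by (metis imageE)
  qed
  have "ax_choice N E" using ZFC by (simp add: ZFC_model_def)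
  then obtain c where c: "c \<in> N" "\<forall>y\<in>el F. \<exists>!z. z \<in> el c \<inter> el y"
    using F(1) ne disj unfolding ax_choice_def by blast
  have cu: "\<exists>!y. y \<in> N \<and> (E (pr x y) c \<and> E y b \<and> Q x y)" if x: "x \<in> X" for x
  proof -
    have "\<exists>!z. z \<in> el c \<inter> el (T x)" using c F(2) x by blast
    moreover have "z \<in> el c \<inter> el (T x) \<longleftrightarrow> (\<exists>y\<in>N. E (pr x y) c \<and> E y b \<and> Q x y \<and> z = pr x y)" for z
      unfolding T(2)[OF XN[OF x]] Int_iff mem_el[of z c] using pr_N[OF XN[OF x]] by blast
    ultimately have "\<exists>!z. \<exists>y\<in>N. E (pr x y) c \<and> E y b \<and> Q x y \<and> z = pr x y" by simp
    then obtain z where z: "\<exists>y\<in>N. E (pr x y) c \<and> E y b \<and> Q x y \<and> z = pr x y"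
      "\<And>z'. \<exists>y\<in>N. E (pr x y) c \<and> E y b \<and> Q x y \<and> z' = pr x y \<Longrightarrow> z' = z"
      by (rule ex1E) blast
    then obtain y where y: "y \<in> N" "E (pr x y) c" "E y b" "Q x y" "z = pr x y" by blast
    have "y' = y" if "y' \<in> N" "E (pr x y') c" "E y' b" "Q x y'" for y'
      using z(2)[of "pr x y'"] that y(1,5) pr_inj[OF XN[OF x] that(1) XN[OF x] y(1)] by blast
    then show ?thesis using y by blast
  qed
  let ?W = "\<lambda>x w. \<exists>y\<in>N. E (pr x y) c \<and> E y b \<and> Q x y \<and> E w y"
  \<comment> \<open>The transversal is translated into a code for \<open>app\<close>:
    \<open>(x, w)\<close> is included for each element \<open>w\<close> of the chosen
    \<open>y\<close>.\<close>
  let ?H = "\<lambda>x p. \<exists>y\<in>N. E (pr x y) c \<and> E y b \<and> Q x y \<and> (\<exists>w\<in>N. E w y \<and> p = pr x w)"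
  have "small {p \<in> N. \<exists>x\<in>X. ?H x p}"
  proof (rule small_UN[OF assms(1)])
    show "df (\<lambda>v. ?H (v 0) (v 1))" by (intro df_intros1 dQ b c)
    fix x assume x: "x \<in> X"
    obtain y where y: "y \<in> N" "E (pr x y) c" "E y b" "Q x y" using cu[OF x] by blast
    then have "?H x p \<longleftrightarrow> (\<exists>w\<in>N. E w y \<and> p = pr x w)" for p
      using cu[OF x] by blast
    then have "{p \<in> N. ?H x p} = pr x ` el y"
      using XN[OF x] by (auto simp: mem_el pr_N)
    moreover have "small (pr x ` el y)"
      by (intro small_dt_image small_el y df_intros1 XN x)
    ultimately show "small {p \<in> N. ?H x p}" by simp
  qed
  then obtain f where f: "f \<in> N" "el f = {p \<in> N. \<exists>x\<in>X. ?H x p}" by (auto simp: small_def)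
  have "Q x (app f x)" if x: "x \<in> X" for x
  proof -
    obtain y where y: "y \<in> N" "E (pr x y) c" "E y b" "Q x y" using cu[OF x] by blast
    have "app f x = y"
    proof (rule el_inj)
      show "app f x \<in> N" "y \<in> N" using f XN[OF x] y by (auto simp: app_N)
      have "E w (app f x) \<longleftrightarrow> E w y" if w: "w \<in> N" for w
      proof -
        have "E w (app f x) \<longleftrightarrow> pr x w \<in> el f"
          using E_app[OF f(1) XN[OF x] w] pr_N[OF XN[OF x] w] by (simp add: mem_el)
        also have "\<dots> \<longleftrightarrow> (\<exists>x'\<in>X. ?H x' (pr x w))"
          unfolding f(2) using pr_N[OF XN[OF x] w] by simp
        also have "\<dots> \<longleftrightarrow> (\<exists>y\<in>N. E (pr x y) c \<and> E y b \<and> Q x y \<and> E w y)"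
        proof
          assume "\<exists>x'\<in>X. ?H x' (pr x w)"
          then obtain x' y' w' where *: "x' \<in> X" "y' \<in> N" "E (pr x' y') c" "E y' b" "Q x' y'"
            "w' \<in> N" "E w' y'" "pr x w = pr x' w'" by blast
          then have "x' = x" "w' = w" using pr_inj[of x w x' w'] XN x w by auto
          then show "\<exists>y\<in>N. E (pr x y) c \<and> E y b \<and> Q x y \<and> E w y" using * by blast
        qed (use x w in blast)
        also have "\<dots> \<longleftrightarrow> E w y" using cu[OF x] y by blast
        finally show ?thesis .
      qed
      then show "el (app f x) = el y" by (auto simp: mem_el)
    qed
    then show ?thesis using y by simp
  qed
  then show ?thesis using f by blast
qed

end

section \<open>The ultrapower\<close>

locale measure = zfc +
  fixes k u :: 'a
  assumes k_N: "k \<in> N" and u_N: "u \<in> N"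
    and k_unctbl: "uncountable_cardinal N E k"
    and u_ultra: "ultrafilter_on N E k u"
    and u_nonpr: "nonprincipal N E k u"
    and u_compl: "complete_filter N E k u"
begin

section \<open>The quantifier over almost all points\<close>

definition Al :: "('a \<Rightarrow> bool) \<Rightarrow> bool" where
  "Al P \<longleftrightarrow> {x \<in> el k. P x} \<in> family N E u"

lemma Al_iff: "Al P \<longleftrightarrow> (\<exists>s\<in>N. E s u \<and> (\<forall>x\<in>N. E x s \<longleftrightarrow> E x k \<and> P x))"
proof -
  have "{x \<in> el k. P x} = el s \<longleftrightarrow> (\<forall>x\<in>N. E x s \<longleftrightarrow> E x k \<and> P x)" for s
    unfolding set_eq_iff mem_Collect_eq mem_el by blast
  then show ?thesis unfolding Al_def family_def image_iff Bex_def mem_el by auto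
qed

lemma df_Al:
  assumes "df (\<lambda>v. P (\<lambda>i. v (Suc i)) (v 0))"
  shows "df (\<lambda>v. Al (P v))"
proof -
  have "df (\<lambda>v. \<exists>s\<in>N. E s u \<and> (\<forall>x\<in>N. E x s \<longleftrightarrow> E x k \<and> P v x))"
    by (intro df_intros1 u_N k_N
        dfn_ren[OF assms, where f = "\<lambda>i. case i of 0 \<Rightarrow> 0 | Suc j \<Rightarrow> Suc (Suc j)", simplified])
  then show ?thesis unfolding Al_iff .
qed

lemma Al_all: "(\<And>x. x \<in> N \<Longrightarrow> E x k \<Longrightarrow> P x) \<Longrightarrow> Al P"
proof -
  assume "\<And>x. x \<in> N \<Longrightarrow> E x k \<Longrightarrow> P x"
  then have "{x \<in> el k. P x} = el k" by (auto simp: mem_el)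
  then show "Al P" using u_ultra unfolding Al_def ultrafilter_on_def by simp
qed

lemma Al_mono:
  assumes "Al P" "df (\<lambda>v. Q (v 0))" "\<And>x. x \<in> N \<Longrightarrow> E x k \<Longrightarrow> P x \<Longrightarrow> Q x"
  shows "Al Q"
proof -
  have s: "small {x \<in> el k. Q x}"
    by (intro small_Sep small_el k_N assms(2))
  have up: "\<forall>X\<in>family N E u. \<forall>y\<in>N. X \<subseteq> el y \<and> el y \<subseteq> el k \<longrightarrow> el y \<in> family N E u"
    using u_ultra unfolding ultrafilter_on_def by blast
  have "{x \<in> el k. P x} \<subseteq> {x \<in> el k. Q x}"
    using assms(3) by (auto simp: mem_el)
  then show ?thesis
    using up assms(1) cd_N[OF s] unfolding Al_def
    by (metis (no_types, lifting) el_cd[OF s] mem_Collect_eq subsetI)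
qed

lemma Al_conj: "Al P \<Longrightarrow> Al Q \<Longrightarrow> Al (\<lambda>x. P x \<and> Q x)"
proof -
  assume *: "Al P" "Al Q"
  have "{x \<in> el k. P x} \<inter> {x \<in> el k. Q x} = {x \<in> el k. P x \<and> Q x}" by blast
  moreover have "\<forall>X\<in>family N E u. \<forall>Y\<in>family N E u. X \<inter> Y \<in> family N E u"
    using u_ultra unfolding ultrafilter_on_def by blast
  ultimately show ?thesis using * unfolding Al_def by metis
qed

lemma Al_mono2:
  assumes "Al P" "Al Q" "df (\<lambda>v. S (v 0))" "\<And>x. x \<in> N \<Longrightarrow> E x k \<Longrightarrow> P x \<Longrightarrow> Q x \<Longrightarrow> S x"
  shows "Al S"
  using Al_mono[OF Al_conj[OF assms(1,2)] assms(3)] assms(4) by blast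

lemma Al_ex: "Al P \<Longrightarrow> \<exists>x\<in>N. E x k \<and> P x"
proof -
  assume "Al P"
  moreover have "{} \<notin> family N E u" using u_ultra unfolding ultrafilter_on_def by blast
  ultimately have "{x \<in> el k. P x} \<noteq> {}" unfolding Al_def by metis
  then show ?thesis by (auto simp: mem_el)
qed

lemma Al_not:
  assumes "df (\<lambda>v. P (v 0))"
  shows "Al (\<lambda>x. \<not> P x) \<longleftrightarrow> \<not> Al P"
proof
  assume "Al (\<lambda>x. \<not> P x)"
  then show "\<not> Al P" using Al_ex[OF Al_conj] by blast
next
  assume nP: "\<not> Al P"
  have s: "small {x \<in> el k. P x}"
    by (intro small_Sep small_el k_N assms)
  have "\<forall>x\<in>N. el x \<subseteq> el k \<longrightarrow> el x \<in> family N E u \<or> el k - el x \<in> family N E u"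
    using u_ultra unfolding ultrafilter_on_def by blast
  from this[THEN bspec, OF cd_N[OF s]]
  have "{x \<in> el k. P x} \<in> family N E u \<or> el k - {x \<in> el k. P x} \<in> family N E u"
    unfolding el_cd[OF s] by blast
  moreover have "el k - {x \<in> el k. P x} = {x \<in> el k. \<not> P x}" by blast
  ultimately show "Al (\<lambda>x. \<not> P x)" using nP unfolding Al_def by simp
qed

lemma Al_ne: "c \<in> N \<Longrightarrow> E c k \<Longrightarrow> Al (\<lambda>x. x \<noteq> c)"
proof -
  assume c: "c \<in> N" "E c k"
  then have "{x \<in> el k. x = c} = {c}" by (auto simp: mem_el)
  then have "\<not> Al (\<lambda>x. x = c)"
    using u_nonpr c unfolding Al_def nonprincipal_def by (simp add: mem_el)
  then show ?thesis
    by (subst Al_not) (auto intro!: df_intros1 c)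
qed

text \<open>\<open>complete_filter\<close> speaks of sequences that are sets of the model.
  Replacement turns the definable family \<open>P\<close> into such a sequence, which maps
  \<open>i\<close> to the code of its set.\<close>

lemma Al_complete:
  assumes a: "a \<in> N" "E a k" and dP: "df (\<lambda>v. P (v 0) (v 1))"
    and Al: "\<And>i. i \<in> N \<Longrightarrow> E i a \<Longrightarrow> Al (P i)"
  shows "Al (\<lambda>x. \<forall>i\<in>N. E i a \<longrightarrow> P i x)"
proof -
  note dP' = dfn_subst2[where P = "\<lambda>_. P", OF dP]
  let ?A = "\<lambda>i. {x \<in> N. E x k \<and> P i x}"
  have A: "?A i = {x \<in> el k. P i x}" for i by (auto simp: mem_el)
  have sA: "small (?A i)" if "i \<in> N" for i
    unfolding A by (intro small_Sep small_el k_N dP' dtm_var dt_const that)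
  have dA: "dt (\<lambda>v. cd (?A (v 0)))"
    by (rule dt_cd1[where Q = "\<lambda>i x. E x k \<and> P i x"])
      (use sA in \<open>auto intro!: df_intros1 dP' k_N\<close>)
  have "small ((\<lambda>i. pr i (cd (?A i))) ` el a)"
    by (intro small_dt_image small_el a dt_pr dtm_var dA)
  then obtain f where f: "f \<in> N" "el f = (\<lambda>i. pr i (cd (?A i))) ` el a"
    by (auto simp: small_def)
  have rel: "rel N E (el f) i s \<longleftrightarrow> i \<in> el a \<and> s = cd (?A i)" for i s
  proof
    assume "rel N E (el f) i s"
    then obtain j where j: "j \<in> el a" "i \<in> N" "s \<in> N" "pr j (cd (?A j)) = pr i s"
      unfolding rel_def f(2) is_pair_iff by blast
    then show "i \<in> el a \<and> s = cd (?A i)"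
      using pr_inj[of j "cd (?A j)" i s] sA[of j] by (auto simp: el_N)
  next
    assume i: "i \<in> el a \<and> s = cd (?A i)"
    then show "rel N E (el f) i s"
      unfolding rel_def f(2) is_pair_iff using sA[of i] el_N[of i a] by auto
  qed
  have "cd (?A i) \<in> el u" if "i \<in> el a" for i
  proof -
    have "i \<in> N" "E i a" using that by (auto simp: mem_el)
    then have "?A i \<in> family N E u" using Al[of i] unfolding Al_def A by simp
    then obtain s where "s \<in> el u" "el s = ?A i" unfolding family_def by blast
    then show ?thesis using cd_el[of s] by (auto simp: mem_el)
  qed
  moreover have "is_pair N E (pr i (cd (?A i))) i (cd (?A i))" if "i \<in> el a" for i
    unfolding is_pair_iff using sA el_N[OF that] by simp
  ultimately have "\<forall>p\<in>el f. \<exists>x\<in>el a. \<exists>y\<in>el u. is_pair N E p x y"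
    unfolding f(2) by blast
  moreover have "\<exists>!s. rel N E (el f) i s" if "i \<in> el a" for i
    by (rule ex1I[of _ "cd (?A i)"]) (simp_all only: rel that)
  ultimately have "function_from_to N E f a u"
    unfolding function_from_to_def rel_between_def using f(1) by blast
  then have "{x \<in> el k. \<forall>i\<in>el a. \<forall>s. rel N E (el f) i s \<longrightarrow> E x s} \<in> family N E u"
    using u_compl a f(1) unfolding complete_filter_def by (simp add: mem_el)
  moreover have "{x \<in> el k. \<forall>i\<in>el a. \<forall>s. rel N E (el f) i s \<longrightarrow> E x s} =
      {x \<in> el k. \<forall>i\<in>N. E i a \<longrightarrow> P i x}"
    unfolding rel using sA by (auto simp: mem_el E_cd)
  ultimately show ?thesis unfolding Al_def by simp
qed

section \<open>Membership and equality almost everywhere\<close>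

definition es :: "'a \<Rightarrow> 'a \<Rightarrow> bool" where
  "es g f \<longleftrightarrow> Al (\<lambda>x. E (app g x) (app f x))"

definition eqf :: "'a \<Rightarrow> 'a \<Rightarrow> bool" where
  "eqf g f \<longleftrightarrow> Al (\<lambda>x. app g x = app f x)"

text \<open>Pairs with first component outside \<open>k\<close> do not affect the values on
  \<open>k\<close>; excluding them leaves only set many codes with values in a given set.\<close>

definition nrm :: "'a \<Rightarrow> bool" where
  "nrm g \<longleftrightarrow> (\<forall>p\<in>N. E p g \<longrightarrow> (\<exists>x\<in>N. \<exists>y\<in>N. E x k \<and> p = pr x y))"

text \<open>
  Every \<open>g\<close> below \<open>f\<close> in the sense of \<open>es\<close> is almost everywhere equal to a \<open>g'\<close> with \<open>R g' f\<close>, but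
  only set many \<open>g'\<close> are in the relation \<open>R\<close> to \<open>f\<close>; so \<open>R\<close> can be collapsed without choosing
  representatives of the classes of \<open>eqf\<close>.
\<close>

definition R :: "'a \<Rightarrow> 'a \<Rightarrow> bool" where
  "R g f \<longleftrightarrow> es g f \<and> nrm g \<and>
    (\<forall>x\<in>N. E x k \<longrightarrow> E (app g x) (app f x) \<or> (\<forall>z\<in>N. \<not> E z (app g x)))"

lemma df_es: "dt s \<Longrightarrow> dt t \<Longrightarrow> df (\<lambda>v. es (s v) (t v))"
proof -
  have "df (\<lambda>v. es (v 0) (v 1))" unfolding es_def by (intro df_Al df_intros1)
  then show "dt s \<Longrightarrow> dt t \<Longrightarrow> df (\<lambda>v. es (s v) (t v))" by (rule dfn_subst2[where P = "\<lambda>_. es"])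
qed

lemma df_eqf: "dt s \<Longrightarrow> dt t \<Longrightarrow> df (\<lambda>v. eqf (s v) (t v))"
proof -
  have "df (\<lambda>v. eqf (v 0) (v 1))" unfolding eqf_def by (intro df_Al df_intros1)
  then show "dt s \<Longrightarrow> dt t \<Longrightarrow> df (\<lambda>v. eqf (s v) (t v))" by (rule dfn_subst2[where P = "\<lambda>_. eqf"])
qed

lemma df_nrm: "dt s \<Longrightarrow> df (\<lambda>v. nrm (s v))"
proof -
  have "df (\<lambda>v. nrm (v 0))" unfolding nrm_def by (intro df_intros1 k_N)
  then show "dt s \<Longrightarrow> df (\<lambda>v. nrm (s v))" by (rule dfn_subst1[where P = "\<lambda>_. nrm"])
qed

lemma df_R: "dt s \<Longrightarrow> dt t \<Longrightarrow> df (\<lambda>v. R (s v) (t v))"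
proof -
  have "df (\<lambda>v. R (v 0) (v 1))" unfolding R_def by (intro df_intros1 df_es df_nrm k_N)
  then show "dt s \<Longrightarrow> dt t \<Longrightarrow> df (\<lambda>v. R (s v) (t v))" by (rule dfn_subst2[where P = "\<lambda>_. R"])
qed

lemma eqf_sym: "eqf f g \<Longrightarrow> eqf g f"
  unfolding eqf_def by (simp add: eq_commute)

text \<open>Keep the value of \<open>g\<close> where it lies in that of \<open>f\<close>, put the
  empty set at the other points of \<open>k\<close>, and drop all pairs outside \<open>k\<close>. On
  \<open>k\<close> this changes values only on a null set.\<close>

lemma R_normalize:
  assumes "g \<in> N" "f \<in> N" "es g f"
  shows "\<exists>g'\<in>N. R g' f \<and> eqf g g'"
proof -
  let ?Q = "\<lambda>x z. E z (app g x) \<and> E (app g x) (app f x)"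
  have sm: "small {z \<in> N. ?Q x z}" if x: "x \<in> N" for x
  proof -
    have "small {z \<in> el (app g x). E (app g x) (app f x)}"
      by (intro small_Sep small_el app_N assms x dfn_const)
    moreover have "{z \<in> el (app g x). E (app g x) (app f x)} = {z \<in> N. ?Q x z}"
      by (auto simp: mem_el)
    ultimately show ?thesis by simp
  qed
  have "dt (\<lambda>v. cd {z \<in> N. ?Q (v 0) z})"
    by (rule dt_cd1[where Q = ?Q]) (use sm assms in \<open>auto intro!: df_intros1\<close>)
  from lambda_ex[OF small_el[OF k_N] this] obtain g' where g': "g' \<in> N"
    "\<forall>x\<in>el k. app g' x = cd {z \<in> N. ?Q x z}" "\<forall>p\<in>el g'. \<exists>x\<in>el k. \<exists>y\<in>N. p = pr x y"
    by blast
  have pos: "app g' x = app g x" if x: "x \<in> N" "E x k" "E (app g x) (app f x)" for x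
  proof -
    have "{z \<in> N. ?Q x z} = el (app g x)" using x by (auto simp: mem_el)
    then show ?thesis
      using g'(2) x(1,2) cd_el[OF app_N[OF assms(1) x(1)]] by (simp add: mem_el)
  qed
  have neg: "\<not> E z (app g' x)" if x: "x \<in> N" "E x k" "\<not> E (app g x) (app f x)" "z \<in> N" for x z
    using g'(2) x sm[OF x(1)] by (simp add: mem_el E_cd)
  have eq: "eqf g g'"
    unfolding eqf_def
    by (rule Al_mono[OF assms(3)[unfolded es_def]]) (auto intro!: df_intros1 g' assms simp: pos)
  have "es g' f"
    unfolding es_def
    by (rule Al_mono[OF assms(3)[unfolded es_def]]) (auto intro!: df_intros1 g' assms simp: pos)
  moreover have "nrm g'"
    using g'(3) unfolding nrm_def Ball_def Bex_def mem_el by blast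
  moreover have "E (app g' x) (app f x) \<or> (\<forall>z\<in>N. \<not> E z (app g' x))" if "x \<in> N" "E x k" for x
    using pos[OF that] neg[OF that] by metis
  ultimately show ?thesis
    using g'(1) eq unfolding R_def by blast
qed

text \<open>Let \<open>t\<close> be transitive and contain the empty set and all values of
  \<open>f\<close>. Going down along \<open>R\<close>, all values stay in \<open>t\<close>, and
  normal codes with values in \<open>t\<close> are subsets of the product of \<open>k\<close> and
  \<open>t\<close>.\<close>

lemma R_closed_ex:
  assumes f: "f \<in> N"
  shows "\<exists>d. small d \<and> f \<in> d \<and> (\<forall>z\<in>d. \<forall>y\<in>N. R y z \<longrightarrow> y \<in> d)"
proof -
  define em where "em = cd {}"
  have em: "em \<in> N" "el em = {}" using small_empty by (auto simp: em_def)
  have "small (insert em ((\<lambda>x. app f x) ` el k))"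
    by (intro small_insert em small_dt_image small_el k_N df_intros1 f)
  then obtain b where b: "b \<in> N" "el b = insert em ((\<lambda>x. app f x) ` el k)"
    by (auto simp: small_def)
  obtain t where t: "t \<in> N" "tr t" "\<forall>y\<in>N. E y b \<longrightarrow> E y t"
    using transitive_superset[OF b(1)] by blast
  have emt: "E em t" using t(3) em(1) b(2) mem_el[of em b] by blast
  have ft: "E (app f x) t" if "x \<in> N" "E x k" for x
  proof -
    have "app f x \<in> el b" using that b(2) by (simp add: mem_el)
    then show ?thesis using t(3) by (simp add: mem_el)
  qed
  let ?Q = "\<lambda>x p. \<exists>y\<in>N. E y t \<and> p = pr x y"
  have "small {p \<in> N. \<exists>x\<in>el k. ?Q x p}"
  proof (rule small_UN)
    fix x assume x: "x \<in> el k"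
    have "small (pr x ` el t)"
      by (intro small_dt_image small_el t df_intros1) (use x el_N in blast)
    moreover have "pr x ` el t = {p \<in> N. ?Q x p}"
      using el_N[OF x] by (auto simp: mem_el pr_N)
    ultimately show "small {p \<in> N. ?Q x p}" by simp
  qed (auto intro!: df_intros1 small_el k_N t)
  then have "small {g \<in> N. el g \<subseteq> {p \<in> N. \<exists>x\<in>el k. ?Q x p}}" (is "small ?D")
    by (rule small_Pow)
  then have "small {g \<in> ?D. nrm g \<and> (\<forall>x\<in>N. E x k \<longrightarrow> E (app g x) t)}" (is "small ?D'")
    by (rule small_Sep) (intro df_intros1 df_nrm k_N t)
  then have sd: "small (insert f ?D')" by (rule small_insert[OF f])
  have D': "g \<in> ?D'" if g: "g \<in> N" "nrm g" "\<forall>x\<in>N. E x k \<longrightarrow> E (app g x) t" for g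
  proof -
    have "p \<in> {p \<in> N. \<exists>x\<in>el k. ?Q x p}" if p: "p \<in> el g" for p
    proof -
      obtain x y where xy: "x \<in> N" "y \<in> N" "E x k" "p = pr x y"
        using g(2) p unfolding nrm_def mem_el by blast
      then have "E y (app g x)" using E_app[OF g(1) xy(1,2)] p by (simp add: mem_el)
      then have "E y t" using t(2) g(3) xy app_N[OF g(1) xy(1)] unfolding tr_def by blast
      moreover have "x \<in> el k" "p \<in> N" using xy p by (auto simp: mem_el)
      ultimately show ?thesis using xy by blast
    qed
    then show ?thesis using g by blast
  qed
  have "y \<in> insert f ?D'" if z: "z \<in> insert f ?D'" and y: "y \<in> N" "R y z" for y z
  proof -
    have zt: "E (app z x) t" if "x \<in> N" "E x k" for x
      using z ft that by blast
    have zN: "z \<in> N" using z f by blast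
    have "E (app y x) t" if x: "x \<in> N" "E x k" for x
    proof (cases "\<forall>w\<in>N. \<not> E w (app y x)")
      case True
      then have "app y x = em"
        using el_inj[OF app_N[OF y(1) x(1)] em(1)] em(2) unfolding elts_def by auto
      then show ?thesis using emt by simp
    next
      case False
      then have "E (app y x) (app z x)" using y(2) x unfolding R_def by blast
      then show ?thesis
        using t(2) zt[OF x] app_N[OF y(1) x(1)] app_N[OF zN x(1)] unfolding tr_def by blast
    qed
    then have "y \<in> ?D'" using D'[OF y(1)] y(2) unfolding R_def by blast
    then show ?thesis by blast
  qed
  then have "\<forall>z\<in>insert f ?D'. \<forall>y\<in>N. R y z \<longrightarrow> y \<in> insert f ?D'" by simp
  with sd insertI1 show ?thesis by (intro exI conjI)
qed

section \<open>Well-foundedness of the ultrapower\<close>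

text \<open>Uncountability of \<open>k\<close> enters here: with \<open>w\<close> below
  \<open>k\<close>, completeness applies to families indexed by \<open>w\<close>.\<close>

lemma omega_ex: "\<exists>w\<in>N. E w k \<and> ordn w \<and> (\<exists>n\<in>N. E n w) \<and> (\<forall>n\<in>N. E n w \<longrightarrow> E (su n) w)"
proof -
  obtain w where w: "w \<in> el k" "limit_ordinal N E w"
    using k_unctbl unfolding uncountable_cardinal_def is_omega_def by blast
  then have wN: "w \<in> N" "E w k" by (auto simp: mem_el)
  have ow: "ordn w" using w(2) unfolding limit_ordinal_def ordinal_iff by blast
  have "E (su n) w" if n: "n \<in> N" "E n w" for n
  proof -
    obtain z where z: "z \<in> N" "E z w" "E n z"
      using w(2) n mem_el unfolding limit_ordinal_def by blast
    have on: "ordn n" "ordn z" using ordn_mem[OF ow] n z by auto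
    have m: "E y (su n) \<longleftrightarrow> E y n \<or> y = n" if "y \<in> N" for y
      using su(2)[OF n(1) that] .
    have "tr y" if "y \<in> N" "E y (su n)" for y
      using m that on(1) unfolding ordn_def by auto
    moreover have "tr (su n)"
      unfolding tr_def
    proof (intro ballI impI)
      fix y z assume yz: "y \<in> N" "E y (su n)" "z \<in> N" "E z y"
      then have "E z n"
        using ordn_trans[OF on(1) yz(1,3)] m[OF yz(1)] by auto
      then show "E z (su n)" using m[OF yz(3)] by simp
    qed
    ultimately have "ordn (su n)" unfolding ordn_def by blast
    then have "E (su n) z \<or> su n = z \<or> E z (su n)"
      using ordn_linear[of "su n" z] on su n z by blast
    moreover have "\<not> E z (su n)"
      using su(2)[OF n(1) z(1)] z(3) E_asym E_irrefl n z(1) by blast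
    ultimately show ?thesis using z ordn_trans[OF ow z(1) su(1)[OF n(1)] z(2)] by blast
  qed
  moreover have "\<exists>n\<in>N. E n w"
    using w(2) unfolding limit_ordinal_def by (auto simp: elts_def)
  ultimately show ?thesis using wN ow by blast
qed

text \<open>Every non-successor restarts at \<open>f0\<close>. This is harmless for the descent in
  \<open>R_induct\<close>, which only compares the values at \<open>n\<close> and
  \<open>su n\<close>.\<close>

lemma iterate_ex:
  assumes c: "c \<in> N" and f0: "f0 \<in> N"
  shows "\<exists>F. dt (\<lambda>v. F (v 0)) \<and> (\<forall>m\<in>N. F (su m) = app c (F m)) \<and>
    (\<forall>n\<in>N. (\<forall>m\<in>N. n \<noteq> su m) \<longrightarrow> F n = f0)"
proof -
  let ?Q = "\<lambda>n r z. (\<exists>m\<in>N. n = su m \<and> (\<exists>w\<in>N. E (pr m w) r \<and> E z (app c w))) \<or>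
    (\<forall>m\<in>N. n \<noteq> su m) \<and> E z f0"
  have Q_su: "?Q (su m) r z \<longleftrightarrow> (\<exists>w\<in>N. E (pr m w) r \<and> E z (app c w))" if "m \<in> N" for m r z
    using that su_inj by blast
  have Q_lim: "?Q n r z \<longleftrightarrow> E z f0" if "\<forall>m\<in>N. n \<noteq> su m" for n r z
    using that by blast
  have sm: "small {z \<in> N. ?Q n r z}" if nr: "n \<in> N" "r \<in> N" for n r
  proof (cases "\<exists>m\<in>N. n = su m")
    case True
    then obtain m where m: "m \<in> N" "n = su m" by blast
    have "small {z \<in> N. \<exists>w\<in>{w \<in> N. E (pr m w) r}. E z (app c w)}"
    proof (rule small_UN)
      show "small {w \<in> N. E (pr m w) r}" by (rule small_rel_image[OF nr(2) m(1)])
      show "df (\<lambda>v. E (v 1) (app c (v 0)))" by (intro df_intros1 c)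
      fix w assume "w \<in> {w \<in> N. E (pr m w) r}"
      then have "{y \<in> N. E y (app c w)} = el (app c w)" "app c w \<in> N"
        using app_N c by (auto simp: mem_el)
      then show "small {y \<in> N. E y (app c w)}" by simp
    qed
    moreover have "{z \<in> N. \<exists>w\<in>{w \<in> N. E (pr m w) r}. E z (app c w)} = {z \<in> N. ?Q n r z}"
      unfolding m(2) Q_su[OF m(1)] by blast
    ultimately show ?thesis by simp
  next
    case False
    then have "{z \<in> N. ?Q n r z} = el f0" using Q_lim by (auto simp: mem_el)
    then show ?thesis using f0 by simp
  qed
  have dG: "dt (\<lambda>v. cd {z \<in> N. ?Q (v 0) (v 1) z})"
    by (rule dt_cd2[where Q = ?Q]) (use sm in \<open>auto intro!: df_intros1 dt_su c f0\<close>)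
  obtain F where F: "dt (\<lambda>v. F (v 0))"
    "\<forall>n\<in>N. \<exists>r\<in>N. el r = {p. \<exists>y\<in>N. E y n \<and> p = pr y (F y)} \<and> F n = cd {z \<in> N. ?Q n r z}"
    using E_recursion[OF dG] by blast
  note FN = dt_fun_N[OF F(1)]
  have "F (su m) = app c (F m)" if m: "m \<in> N" for m
  proof -
    obtain r where r: "r \<in> N" "el r = {p. \<exists>y\<in>N. E y (su m) \<and> p = pr y (F y)}"
      "F (su m) = cd {z \<in> N. ?Q (su m) r z}"
      using F(2) su(1)[OF m] by blast
    have "E (pr m w) r \<longleftrightarrow> w = F m" if "w \<in> N" for w
    proof -
      have "E (pr m w) r \<longleftrightarrow> pr m w \<in> el r" using pr_N m that by (simp add: mem_el)
      also have "\<dots> \<longleftrightarrow> w = F m"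
        unfolding r(2) using m that FN su(2)[OF m] pr_inj by auto
      finally show ?thesis .
    qed
    then have "{z \<in> N. ?Q (su m) r z} = el (app c (F m))"
      unfolding Q_su[OF m] using FN[OF m] by (auto simp: mem_el)
    then show ?thesis using r(3) cd_el[OF app_N[OF c FN[OF m]]] by simp
  qed
  moreover have "F n = f0" if n: "n \<in> N" "\<forall>m\<in>N. n \<noteq> su m" for n
  proof -
    obtain r where "F n = cd {z \<in> N. ?Q n r z}" using F(2) n(1) by blast
    moreover have "{z \<in> N. ?Q n r z} = el f0"
      unfolding Q_lim[OF n(2)] by (auto simp: mem_el)
    ultimately show ?thesis using cd_el[OF f0] by simp
  qed
  ultimately show ?thesis using F(1) by blast
qed

text \<open>
  A descending sequence of length \<open>\<omega>\<close> would descend pointwise at almost every, hence at some, point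
  of \<open>k\<close>.
\<close>

lemma R_induct:
  assumes dP: "df (\<lambda>v. P (v 0))"
    and step: "\<And>x. x \<in> N \<Longrightarrow> (\<And>y. y \<in> N \<Longrightarrow> R y x \<Longrightarrow> P y) \<Longrightarrow> P x"
    and x: "x \<in> N"
  shows "P x"
proof (rule ccontr)
  assume nP: "\<not> P x"
  obtain d where d: "small d" "x \<in> d" "\<forall>z\<in>d. \<forall>y\<in>N. R y z \<longrightarrow> y \<in> d"
    using R_closed_ex[OF x] by blast
  have "small {f \<in> d. \<not> P f}" by (intro small_Sep d dfn_not dP)
  then obtain s where s: "s \<in> N" "el s = {f \<in> d. \<not> P f}" by (auto simp: small_def)
  have sE: "E f s \<longleftrightarrow> f \<in> d \<and> \<not> P f" if "f \<in> N" for f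
    using s(2) that mem_el[of f s] by auto
  have "\<exists>g\<in>N. E g s \<and> R g f" if "f \<in> el s" for f
  proof -
    have f: "f \<in> d" "\<not> P f" "f \<in> N" using that s(2) el_N[of f s] by auto
    then obtain g where "g \<in> N" "R g f" "\<not> P g" using step by blast
    then show ?thesis using sE d(3) f by blast
  qed
  then have "\<exists>c\<in>N. \<forall>f\<in>el s. E (app c f) s \<and> R (app c f) f"
    by (intro choice[where Q = "\<lambda>f g. E g s \<and> R g f"] small_el s df_intros1 df_R)
  then obtain c where c: "c \<in> N" "\<forall>f\<in>el s. E (app c f) s \<and> R (app c f) f"
    by blast
  obtain F where F: "dt (\<lambda>v. F (v 0))" "\<forall>m\<in>N. F (su m) = app c (F m)"
    "\<forall>n\<in>N. (\<forall>m\<in>N. n \<noteq> su m) \<longrightarrow> F n = x"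
    using iterate_ex[OF c(1) x] by blast
  note FN = dt_fun_N[OF F(1)] and dF = dt_fun[OF F(1)]
  obtain w where w: "w \<in> N" "E w k" "ordn w" "\<exists>n\<in>N. E n w" "\<forall>n\<in>N. E n w \<longrightarrow> E (su n) w"
    using omega_ex by blast
  have Fs: "E n w \<longrightarrow> E (F n) s" if "n \<in> N" for n
    using _ that
  proof (rule E_induct)
    show "df (\<lambda>v. E (v 0) w \<longrightarrow> E (F (v 0)) s)" by (intro df_intros1 dF w s)
    fix n assume n: "n \<in> N" and IH: "\<And>y. y \<in> N \<Longrightarrow> E y n \<Longrightarrow> E y w \<longrightarrow> E (F y) s"
    show "E n w \<longrightarrow> E (F n) s"
    proof (cases "\<exists>m\<in>N. n = su m")
      case True
      then obtain m where m: "m \<in> N" "n = su m" by blast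
      then have "E m n" using su(2) by blast
      then have "E n w \<longrightarrow> E (F m) s" using IH[OF m(1)] ordn_trans[OF w(3) n m(1)] by blast
      then show ?thesis using c(2) F(2) m FN[OF m(1)] by (simp add: mem_el)
    next
      case False
      then show ?thesis using F(3) n sE[OF x] nP d(2) by simp
    qed
  qed
  have "Al (\<lambda>y. \<forall>n\<in>N. E n w \<longrightarrow> E (app (F (su n)) y) (app (F n) y))"
  proof (rule Al_complete[OF w(1,2)])
    show "df (\<lambda>v. E (app (F (su (v 0))) (v 1)) (app (F (v 0)) (v 1)))"
      by (intro df_intros1 dF dt_su)
    fix n assume n: "n \<in> N" "E n w"
    then have "F n \<in> el s" using Fs FN by (simp add: mem_el)
    then have "R (F (su n)) (F n)" using c(2) F(2) n(1) by simp
    then show "Al (\<lambda>y. E (app (F (su n)) y) (app (F n) y))" unfolding R_def es_def by blast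
  qed
  then obtain y where y: "y \<in> N" "\<forall>n\<in>N. E n w \<longrightarrow> E (app (F (su n)) y) (app (F n) y)"
    using Al_ex by blast
  obtain n where n: "n \<in> N" "E n w" using w(4) by blast
  have "df (\<lambda>v. \<exists>n\<in>N. E n w \<and> v 0 = app (F n) y)" by (intro df_intros1 dF w y)
  from foundation[OF this app_N[OF FN[OF n(1)] y(1)]] n
  obtain z where z: "z \<in> N" "\<exists>n\<in>N. E n w \<and> z = app (F n) y"
    "\<forall>z'\<in>N. E z' z \<longrightarrow> \<not> (\<exists>n\<in>N. E n w \<and> z' = app (F n) y)" by blast
  then show False using y w(5) app_N FN su(1) by metis
qed

section \<open>Transitive collapse\<close>

lemma collapse_ex:
  "\<exists>F. dt (\<lambda>v. F (v 0)) \<and> (\<forall>f\<in>N. el (F f) = {z. \<exists>g\<in>N. R g f \<and> z = F g})"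
proof -
  let ?Q = "\<lambda>r z. \<exists>p\<in>el r. \<exists>y\<in>N. p = pr y z"
  have sm: "small {z \<in> N. ?Q r z}" if "r \<in> N" for r
    by (rule small_image) (use that in \<open>auto intro!: df_intros1 simp: pr_inj\<close>)
  have dG: "dt (\<lambda>v. cd {z \<in> N. ?Q (v 1) z})"
    by (rule dt_cd1[where Q = ?Q]) (use sm in \<open>auto intro!: df_intros1\<close>)
  have "\<exists>F. dt (\<lambda>v. F (v 0)) \<and>
    (\<forall>x\<in>N. \<exists>r\<in>N. el r = {p. \<exists>y\<in>N. R y x \<and> p = pr y (F y)} \<and> F x = cd {z \<in> N. ?Q r z})"
  proof (rule recursion[where R = R and G = "\<lambda>x r. cd {z \<in> N. ?Q r z}", OF _ R_closed_ex _ dG])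
    show "df (\<lambda>v. R (v 0) (v 1))" by (intro df_R dtm_var)
    show "P x" if "df (\<lambda>v. P (v 0))" "\<And>x. x \<in> N \<Longrightarrow> (\<And>y. y \<in> N \<Longrightarrow> R y x \<Longrightarrow> P y) \<Longrightarrow> P x" "x \<in> N"
      for P x
      using that by (rule R_induct)
  qed
  then obtain F where F: "dt (\<lambda>v. F (v 0))"
    "\<forall>x\<in>N. \<exists>r\<in>N. el r = {p. \<exists>y\<in>N. R y x \<and> p = pr y (F y)} \<and> F x = cd {z \<in> N. ?Q r z}"
    by blast
  note FN = dt_fun_N[OF F(1)]
  have "el (F f) = {z. \<exists>g\<in>N. R g f \<and> z = F g}" if f: "f \<in> N" for f
  proof -
    obtain r where r: "r \<in> N" "el r = {p. \<exists>y\<in>N. R y f \<and> p = pr y (F y)}"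
      "F f = cd {z \<in> N. ?Q r z}" using F(2) f by blast
    have "?Q r z \<longleftrightarrow> (\<exists>g\<in>N. R g f \<and> z = F g)" if "z \<in> N" for z
      unfolding r(2) using that FN pr_inj by auto
    then show ?thesis
      unfolding r(3) el_cd[OF sm[OF r(1)]] using FN by blast
  qed
  then show ?thesis using F(1) by blast
qed

text \<open>The collapse is taken on functions rather than on their classes; it identifies exactly
  those that agree almost everywhere, see \<open>pi_eq\<close>.\<close>

definition pi :: "'a \<Rightarrow> 'a" where
  "pi = (SOME F. dt (\<lambda>v. F (v 0)) \<and> (\<forall>f\<in>N. el (F f) = {z. \<exists>g\<in>N. R g f \<and> z = F g}))"

lemma dt_pi0: "dt (\<lambda>v. pi (v 0))"
  and el_pi: "f \<in> N \<Longrightarrow> el (pi f) = {z. \<exists>g\<in>N. R g f \<and> z = pi g}"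
  using someI_ex[OF collapse_ex] unfolding pi_def[symmetric] by blast+

lemmas dt_pi = dt_fun[OF dt_pi0] and pi_N = dt_fun_N[OF dt_pi0]

text \<open>Almost equal functions have the same predecessors for \<open>es\<close>, though not
  necessarily for \<open>R\<close>. \<open>R_normalize\<close> exchanges a predecessor of one for an
  almost equal predecessor of the other, and the induction hypothesis identifies the two
  collapses.\<close>

lemma pi_cong:
  assumes "f \<in> N" "f' \<in> N" "eqf f f'"
  shows "pi f = pi f'"
proof -
  have "\<forall>f'\<in>N. eqf f f' \<longrightarrow> pi f = pi f'"
    using _ _ assms(1)
  proof (rule R_induct)
    show "df (\<lambda>v. \<forall>f'\<in>N. eqf (v 0) f' \<longrightarrow> pi (v 0) = pi f')"
      by (intro df_intros1 df_eqf dt_pi)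
    fix f assume f: "f \<in> N"
      and IH: "\<And>g. g \<in> N \<Longrightarrow> R g f \<Longrightarrow> \<forall>g'\<in>N. eqf g g' \<longrightarrow> pi g = pi g'"
    show "\<forall>f'\<in>N. eqf f f' \<longrightarrow> pi f = pi f'"
    proof (intro ballI impI)
      fix f' assume f': "f' \<in> N" "eqf f f'"
      have es: "es g f \<longleftrightarrow> es g f'" if g: "g \<in> N" for g
      proof
        assume "es g f"
        then show "es g f'"
          using f'(2) unfolding es_def eqf_def by (rule Al_mono2) (auto intro!: df_intros1 f' g)
      next
        assume "es g f'"
        then show "es g f"
          using f'(2) unfolding es_def eqf_def by (rule Al_mono2) (auto intro!: df_intros1 f g)
      qed
      have "\<exists>g'\<in>N. R g' f' \<and> pi g = pi g'" if g: "g \<in> N" "R g f" for g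
        using R_normalize[OF g(1) f'(1)] es[OF g(1)] g IH[OF g] unfolding R_def[of g f] by blast
      moreover have "\<exists>g\<in>N. R g f \<and> pi g' = pi g" if g: "g' \<in> N" "R g' f'" for g'
      proof -
        obtain g where "g \<in> N" "R g f" "eqf g' g"
          using R_normalize[OF g(1) f] es[OF g(1)] g unfolding R_def[of g' f'] by blast
        then show ?thesis using IH[of g] eqf_sym g(1) by metis
      qed
      ultimately have "el (pi f) = el (pi f')"
        unfolding el_pi[OF f] el_pi[OF f'(1)] by blast
      then show "pi f = pi f'" using el_inj pi_N f f' by blast
    qed
  qed
  then show ?thesis using assms by blast
qed

lemma es_imp: "g \<in> N \<Longrightarrow> f \<in> N \<Longrightarrow> es g f \<Longrightarrow> E (pi g) (pi f)"
proof -
  assume *: "g \<in> N" "f \<in> N" "es g f"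
  then obtain g' where "g' \<in> N" "R g' f" "eqf g g'" using R_normalize by blast
  then have "pi g \<in> el (pi f)" using el_pi[OF *(2)] pi_cong[OF *(1)] by blast
  then show ?thesis by (simp add: mem_el)
qed

lemma pi_diff:
  assumes f: "f \<in> N" "f' \<in> N"
    and Al: "Al (\<lambda>x. \<exists>z\<in>N. E z (app f x) \<and> \<not> E z (app f' x))"
  obtains g where "g \<in> N" "R g f" "Al (\<lambda>x. \<not> E (app g x) (app f' x))"
proof -
  let ?Q = "\<lambda>x z. (\<exists>z\<in>N. E z (app f x) \<and> \<not> E z (app f' x)) \<longrightarrow> E z (app f x) \<and> \<not> E z (app f' x)"
  have "\<exists>g\<in>N. \<forall>x\<in>el k. ?Q x (app g x)"
  proof (rule choice)
    show "df (\<lambda>v. ?Q (v 0) (v 1))" by (intro df_intros1 f)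
    show "\<exists>z\<in>N. ?Q x z" for x using f(1) by blast
  qed (rule small_el[OF k_N])
  then obtain g where g: "g \<in> N" "\<forall>x\<in>el k. ?Q x (app g x)" by blast
  have "es g f"
    unfolding es_def
    by (rule Al_mono[OF Al]) (use g in \<open>auto intro!: df_intros1 f simp: mem_el\<close>)
  then obtain g' where g': "g' \<in> N" "R g' f" "eqf g g'"
    using R_normalize g(1) f(1) by blast
  have "Al (\<lambda>x. \<not> E (app g' x) (app f' x))"
    by (rule Al_mono2[OF Al g'(3)[unfolded eqf_def]])
      (use g g' in \<open>auto intro!: df_intros1 f simp: mem_el\<close>)
  then show ?thesis using that g' by blast
qed

text \<open>If \<open>f\<close> and \<open>f'\<close> are not almost equal, the ultrafilter makes
  one of the two differences nonempty almost everywhere, and \<open>pi_diff\<close> selects a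
  predecessor from it. Its collapse is also that of a predecessor of the other function, to which it
  is almost equal by induction; a contradiction.\<close>

lemma pi_inj:
  assumes "f \<in> N" "f' \<in> N" "pi f = pi f'"
  shows "eqf f f'"
proof -
  have "\<forall>f'\<in>N. pi f = pi f' \<longrightarrow> eqf f f'"
    using _ _ assms(1)
  proof (rule R_induct)
    show "df (\<lambda>v. \<forall>f'\<in>N. pi (v 0) = pi f' \<longrightarrow> eqf (v 0) f')"
      by (intro df_intros1 df_eqf dt_pi)
    fix f assume f: "f \<in> N"
      and IH: "\<And>g. g \<in> N \<Longrightarrow> R g f \<Longrightarrow> \<forall>g'\<in>N. pi g = pi g' \<longrightarrow> eqf g g'"
    show "\<forall>f'\<in>N. pi f = pi f' \<longrightarrow> eqf f f'"
    proof (intro ballI impI, rule ccontr)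
      fix f' assume f': "f' \<in> N" "pi f = pi f'" "\<not> eqf f f'"
      let ?A = "\<lambda>x. \<exists>z\<in>N. E z (app f x) \<and> \<not> E z (app f' x)"
      let ?B = "\<lambda>x. \<exists>z\<in>N. E z (app f' x) \<and> \<not> E z (app f x)"
      have dA: "df (\<lambda>v. ?A (v 0))" and dB: "df (\<lambda>v. ?B (v 0))"
        by (intro df_intros1 f f')+
      have "Al ?A \<or> Al ?B"
      proof (rule ccontr)
        assume "\<not> (Al ?A \<or> Al ?B)"
        then have "Al (\<lambda>x. \<not> ?A x)" "Al (\<lambda>x. \<not> ?B x)"
          using Al_not[OF dA] Al_not[OF dB] by auto
        then have "eqf f f'"
          unfolding eqf_def
        proof (rule Al_mono2)
          show "df (\<lambda>v. app f (v 0) = app f' (v 0))" by (intro df_intros1 f f')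
          fix x assume x: "x \<in> N" "\<not> ?A x" "\<not> ?B x"
          have "el (app f x) = el (app f' x)"
            unfolding set_eq_iff mem_el using x(2,3) by blast
          then show "app f x = app f' x"
            using el_inj app_N f f' x(1) by blast
        qed
        then show False using f'(3) by simp
      qed
      then show False
      proof
        assume "Al ?A"
        then obtain g where g: "g \<in> N" "R g f" "Al (\<lambda>x. \<not> E (app g x) (app f' x))"
          by (rule pi_diff[OF f f'(1)])
        have "pi g \<in> el (pi f')" using el_pi[OF f] f'(2) g by auto
        then obtain h where h: "h \<in> N" "R h f'" "pi g = pi h" using el_pi[OF f'(1)] by auto
        then have "eqf g h" "es h f'" using IH[OF g(1,2)] unfolding R_def[of h f'] by blast+
        then have "Al (\<lambda>x. E (app g x) (app f' x))"
          unfolding es_def eqf_def by (rule Al_mono2) (auto intro!: df_intros1 g(1) f'(1))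
        from Al_ex[OF Al_conj[OF this g(3)]] show False by blast
      next
        assume "Al ?B"
        then obtain g where g: "g \<in> N" "R g f'" "Al (\<lambda>x. \<not> E (app g x) (app f x))"
          by (rule pi_diff[OF f'(1) f])
        have "pi g \<in> el (pi f)" using el_pi[OF f'(1)] f'(2) g by auto
        then obtain h where h: "h \<in> N" "R h f" "pi h = pi g" using el_pi[OF f] by auto
        then have "eqf h g" "es h f" using IH[OF h(1,2)] g(1) unfolding R_def[of h f] by blast+
        then have "Al (\<lambda>x. E (app g x) (app f x))"
          unfolding es_def eqf_def by (rule Al_mono2) (auto intro!: df_intros1 g(1) f)
        from Al_ex[OF Al_conj[OF this g(3)]] show False by blast
      qed
    qed
  qed
  then show ?thesis using assms by blast
qed

lemma pi_eq: "f \<in> N \<Longrightarrow> g \<in> N \<Longrightarrow> pi f = pi g \<longleftrightarrow> Al (\<lambda>x. app f x = app g x)"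
  using pi_inj pi_cong unfolding eqf_def by blast

lemma pi_mem:
  assumes "g \<in> N" "f \<in> N"
  shows "E (pi g) (pi f) \<longleftrightarrow> Al (\<lambda>x. E (app g x) (app f x))"
proof
  assume "E (pi g) (pi f)"
  then have "pi g \<in> el (pi f)" using pi_N assms by (simp add: mem_el)
  then obtain h where h: "h \<in> N" "R h f" "pi g = pi h" using el_pi[OF assms(2)] by auto
  then have "eqf g h" "es h f" using pi_inj assms unfolding R_def by auto
  then show "Al (\<lambda>x. E (app g x) (app f x))"
    unfolding eqf_def es_def
    by (rule Al_mono2) (auto intro!: df_intros1 assms)
qed (use es_imp assms in \<open>auto simp: es_def\<close>)

section \<open>Los's theorem\<close>

definition Ult :: "'a set" where
  "Ult = pi ` N"

lemma df_sat:
  assumes "class_params p = {}" "\<And>i. dt (t i)"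
  shows "df (\<lambda>v. sat N E (\<lambda>i. t i v) p)"
proof -
  have "dfn {N} (el ` N) E (\<lambda>M v. sat M E (\<lambda>i. t i v) p)"
    by (rule sat_dfn[where t = "\<lambda>i _. t i"]) (use assms in auto)
  then show ?thesis
    by (rule iffD1[OF dfn_cong, rotated]) simp
qed

theorem Los:
  assumes "class_params p = {}" "\<And>i. f i \<in> N"
  shows "sat Ult E (\<lambda>i. pi (f i)) p \<longleftrightarrow> Al (\<lambda>x. sat N E (\<lambda>i. app (f i) x) p)"
  using assms
proof (induction p arbitrary: f)
  case (Mem i j)
  then show ?case by (simp add: pi_mem)
next
  case (Eq i j)
  then show ?case by (simp add: pi_eq)
next
  case (Neg p)
  have "df (\<lambda>v. sat N E (\<lambda>i. app (f i) (v 0)) p)"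
    by (rule df_sat) (use Neg in \<open>auto intro!: df_intros1\<close>)
  then show ?case using Neg by (simp add: Al_not)
next
  case (Conj p q)
  have d: "df (\<lambda>v. sat N E (\<lambda>i. app (f i) (v 0)) p)" "df (\<lambda>v. sat N E (\<lambda>i. app (f i) (v 0)) q)"
    by (rule df_sat; use Conj in \<open>auto intro!: df_intros1\<close>)+
  let ?P = "\<lambda>x. sat N E (\<lambda>i. app (f i) x) p" and ?Q = "\<lambda>x. sat N E (\<lambda>i. app (f i) x) q"
  have "Al ?P \<and> Al ?Q \<longleftrightarrow> Al (\<lambda>x. ?P x \<and> ?Q x)"
    using Al_conj[of ?P ?Q] Al_mono[OF _ d(1), of "\<lambda>x. ?P x \<and> ?Q x"]
      Al_mono[OF _ d(2), of "\<lambda>x. ?P x \<and> ?Q x"] by blast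
  then show ?case using Conj by simp
next
  case (Forall i p)
  have upd: "(\<lambda>j. app ((f(i := g)) j) x) = (\<lambda>j. app (f j) x)(i := app g x)" for g x
    by auto
  have upd': "(\<lambda>j. pi ((f(i := g)) j)) = (\<lambda>j. pi (f j))(i := pi g)" for g
    by auto
  let ?S = "\<lambda>x y. sat N E ((\<lambda>j. app (f j) x)(i := y)) p"
  have dS: "df (\<lambda>v. ?S (v 0) (v 1))"
  proof -
    have "df (\<lambda>v. sat N E (\<lambda>j. if j = i then v 1 else app (f j) (v 0)) p)"
    proof (rule df_sat)
      show "dt (\<lambda>v. if j = i then v 1 else app (f j) (v 0))" for j
        using Forall.prems by (cases "j = i") (auto intro!: df_intros1)
    qed (use Forall.prems in simp)
    moreover have "(\<lambda>j. if j = i then y else app (f j) x) = (\<lambda>j. app (f j) x)(i := y)" for x y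
      by auto
    ultimately show ?thesis by simp
  qed
  note dS' = dfn_subst2[where P = "\<lambda>_. ?S", OF dS]
  have IH: "sat Ult E ((\<lambda>j. pi (f j))(i := pi g)) p \<longleftrightarrow> Al (\<lambda>x. ?S x (app g x))" if "g \<in> N" for g
    using Forall.IH[of "f(i := g)"] Forall.prems that unfolding upd upd' by simp
  have "sat Ult E (\<lambda>j. pi (f j)) (Forall i p) \<longleftrightarrow> (\<forall>g\<in>N. Al (\<lambda>x. ?S x (app g x)))"
    using IH by (simp add: Ult_def)
  also have "\<dots> \<longleftrightarrow> Al (\<lambda>x. \<forall>y\<in>N. ?S x y)"
  proof
    assume L: "\<forall>g\<in>N. Al (\<lambda>x. ?S x (app g x))"
    \<comment> \<open>Choice inside the model gives one function that picks a counterexample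
      wherever there is one.\<close>
    have "\<exists>g\<in>N. \<forall>x\<in>el k. (\<exists>y\<in>N. \<not> ?S x y) \<longrightarrow> \<not> ?S x (app g x)"
    proof (rule choice)
      show "df (\<lambda>v. (\<exists>y\<in>N. \<not> ?S (v 0) y) \<longrightarrow> \<not> ?S (v 0) (v 1))"
        by (intro df_intros1 dS')
      show "\<exists>y\<in>N. (\<exists>y\<in>N. \<not> ?S x y) \<longrightarrow> \<not> ?S x y" for x
        using N_nonempty by blast
    qed (rule small_el[OF k_N])
    then obtain g where g: "g \<in> N" "\<forall>x\<in>el k. (\<exists>y\<in>N. \<not> ?S x y) \<longrightarrow> \<not> ?S x (app g x)" by blast
    show "Al (\<lambda>x. \<forall>y\<in>N. ?S x y)"
    proof (rule Al_mono)
      show "Al (\<lambda>x. ?S x (app g x))" using L g(1) by blast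
      show "df (\<lambda>v. \<forall>y\<in>N. ?S (v 0) y)" by (intro df_intros1 dS')
      show "\<forall>y\<in>N. ?S x y" if "x \<in> N" "E x k" "?S x (app g x)" for x
        using g(2) that mem_el[of x k] by blast
    qed
  next
    assume R: "Al (\<lambda>x. \<forall>y\<in>N. ?S x y)"
    show "\<forall>g\<in>N. Al (\<lambda>x. ?S x (app g x))"
    proof
      fix g assume g: "g \<in> N"
      show "Al (\<lambda>x. ?S x (app g x))"
        by (rule Al_mono[OF R]) (use g app_N in \<open>auto intro!: dS' df_intros1\<close>)
    qed
  qed
  finally show ?case by simp
qed simp

end

section \<open>First-order form of the axioms and of measurability\<close>

text \<open>This set-valued counterpart of \<open>dtm\<close> lets the rules follow the shape of the
  definitions, which are written with \<open>elts\<close>. With \<open>K = UNIV\<close> and no class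
  parameters, one formula serves the model and its ultrapower.\<close>

definition dset ::
    "'a set set \<Rightarrow> 'a set set \<Rightarrow> ('a \<Rightarrow> 'a \<Rightarrow> bool) \<Rightarrow> ('a set \<Rightarrow> (nat \<Rightarrow> 'a) \<Rightarrow> 'a set) \<Rightarrow> bool" where
  "dset K D E S \<longleftrightarrow> (\<forall>M\<in>K. \<forall>v. range v \<subseteq> M \<longrightarrow> S M v \<subseteq> M) \<and>
     dfn K D E (\<lambda>M v. v 0 \<in> S M (\<lambda>i. v (Suc i)))"

lemma dset_sub: "dset K D E S \<Longrightarrow> M \<in> K \<Longrightarrow> range v \<subseteq> M \<Longrightarrow> S M v \<subseteq> M"
  by (simp add: dset_def)

lemma dset_dfn: "dset K D E S \<Longrightarrow> dfn K D E (\<lambda>M v. v 0 \<in> S M (\<lambda>i. v (Suc i)))"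
  by (simp add: dset_def)

lemma dset_shift: "dset K D E S \<Longrightarrow> dset K D E (\<lambda>M v. S M (\<lambda>i. v (Suc i)))"
  unfolding dset_def
  by (auto simp: image_subset_iff
      dest: dfn_ren[where f = "\<lambda>i. case i of 0 \<Rightarrow> 0 | Suc j \<Rightarrow> Suc (Suc j)"])

lemma dfn_in_set: "dtm K D E t \<Longrightarrow> dset K D E S \<Longrightarrow> dfn K D E (\<lambda>M v. t M v \<in> S M v)"
  by (rule dfn_subst[where P = "\<lambda>M v x. x \<in> S M v"]) (auto dest: dset_dfn)

lemma dfn_ball_set:
  assumes "dset K D E S" "dfn K D E (\<lambda>M v. P M (\<lambda>i. v (Suc i)) (v 0))"
  shows "dfn K D E (\<lambda>M v. \<forall>x\<in>S M v. P M v x)"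
proof -
  have "dfn K D E (\<lambda>M v. \<forall>x\<in>M. x \<in> S M v \<longrightarrow> P M v x)"
    by (intro dfn_all dfn_imp assms dset_dfn)
  moreover have "(\<forall>x\<in>M. x \<in> S M v \<longrightarrow> P M v x) \<longleftrightarrow> (\<forall>x\<in>S M v. P M v x)"
    if "M \<in> K" "range v \<subseteq> M" for M v
    using dset_sub[OF assms(1) that] by blast
  ultimately show ?thesis by (rule iffD1[OF dfn_cong, rotated])
qed

lemma dfn_bex_set:
  assumes "dset K D E S" "dfn K D E (\<lambda>M v. P M (\<lambda>i. v (Suc i)) (v 0))"
  shows "dfn K D E (\<lambda>M v. \<exists>x\<in>S M v. P M v x)"
  using dfn_not[OF dfn_ball_set[OF assms(1) dfn_not[OF assms(2)]]] by simp

lemma dfn_subset: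
  assumes "dset K D E S" "dset K D E T"
  shows "dfn K D E (\<lambda>M v. S M v \<subseteq> T M v)"
  unfolding subset_eq by (intro dfn_ball_set assms dset_dfn)

lemma dfn_set_eq:
  assumes "dset K D E S" "dset K D E T"
  shows "dfn K D E (\<lambda>M v. S M v = T M v)"
  unfolding set_eq_subset by (intro dfn_conj dfn_subset assms)

lemma dset_UNIV: "dset K D E (\<lambda>M v. M)"
  unfolding dset_def
proof
  show "dfn K D E (\<lambda>M v. v 0 \<in> M)"
    by (rule iffD1[OF dfn_cong dfn_const[of K D E True]]) auto
qed simp

lemma dset_const: "X \<in> D \<Longrightarrow> (\<And>M. M \<in> K \<Longrightarrow> X \<subseteq> M) \<Longrightarrow> dset K D E (\<lambda>M v. X)"
  unfolding dset_def by (simp add: dfn_MemC_var)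

lemma dset_elts: "dtm K D E t \<Longrightarrow> dset K D E (\<lambda>M v. elts M E (t M v))"
  unfolding dset_def elts_def mem_Collect_eq
  by (intro conjI dfn_conj dfn_Mem dtm_var dtm_shift dfn_in_set dset_UNIV) auto

lemma dset_empty: "dset K D E (\<lambda>M v. {})"
  unfolding dset_def by (simp add: dfn_const)

lemma dset_insert: "dtm K D E t \<Longrightarrow> dset K D E S \<Longrightarrow> dset K D E (\<lambda>M v. insert (t M v) (S M v))"
  unfolding dset_def[of _ _ _ "\<lambda>M v. insert (t M v) (S M v)"] insert_iff
  by (intro conjI dfn_disj dfn_Eq dtm_var dtm_shift dset_dfn)
    (auto dest: dset_sub dtm_range)

lemma dset_Int: "dset K D E S \<Longrightarrow> dset K D E T \<Longrightarrow> dset K D E (\<lambda>M v. S M v \<inter> T M v)"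
  unfolding dset_def Int_iff by (auto intro: dfn_conj)

lemma dset_Diff: "dset K D E S \<Longrightarrow> dset K D E T \<Longrightarrow> dset K D E (\<lambda>M v. S M v - T M v)"
  unfolding dset_def Diff_iff by (auto intro: dfn_conj dfn_not)

lemma dset_Collect:
  assumes "dset K D E S" "dfn K D E (\<lambda>M v. P M (\<lambda>i. v (Suc i)) (v 0))"
  shows "dset K D E (\<lambda>M v. {x \<in> S M v. P M v x})"
  using assms unfolding dset_def by (auto intro: dfn_conj)

lemma dset_UN:
  assumes "dset K D E S" "dset K D E (\<lambda>M v. T M (\<lambda>i. v (Suc i)) (v 0))"
  shows "dset K D E (\<lambda>M v. \<Union>x\<in>S M v. T M v x)"
proof -
  have "dset K D E (\<lambda>M v. {y \<in> M. \<exists>x\<in>S M v. y \<in> T M v x})"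
  proof (intro dset_Collect dset_UNIV dfn_bex_set dset_shift assms)
    have "dset K D E (\<lambda>M v. T M (\<lambda>i. v (Suc i)) (v 0))" by (rule assms)
    from dfn_ren[OF dset_dfn[OF this], where f = "\<lambda>i. case i of 0 \<Rightarrow> 1 | Suc 0 \<Rightarrow> 0 | Suc (Suc j) \<Rightarrow> Suc (Suc j)"]
    show "dfn K D E (\<lambda>M v. v (Suc 0) \<in> T M (\<lambda>i. v (Suc (Suc i))) (v 0))" by simp
  qed
  moreover have "(\<lambda>x. T M v x) ` S M v \<subseteq> Pow M" if "M \<in> K" "range v \<subseteq> M" for M v
  proof -
    have "T M v x \<subseteq> M" if "x \<in> M" for x
      using dset_sub[OF assms(2) \<open>M \<in> K\<close> range_case_nat[OF that \<open>range v \<subseteq> M\<close>]] by simp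
    then show ?thesis using dset_sub[OF assms(1) that] by blast
  qed
  then have "{y \<in> M. \<exists>x\<in>S M v. y \<in> T M v x} = (\<Union>x\<in>S M v. T M v x)" if "M \<in> K" "range v \<subseteq> M" for M v
    using that by blast
  ultimately show ?thesis
    unfolding dset_def
    using dfn_cong[of K "\<lambda>M v. v 0 \<in> {y \<in> M. \<exists>x\<in>S M (\<lambda>i. v (Suc i)). y \<in> T M (\<lambda>i. v (Suc i)) x}"
        "\<lambda>M v. v 0 \<in> (\<Union>x\<in>S M (\<lambda>i. v (Suc i)). T M (\<lambda>i. v (Suc i)) x)" D E]
    by (auto simp: image_subset_iff)
qed

lemmas fo_intros = dfn_not dfn_conj dfn_disj dfn_imp dfn_iff dfn_const dfn_ball_set dfn_bex_set
  dfn_subset dfn_set_eq dfn_in_set dfn_Mem dfn_Eq dtm_var dset_UNIV dset_elts dset_empty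
  dset_insert dset_Int dset_Diff dset_Collect dset_UN

lemma sat_dfn_upd:
  assumes "class_params p \<subseteq> D"
  shows "dfn K D E (\<lambda>M v. sat M E ((\<lambda>i. v (f i))(j := v m)) p)"
proof -
  have "sat M E (\<lambda>i. v (if i = j then m else f i)) p \<longleftrightarrow> sat M E ((\<lambda>i. v (f i))(j := v m)) p" for M v
    by (rule arg_cong[where f = "\<lambda>w. sat M E w p"]) auto
  then show ?thesis
    by (rule iffD1[OF dfn_cong sat_dfn_var[OF assms, of K E "\<lambda>i. if i = j then m else f i"]])
qed

lemma sat_dfn_upd2:
  assumes "class_params p \<subseteq> D"
  shows "dfn K D E (\<lambda>M v. sat M E ((\<lambda>i. v (f i))(j := v m, j' := v m')) p)"
proof -
  have "sat M E (\<lambda>i. v (if i = j' then m' else if i = j then m else f i)) p \<longleftrightarrow> sat M E ((\<lambda>i. v (f i))(j := v m, j' := v m')) p" for M v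
    by (rule arg_cong[where f = "\<lambda>w. sat M E w p"]) auto
  then show ?thesis
    by (rule iffD1[OF dfn_cong sat_dfn_var[OF assms, of K E "\<lambda>i. if i = j' then m' else if i = j then m else f i"]])
qed

text \<open>Relativisation of one fixed formula: its quantifiers become bounded by \<open>S\<close>.
  It is applied to an inner model and to the slices of the indexed family.\<close>

lemma sat_dfn_set:
  assumes "class_params p \<subseteq> D" "dset K D E S"
  shows "dfn K D E (\<lambda>M v. sat (S M v) E (\<lambda>i. v (f i)) p)"
  using assms
proof (induction p arbitrary: f S)
  case (Forall i p)
  have *: "(\<lambda>j. v (if j = i then 0 else Suc (f j))) = (\<lambda>j. v (Suc (f j)))(i := v 0)"
    for v :: "nat \<Rightarrow> 'a" by auto
  have "dfn K D E (\<lambda>M v. sat (S M (\<lambda>i. v (Suc i))) E (\<lambda>j. v (if j = i then 0 else Suc (f j))) p)"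
    by (rule Forall.IH[where S = "\<lambda>M v. S M (\<lambda>i. v (Suc i))"])
      (use Forall.prems in \<open>auto intro: dset_shift\<close>)
  then show ?case
    unfolding * sat.simps
    by (intro dfn_ball_set[where P = "\<lambda>M v x. sat (S M v) E ((\<lambda>i. v (f i))(i := x)) p"] Forall.prems)
qed (auto intro: dfn_Mem_var dfn_Eq_var dfn_MemC_var dfn_not dfn_conj)

text \<open>The definitions use unique existence over the whole type. Since \<open>rel\<close>
  relates only elements of \<open>M\<close>, the quantifier can be bounded by \<open>M\<close> and
  so expressed.\<close>

lemma Ex1_bounded: "(\<And>x. P x \<Longrightarrow> x \<in> A) \<Longrightarrow> (\<exists>!x. P x) \<longleftrightarrow> (\<exists>x\<in>A. P x \<and> (\<forall>y\<in>A. P y \<longrightarrow> y = x))"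
  by blast

section \<open>The axioms and measurability as formulas\<close>

lemma fo_axioms:
  "dfn K D E (\<lambda>M v. ax_extensionality M E)" "dfn K D E (\<lambda>M v. ax_pairing M E)"
  "dfn K D E (\<lambda>M v. ax_union M E)" "dfn K D E (\<lambda>M v. ax_power M E)"
  "dfn K D E (\<lambda>M v. ax_infinity M E)" "dfn K D E (\<lambda>M v. ax_foundation M E)"
  unfolding ax_extensionality_def ax_pairing_def ax_union_def ax_power_def ax_infinity_def
    ax_foundation_def
  by (intro fo_intros)+

lemma ax_choice_iff:
  "ax_choice M E \<longleftrightarrow>
    (\<forall>x\<in>M. (\<forall>y\<in>elts M E x. elts M E y \<noteq> {}) \<and>
       (\<forall>y\<in>elts M E x. \<forall>z\<in>elts M E x. y \<noteq> z \<longrightarrow> elts M E y \<inter> elts M E z = {}) \<longrightarrow>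
       (\<exists>c\<in>M. \<forall>y\<in>elts M E x. \<exists>z\<in>elts M E c \<inter> elts M E y. \<forall>z'\<in>elts M E c \<inter> elts M E y. z' = z))"
proof -
  have *: "(\<exists>!z. z \<in> A) \<longleftrightarrow> (\<exists>z\<in>A. \<forall>z'\<in>A. z' = z)" for A :: "'a set"
    by (auto simp: Ex1_def)
  show ?thesis unfolding ax_choice_def * ..
qed

lemma fo_choice: "dfn K D E (\<lambda>M v. ax_choice M E)"
  unfolding ax_choice_iff by (intro fo_intros)

lemma rel_bounded: "rel M E S x y \<Longrightarrow> x \<in> M" "rel M E S x y \<Longrightarrow> y \<in> M"
  by (auto simp: rel_def is_pair_def)

lemma dfn_rel:
  assumes "dset K D E S" "dtm K D E s" "dtm K D E t"
  shows "dfn K D E (\<lambda>M v. rel M E (S M v) (s M v) (t M v))"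
  unfolding rel_def
proof (rule dfn_bex_set[OF assms(1)])
  have "dfn K D E (\<lambda>M v. is_pair M E (v 0) (v 1) (v 2))"
    unfolding is_pair_def by (intro fo_intros)
  then show "dfn K D E (\<lambda>M v. is_pair M E (v 0) (s M (\<lambda>i. v (Suc i))) (t M (\<lambda>i. v (Suc i))))"
    by (rule dfn_subst3[where P = "\<lambda>M. is_pair M E", OF _ dtm_var])
      (intro dtm_shift assms)+
qed

lemma dfn_family:
  assumes "dset K D E S" "dtm K D E t"
  shows "dfn K D E (\<lambda>M v. S M v \<in> family M E (t M v))"
  unfolding family_def image_iff
  by (intro dfn_bex_set dset_elts assms dfn_set_eq dset_shift dtm_var)

lemma fo_function: "dfn K D E (\<lambda>M v. function_from_to M E (v 0) (v 1) (v 2))"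
proof -
  have "function_from_to M E f a b \<longleftrightarrow> f \<in> M \<and>
    (\<forall>p\<in>elts M E f. \<exists>x\<in>elts M E a. \<exists>y\<in>elts M E b. is_pair M E p x y) \<and>
    (\<forall>x\<in>elts M E a. \<exists>y\<in>M. rel M E (elts M E f) x y \<and> (\<forall>y'\<in>M. rel M E (elts M E f) x y' \<longrightarrow> y' = y))"
    for M f a b
    unfolding function_from_to_def rel_between_def using rel_bounded(2)[of M E]
    by (subst Ex1_bounded) auto
  then show ?thesis
    unfolding is_pair_def by (simp only:) (intro fo_intros dfn_rel)
qed

lemmas fo_function' = dfn_subst3[where P = "\<lambda>M. function_from_to M E" for E, OF fo_function]

lemma fo_bijection: "dfn K D E (\<lambda>M v. bijection_from_to M E (v 0) (v 1) (v 2))"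
proof -
  have "bijection_from_to M E f a b \<longleftrightarrow> function_from_to M E f a b \<and>
    (\<forall>y\<in>elts M E b. \<exists>x\<in>M. rel M E (elts M E f) x y \<and> (\<forall>x'\<in>M. rel M E (elts M E f) x' y \<longrightarrow> x' = x))"
    for M f a b
    unfolding bijection_from_to_def using rel_bounded(1)[of M E]
    by (subst Ex1_bounded[where A = M]) auto
  then show ?thesis
    by (simp only:) (intro fo_intros dfn_rel fo_function')
qed

lemmas fo_bijection' = dfn_subst3[where P = "\<lambda>M. bijection_from_to M E" for E, OF fo_bijection]

lemma fo_ordinal: "dfn K D E (\<lambda>M v. ordinal M E (v 0))"
  unfolding ordinal_def transitive_set_def strict_linear_order_on_def by (intro fo_intros)

lemmas fo_ordinal' = dfn_subst1[where P = "\<lambda>M. ordinal M E" for E, OF fo_ordinal]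

lemma fo_uncountable: "dfn K D E (\<lambda>M v. uncountable_cardinal M E (v 0))"
  unfolding uncountable_cardinal_def cardinal_def is_omega_def limit_ordinal_def
  by (intro fo_intros fo_ordinal' fo_bijection')

lemma fo_ultrafilter: "dfn K D E (\<lambda>M v. ultrafilter_on M E (v 0) (v 1))"
proof -
  have 1: "(\<forall>X\<in>family M E u. P X) \<longleftrightarrow> (\<forall>s\<in>elts M E u. P (elts M E s))" for M u P
    by (auto simp: family_def)
  have 2: "family M E u \<subseteq> Pow A \<longleftrightarrow> (\<forall>s\<in>elts M E u. elts M E s \<subseteq> A)" for M u A
    by (auto simp: family_def)
  show ?thesis
    unfolding ultrafilter_on_def 1 2 by (intro fo_intros dfn_family)
qed

lemma fo_nonprincipal: "dfn K D E (\<lambda>M v. nonprincipal M E (v 0) (v 1))"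
  unfolding nonprincipal_def by (intro fo_intros dfn_family)

lemma fo_complete: "dfn K D E (\<lambda>M v. complete_filter M E (v 0) (v 1))"
proof -
  have "(\<forall>s. rel M E F i s \<longrightarrow> P s) \<longleftrightarrow> (\<forall>s\<in>M. rel M E F i s \<longrightarrow> P s)" for M F i P
    using rel_bounded(2)[of M E] by blast
  then show ?thesis
    unfolding complete_filter_def by (simp only:) (intro fo_intros dfn_family dfn_rel fo_function')
qed

lemma fo_measurable: "dfn K D E (\<lambda>M v. measurable_cardinal M E (v 0))"
  unfolding measurable_cardinal_def
  by (intro fo_intros dfn_subst1[where P = "\<lambda>M. uncountable_cardinal M E", OF fo_uncountable]
      dfn_subst2[where P = "\<lambda>M. ultrafilter_on M E", OF fo_ultrafilter]
      dfn_subst2[where P = "\<lambda>M. nonprincipal M E", OF fo_nonprincipal]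
      dfn_subst2[where P = "\<lambda>M. complete_filter M E", OF fo_complete])

lemmas fo_measurable' = dfn_subst1[where P = "\<lambda>M. measurable_cardinal M E" for E, OF fo_measurable]

text \<open>There is one formula per instance, with the parameters as free variables, so that the
  schema can be transferred instance by instance.\<close>

lemma fo_separation:
  assumes "class_params p \<subseteq> D"
  shows "dfn K D E (\<lambda>M v. \<forall>a\<in>M. \<exists>b\<in>M. elts M E b = {x \<in> elts M E a. sat M E (v(0 := x)) p})"
  by (intro fo_intros sat_dfn_upd[OF assms])

lemma fo_replacement:
  assumes "class_params p \<subseteq> D"
  shows "dfn K D E (\<lambda>M v. \<forall>a\<in>M. (\<forall>x\<in>elts M E a. \<exists>!y. y \<in> M \<and> sat M E (v(0 := x, 1 := y)) p) \<longrightarrow>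
    (\<exists>b\<in>M. elts M E b = {y \<in> M. \<exists>x\<in>elts M E a. sat M E (v(0 := x, 1 := y)) p}))"
proof -
  have "(\<exists>!y. y \<in> M \<and> P y) \<longleftrightarrow> (\<exists>y\<in>M. P y \<and> (\<forall>y'\<in>M. P y' \<longrightarrow> y' = y))" for M and P :: "'a \<Rightarrow> bool"
    by blast
  then show ?thesis
    by (simp only:) (intro fo_intros sat_dfn_upd2[OF assms])
qed

section \<open>The ultrapower as an inner model\<close>

context measure
begin

section \<open>Transfer to the ultrapower\<close>

lemma Al_cong: "(\<And>x. x \<in> N \<Longrightarrow> E x k \<Longrightarrow> P x \<longleftrightarrow> Q x) \<Longrightarrow> Al P \<longleftrightarrow> Al Q"
  unfolding Al_iff by (metis (no_types, lifting))

lemma Al_const: "Al (\<lambda>x. b) \<longleftrightarrow> b"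
  using Al_all[of "\<lambda>x. b"] Al_ex[of "\<lambda>x. b"] by blast

lemma Los_fo:
  assumes "dfn UNIV {} E P" "\<And>i. f i \<in> N"
  shows "P Ult (\<lambda>i. pi (f i)) \<longleftrightarrow> Al (\<lambda>x. P N (\<lambda>i. app (f i) x))"
proof -
  obtain p where p: "class_params p \<subseteq> {}"
    "\<And>M v w. M \<in> UNIV \<Longrightarrow> range v \<subseteq> M \<Longrightarrow> range w \<subseteq> M \<Longrightarrow> P M v \<longleftrightarrow> sat M E (mix v w) p"
    by (rule dfnE[OF assms(1)]) blast
  have f: "mix f f i \<in> N" for i using assms(2) by (simp add: mix_def)
  have "P Ult (\<lambda>i. pi (f i)) \<longleftrightarrow> sat Ult E (\<lambda>i. pi (mix f f i)) p"
  proof -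
    have "range (\<lambda>i. pi (f i)) \<subseteq> Ult" using assms(2) by (auto simp: Ult_def)
    moreover have "mix (\<lambda>i. pi (f i)) (\<lambda>i. pi (f i)) = (\<lambda>i. pi (mix f f i))"
      by (auto simp: mix_def)
    ultimately show ?thesis using p(2)[of Ult "\<lambda>i. pi (f i)" "\<lambda>i. pi (f i)"] by simp
  qed
  also have "\<dots> \<longleftrightarrow> Al (\<lambda>x. sat N E (\<lambda>i. app (mix f f i) x) p)"
    by (rule Los) (use p(1) f in auto)
  also have "\<dots> \<longleftrightarrow> Al (\<lambda>x. P N (\<lambda>i. app (f i) x))"
  proof (rule Al_cong)
    fix x assume x: "x \<in> N"
    have "range (\<lambda>i. app (f i) x) \<subseteq> N" using assms(2) x app_N by auto
    moreover have "mix (\<lambda>i. app (f i) x) (\<lambda>i. app (f i) x) = (\<lambda>i. app (mix f f i) x)"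
      by (auto simp: mix_def)
    ultimately show "sat N E (\<lambda>i. app (mix f f i) x) p \<longleftrightarrow> P N (\<lambda>i. app (f i) x)"
      using p(2)[of N "\<lambda>i. app (f i) x" "\<lambda>i. app (f i) x"] by simp
  qed
  finally show ?thesis .
qed

lemma transfer:
  assumes "dfn UNIV {} E P" "\<And>v. range v \<subseteq> N \<Longrightarrow> P N v" "range v \<subseteq> Ult"
  shows "P Ult v"
proof -
  have "\<forall>i. \<exists>g\<in>N. v i = pi g" using assms(3) by (auto simp: Ult_def)
  then obtain f where f: "\<And>i. f i \<in> N" "\<And>i. v i = pi (f i)" by metis
  have "Al (\<lambda>x. P N (\<lambda>i. app (f i) x))"
    by (rule Al_all, rule assms(2)) (use f app_N in auto)
  then have "P Ult (\<lambda>i. pi (f i))" using Los_fo[OF assms(1)] f(1) by blast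
  moreover have "v = (\<lambda>i. pi (f i))" using f(2) by auto
  ultimately show ?thesis by simp
qed

lemma Ult_sub: "Ult \<subseteq> N"
  using pi_N by (auto simp: Ult_def)

lemma Ult_nonempty: "\<exists>c. c \<in> Ult"
  using N_nonempty by (auto simp: Ult_def)

lemma Ult_trans: "x \<in> Ult \<Longrightarrow> y \<in> N \<Longrightarrow> E y x \<Longrightarrow> y \<in> Ult"
proof -
  assume x: "x \<in> Ult" and y: "y \<in> N" "E y x"
  obtain f where f: "f \<in> N" "x = pi f" using x by (auto simp: Ult_def)
  have "y \<in> el (pi f)" using y f by (simp add: mem_el)
  then show ?thesis unfolding el_pi[OF f(1)] Ult_def by blast
qed

lemma transfer_sentence:
  assumes "dfn UNIV {} E (\<lambda>M v. Q M)" "Q N"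
  shows "Q Ult"
proof -
  obtain c where "c \<in> Ult" using Ult_nonempty by blast
  then have "range (\<lambda>_::nat. c) \<subseteq> Ult" by auto
  with assms show ?thesis by (rule transfer[where P = "\<lambda>M v. Q M"])
qed

lemma Ult_ZFC: "ZFC_model Ult E"
proof -
  have N: "ax_extensionality N E" "ax_pairing N E" "ax_union N E" "ax_power N E"
    "ax_infinity N E" "ax_foundation N E" "ax_choice N E" "separation_schema N E"
    "replacement_schema N E"
    using ZFC by (auto simp: ZFC_model_def)
  have "separation_schema Ult E"
    unfolding separation_schema_def
  proof (intro allI impI)
    fix p :: "'a set fm" and v :: "nat \<Rightarrow> 'a" assume pv: "class_params p = {} \<and> range v \<subseteq> Ult"
    show "\<forall>a\<in>Ult. \<exists>b\<in>Ult. elts Ult E b = {x \<in> elts Ult E a. sat Ult E (v(0 := x)) p}"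
      by (rule transfer[where v = v, OF fo_separation])
        (use pv N(8) in \<open>auto simp: separation_schema_def\<close>)
  qed
  moreover have "replacement_schema Ult E"
    unfolding replacement_schema_def
  proof (intro allI impI)
    fix p :: "'a set fm" and v :: "nat \<Rightarrow> 'a" assume pv: "class_params p = {} \<and> range v \<subseteq> Ult"
    have N9: "\<forall>a\<in>N. (\<forall>x\<in>elts N E a. \<exists>!y. y \<in> N \<and> sat N E (v(0 := x, 1 := y)) p) \<longrightarrow>
        (\<exists>b\<in>N. elts N E b = {y \<in> N. \<exists>x\<in>elts N E a. sat N E (v(0 := x, 1 := y)) p})"
      if "range v \<subseteq> N" for v
      by (rule N(9)[unfolded replacement_schema_def, THEN spec, THEN spec, THEN mp]) (use pv that in simp)
    show "\<forall>a\<in>Ult. (\<forall>x\<in>elts Ult E a. \<exists>!y. y \<in> Ult \<and> sat Ult E (v(0 := x, 1 := y)) p) \<longrightarrow>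
        (\<exists>b\<in>Ult. elts Ult E b = {y \<in> Ult. \<exists>x\<in>elts Ult E a. sat Ult E (v(0 := x, 1 := y)) p})"
      by (rule transfer[where v = v, OF fo_replacement N9]) (use pv in auto)
  qed
  ultimately show ?thesis
    unfolding ZFC_model_def
    using transfer_sentence[OF fo_axioms(1) N(1)] transfer_sentence[OF fo_axioms(2) N(2)]
      transfer_sentence[OF fo_axioms(3) N(3)] transfer_sentence[OF fo_axioms(4) N(4)]
      transfer_sentence[OF fo_axioms(5) N(5)] transfer_sentence[OF fo_axioms(6) N(6)]
      transfer_sentence[OF fo_choice N(7)] by (intro conjI)
qed

section \<open>The elementary embedding and the ordinals\<close>

lemma constant_ex: "a \<in> N \<Longrightarrow> \<exists>f\<in>N. \<forall>x\<in>el k. app f x = a"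
  using lambda_ex[OF small_el[OF k_N] dt_const] by blast

text \<open>The collapse of the constant function with value \<open>a\<close> is
  \<open>j(a)\<close>, so this is elementarity of \<open>j\<close> in one argument.\<close>

lemma Los_const:
  assumes "dfn UNIV {} E (\<lambda>M v. P M (v 0))" "f \<in> N" "a \<in> N" "\<forall>x\<in>el k. app f x = a"
  shows "P Ult (pi f) \<longleftrightarrow> P N a"
proof -
  have "P Ult (pi f) \<longleftrightarrow> Al (\<lambda>x. P N (app f x))"
    using Los_fo[OF assms(1), of "\<lambda>_. f"] assms(2) by simp
  also have "\<dots> \<longleftrightarrow> Al (\<lambda>x. P N a)"
    by (rule Al_cong) (use assms(4) in \<open>simp add: mem_el\<close>)
  finally show ?thesis by (simp add: Al_const)
qed

text \<open>If \<open>j(a)\<close> were in \<open>a\<close>, then \<open>j(j(a))\<close> would be in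
  \<open>j(a)\<close>, so \<open>j(a)\<close> would be a counterexample below
  \<open>a\<close>.\<close>

lemma pi_const_not_below:
  assumes "a \<in> N" "f \<in> N" "\<forall>x\<in>el k. app f x = a"
  shows "\<not> E (pi f) a"
proof -
  have "\<forall>f\<in>N. (\<forall>x\<in>el k. app f x = a) \<longrightarrow> \<not> E (pi f) a"
    using _ assms(1)
  proof (rule E_induct)
    show "df (\<lambda>v. \<forall>f\<in>N. (\<forall>x\<in>el k. app f x = v 0) \<longrightarrow> \<not> E (pi f) (v 0))"
      by (intro df_intros1 dt_pi k_N)
    fix a assume a: "a \<in> N"
      and IH: "\<And>b. b \<in> N \<Longrightarrow> E b a \<Longrightarrow> \<forall>f\<in>N. (\<forall>x\<in>el k. app f x = b) \<longrightarrow> \<not> E (pi f) b"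
    show "\<forall>f\<in>N. (\<forall>x\<in>el k. app f x = a) \<longrightarrow> \<not> E (pi f) a"
    proof (intro ballI impI notI)
      fix f assume f: "f \<in> N" "\<forall>x\<in>el k. app f x = a" "E (pi f) a"
      obtain g where g: "g \<in> N" "\<forall>x\<in>el k. app g x = pi f"
        using constant_ex[OF pi_N[OF f(1)]] by blast
      have "E (pi g) (pi f)"
        unfolding pi_mem[OF g(1) f(1)] by (rule Al_all) (use f g in \<open>simp add: mem_el\<close>)
      then show False using IH[OF pi_N[OF f(1)] f(3)] g by blast
    qed
  qed
  then show ?thesis using assms by blast
qed

text \<open>By elementarity and transitivity of \<open>Ult\<close>, \<open>j(a)\<close> is an
  ordinal. It is not below \<open>a\<close>, so \<open>a\<close> equals it or belongs to it, and
  transitivity puts \<open>a\<close> into \<open>Ult\<close>.\<close>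

lemma Ult_ordinals:
  assumes "ordinal N E a"
  shows "a \<in> Ult"
proof -
  have a: "a \<in> N" "ordn a" using assms ordinal_iff by auto
  obtain f where f: "f \<in> N" "\<forall>x\<in>el k. app f x = a" using constant_ex[OF a(1)] by blast
  let ?tr = "\<lambda>M x. \<forall>y\<in>M. E y x \<longrightarrow> (\<forall>z\<in>M. E z y \<longrightarrow> E z x)"
  let ?o = "\<lambda>M x. ?tr M x \<and> (\<forall>y\<in>M. E y x \<longrightarrow> ?tr M y)"
  have "dfn UNIV {} E (\<lambda>M v. ?o M (v 0))" by (intro fo_intros)
  from Los_const[where P = ?o, OF this f(1) a(1) f(2)]
  have "?o Ult (pi f) \<longleftrightarrow> ?o N a" .
  moreover have "?o N a" using a(2) unfolding ordn_def tr_def .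
  ultimately have o: "?o Ult (pi f)" by (rule iffD2)
  have pf: "pi f \<in> Ult" using f by (auto simp: Ult_def)
  have tr_Ult: "tr x" if x: "x \<in> Ult" "?tr Ult x" for x
    unfolding tr_def
  proof (intro ballI impI)
    fix y z assume yz: "y \<in> N" "E y x" "z \<in> N" "E z y"
    then have "y \<in> Ult" using Ult_trans x(1) by blast
    moreover from this have "z \<in> Ult" using Ult_trans yz by blast
    ultimately show "E z x" using x(2) yz by blast
  qed
  have "ordn (pi f)"
    unfolding ordn_def
  proof (intro conjI ballI impI)
    show "tr (pi f)" by (rule tr_Ult[OF pf conjunct1[OF o]])
    show "tr y" if "y \<in> N" "E y (pi f)" for y
      using Ult_trans[OF pf that] bspec[OF conjunct2[OF o] Ult_trans[OF pf that]] that(2)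
      by (blast intro: tr_Ult)
  qed
  then have "E a (pi f) \<or> a = pi f \<or> E (pi f) a"
    using ordn_linear a pi_N f(1) by blast
  then show ?thesis
    using pi_const_not_below[OF a(1) f] Ult_trans[OF pf a(1)] pf by blast
qed

lemma k_ordn: "ordn k"
  using k_unctbl ordinal_iff unfolding uncountable_cardinal_def cardinal_def by blast

text \<open>Single points are null because the ultrafilter is nonprincipal; by completeness the
  points up to \<open>d\<close> form a null set too.\<close>

lemma Al_above: "d \<in> N \<Longrightarrow> E d k \<Longrightarrow> Al (\<lambda>x. E d x)"
proof -
  assume d: "d \<in> N" "E d k"
  have "Al (\<lambda>x. \<forall>i\<in>N. E i d \<longrightarrow> x \<noteq> i)"
  proof (rule Al_complete[OF d])
    show "df (\<lambda>v. v 1 \<noteq> v 0)" by (intro df_intros1)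
    show "Al (\<lambda>x. x \<noteq> i)" if "i \<in> N" "E i d" for i
      using Al_ne ordn_trans[OF k_ordn d(1) that(1) d(2)] that by blast
  qed
  from this Al_ne[OF d] show "Al (\<lambda>x. E d x)"
  proof (rule Al_mono2)
    show "df (\<lambda>v. E d (v 0))" by (intro df_intros1 d)
    show "E d x" if "x \<in> N" "E x k" "\<forall>i\<in>N. E i d \<longrightarrow> x \<noteq> i" "x \<noteq> d" for x
      using ordn_linear[of x d] ordn_mem[OF k_ordn] that d by blast
  qed
qed

lemma k_not_fixed:
  assumes f: "f \<in> N" "\<forall>x\<in>el k. app f x = k"
  shows "pi f \<noteq> k"
proof
  assume eq: "pi f = k"
  have "dt (\<lambda>v. v 0)" by (rule dtm_var)
  from lambda_ex[OF small_el[OF k_N] this]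
  obtain g where g: "g \<in> N" "\<forall>x\<in>el k. app g x = x" by blast
  have "E (pi g) (pi f)"
    unfolding pi_mem[OF g(1) f(1)] by (rule Al_all) (use f g in \<open>simp add: mem_el\<close>)
  then have d: "pi g \<in> N" "E (pi g) k" using eq pi_N[OF g(1)] by auto
  obtain h where h: "h \<in> N" "\<forall>x\<in>el k. app h x = pi g" using constant_ex[OF d(1)] by blast
  \<comment> \<open>Here \<open>d = pi g\<close> is represented by the identity. Almost every
    \<open>x\<close> is above \<open>d\<close>, which says that \<open>j(d)\<close> is below
    \<open>d\<close>.\<close>
  have "Al (\<lambda>x. E (app h x) (app g x)) \<longleftrightarrow> Al (\<lambda>x. E (pi g) x)"
    by (rule Al_cong) (use g h in \<open>simp add: mem_el\<close>)
  then have "E (pi h) (pi g)" using Al_above[OF d] pi_mem[OF h(1) g(1)] by simp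
  then show False using pi_const_not_below[OF d(1) h] by blast
qed

end

context zfc
begin

lemma smaller_model_ex:
  assumes "k \<in> N" "measurable_cardinal N E k"
  obtains M where "M \<subset> N" "\<And>x y. x \<in> M \<Longrightarrow> y \<in> N \<Longrightarrow> E y x \<Longrightarrow> y \<in> M"
    "\<And>a. ordinal N E a \<Longrightarrow> a \<in> M" "ZFC_model M E" "df (\<lambda>v. v 0 \<in> M)"
    "\<exists>k\<in>M. measurable_cardinal M E k"
proof -
  have "dfn {N} (el ` N) E (\<lambda>M v. measurable_cardinal M E (v 0))" by (rule fo_measurable)
  then have dmeas: "df (\<lambda>v. measurable_cardinal N E (v 0))"
    by (rule iffD1[OF dfn_cong, rotated]) simp
  obtain l where l: "l \<in> N" "measurable_cardinal N E l"
    "\<forall>z\<in>N. E z l \<longrightarrow> \<not> measurable_cardinal N E z"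
    using foundation[OF dmeas assms] by blast
  then obtain u where u: "u \<in> N" "ultrafilter_on N E l u" "nonprincipal N E l u" "complete_filter N E l u"
    unfolding measurable_cardinal_def by blast
  interpret measure N E l u
    using l u unfolding measurable_cardinal_def by unfold_locales auto
  let ?least = "\<lambda>M x. measurable_cardinal M E x \<and> (\<forall>y\<in>M. E y x \<longrightarrow> \<not> measurable_cardinal M E y)"
  obtain f where f: "f \<in> N" "\<forall>x\<in>el l. app f x = l" using constant_ex[OF l(1)] by blast
  have "dfn UNIV {} E (\<lambda>M v. ?least M (v 0))"
    by (intro fo_intros fo_measurable')
  from Los_const[where P = ?least, OF this f(1) l(1) f(2)]
  have least: "?least Ult (pi f)" using l by blast
  have ne: "Ult \<noteq> N"
  proof
    assume eq: "Ult = N"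
    have ord: "ordn (pi f)"
      using least ordinal_iff unfolding eq measurable_cardinal_def uncountable_cardinal_def cardinal_def
      by blast
    have "pi f = l"
      using ordn_linear[OF pi_N[OF f(1)] l(1) ord k_ordn] least l pi_N[OF f(1)] unfolding eq by blast
    then show False using k_not_fixed[OF f] by simp
  qed
  have dUlt: "df (\<lambda>v. v 0 \<in> Ult)"
  proof -
    have "df (\<lambda>v. \<exists>g\<in>N. v 0 = pi g)" by (intro df_intros1 dt_pi)
    then show ?thesis unfolding Ult_def image_iff .
  qed
  show ?thesis
    by (rule that[OF _ Ult_trans Ult_ordinals Ult_ZFC dUlt])
      (use ne Ult_sub least f(1) in \<open>auto simp: Ult_def\<close>)
qed

end

section \<open>Inner models in a model of class theory\<close>

lemma comprehension:
  assumes "BG_model V C E" "dfn {V} C E (\<lambda>M v. Q (v 0))"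
  shows "{x \<in> V. Q x} \<in> C"
proof -
  obtain p where p: "class_params p \<subseteq> C"
    "\<And>M v w. M \<in> {V} \<Longrightarrow> range v \<subseteq> M \<Longrightarrow> range w \<subseteq> M \<Longrightarrow> Q (v 0) \<longleftrightarrow> sat M E (mix v w) p"
    by (rule dfnE[OF assms(2)]) blast
  obtain c where c: "c \<in> V" using assms(1) by (auto simp: BG_model_def ax_infinity_def)
  let ?c = "\<lambda>_::nat. c"
  have "{x \<in> V. sat V E ((mix ?c ?c)(0 := x)) p} \<in> C"
    using assms(1) p(1) range_mix[of ?c V ?c] c unfolding BG_model_def class_comprehension_def by auto
  moreover have "sat V E ((mix ?c ?c)(0 := x)) p \<longleftrightarrow> Q x" if "x \<in> V" for x
    using p(2)[of V "?c(0 := x)" ?c] mix_upd[of ?c ?c 0 x] c that by auto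
  ultimately show ?thesis by (simp cong: conj_cong)
qed

lemma inner_model_elts:
  assumes "inner_model C E V N" "x \<in> N"
  shows "elts N E x = elts V E x"
  using assms unfolding inner_model_def by (auto simp: elts_def)

text \<open>A formula for \<open>P\<close> over \<open>N\<close> is relativised to the class
  \<open>N\<close>. Its class parameters are extensions of sets; these are the same in
  \<open>N\<close> and in \<open>V\<close> by transitivity, hence belong to
  \<open>C\<close>.\<close>

lemma inner_model_class:
  assumes BG: "BG_model V C E" and N: "inner_model C E V N"
    and P: "dfn {N} (elts N E ` N) E (\<lambda>_ v. P (v 0))"
  shows "{x \<in> N. P x} \<in> C"
proof -
  have NC: "N \<in> C" "N \<subseteq> V" using N by (auto simp: inner_model_def)
  have "elts N E ` N \<subseteq> C"
    using BG NC(2) inner_model_elts[OF N] by (auto simp: BG_model_def)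
  then have "dfn {N} C E (\<lambda>_ v. P (v 0))" using dfn_mono[OF P] by blast
  then obtain p where p: "class_params p \<subseteq> C"
    "\<And>M v w. M \<in> {N} \<Longrightarrow> range v \<subseteq> M \<Longrightarrow> range w \<subseteq> M \<Longrightarrow> P (v 0) \<longleftrightarrow> sat M E (mix v w) p"
    by (rule dfnE) blast
  have "mix (\<lambda>_. x) (\<lambda>_. x) = (\<lambda>_. x)" for x :: 'a by (auto simp: mix_def)
  then have sat: "P x \<longleftrightarrow> sat N E (\<lambda>_. x) p" if "x \<in> N" for x
    using p(2)[of N "\<lambda>_. x" "\<lambda>_. x"] that by auto
  have dN: "dset {V} C E (\<lambda>M v. N)" by (rule dset_const) (use NC in auto)
  have "{x \<in> V. x \<in> N \<and> sat N E (\<lambda>_. x) p} \<in> C"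
    by (rule comprehension[OF BG])
      (intro fo_intros dN sat_dfn_set[where S = "\<lambda>M v. N" and f = "\<lambda>_. 0", OF p(1) dN])
  moreover have "{x \<in> V. x \<in> N \<and> sat N E (\<lambda>_. x) p} = {x \<in> N. P x}"
    using sat NC(2) by blast
  ultimately show ?thesis by simp
qed

lemma inner_model_zfc:
  assumes BG: "BG_model V C E" and N: "inner_model C E V N"
  shows "zfc N E"
proof
  show "ZFC_model N E" using N by (simp add: inner_model_def)
  fix P x assume P: "dfn {N} (elts N E ` N) E (\<lambda>_ v. P (v 0))" and x: "x \<in> N" "P x"
  have NV: "N \<subseteq> V" using N by (auto simp: inner_model_def)
  have "{x \<in> N. P x} \<noteq> {}" using x by blast
  then obtain y where y: "y \<in> {x \<in> N. P x}" "elts V E y \<inter> {x \<in> N. P x} = {}"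
    using BG inner_model_class[OF BG N P] unfolding BG_model_def class_foundation_def by meson
  then have "\<forall>z\<in>N. E z y \<longrightarrow> \<not> P z" using NV by (auto simp: elts_def)
  then show "\<exists>y\<in>N. P y \<and> (\<forall>z\<in>N. E z y \<longrightarrow> \<not> P z)" using y(1) by blast
qed

lemma smaller_inner_model_ex:
  assumes BG: "BG_model V C E" and N: "inner_model C E V N"
    and k: "k \<in> N" "measurable_cardinal N E k"
  shows "\<exists>M. inner_model C E V M \<and> M \<subset> N \<and> (\<exists>k\<in>M. measurable_cardinal M E k)"
proof -
  interpret zfc N E by (rule inner_model_zfc[OF BG N])
  obtain M where M: "M \<subset> N" "\<And>x y. x \<in> M \<Longrightarrow> y \<in> N \<Longrightarrow> E y x \<Longrightarrow> y \<in> M"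
    "\<And>a. ordinal N E a \<Longrightarrow> a \<in> M" "ZFC_model M E" "df (\<lambda>v. v 0 \<in> M)"
    "\<exists>k\<in>M. measurable_cardinal M E k"
    using smaller_model_ex[OF k] by blast
  have NV: "N \<subseteq> V" using N by (auto simp: inner_model_def)
  have "{x \<in> N. x \<in> M} \<in> C" by (rule inner_model_class[OF BG N M(5)])
  moreover have "{x \<in> N. x \<in> M} = M" using M(1) by blast
  ultimately have "M \<in> C" by simp
  moreover have "elts V E x \<subseteq> M" if "x \<in> M" for x
  proof -
    have "elts V E x = elts N E x" using inner_model_elts[OF N] M(1) that by blast
    then show ?thesis using M(2)[OF that] by (auto simp: elts_def)
  qed
  \<comment> \<open>An ordinal of \<open>V\<close> lies in \<open>N\<close>, and it is an ordinal
    there because its elements, and those of any set in \<open>N\<close>, are the same in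
    \<open>N\<close> and in \<open>V\<close>.\<close>
  moreover have "a \<in> M" if a: "ordinal V E a" for a
  proof -
    have aN: "a \<in> N" using N a by (simp add: inner_model_def)
    have sub: "elts V E y = elts N E y" if "y \<in> N" for y using inner_model_elts[OF N that] by simp
    have "ordinal N E a"
      unfolding ordinal_def transitive_set_def
    proof (intro conjI ballI impI aN)
      show "elts N E y \<subseteq> elts N E a" if "y \<in> elts N E a" for y
        using a that sub[OF aN] sub[of y] unfolding ordinal_def transitive_set_def
        by (auto simp: elts_def)
      show "strict_linear_order_on (elts N E a) E"
        using a sub[OF aN] by (simp add: ordinal_def)
      show "\<exists>m\<in>elts N E s. \<forall>y\<in>elts N E s. m = y \<or> E m y"
        if "s \<in> N" "elts N E s \<subseteq> elts N E a \<and> elts N E s \<noteq> {}" for s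
        using a that(2) subsetD[OF NV that(1)] unfolding ordinal_def sub[OF aN] sub[OF that(1), symmetric]
        by blast
    qed
    then show ?thesis by (rule M(3))
  qed
  ultimately have "inner_model C E V M"
    unfolding inner_model_def using M(1,4) NV by blast
  then show ?thesis using M(1,6) by blast
qed

section \<open>The least index\<close>

theorem theorem2p2:
  fixes V :: "'a set" and C :: "'a set set" and E :: "'a \<Rightarrow> 'a \<Rightarrow> bool"
  assumes "BG_model V C E"
    and "well_ordered_model_universe V C E V"
  shows "\<not> (\<exists>k\<in>V. measurable_cardinal V E k)"
proof
  assume "\<exists>k\<in>V. measurable_cardinal V E k"
  then obtain k where k: "k \<in> V" "measurable_cardinal V E k" by blast
  note BG = assms(1)
  obtain MM I L where MM: "MM \<in> C" and wo: "well_ordered_class V C E I L"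
    and iff: "\<forall>M\<in>C. proper_inner_model C E V M \<longleftrightarrow> (\<exists>!a. a \<in> I \<and> M = slice V E MM a)"
    and mono: "\<forall>a\<in>I. \<forall>b\<in>I. rel V E L a b \<longrightarrow> slice V E MM a \<subseteq> slice V E MM b"
    using assms(2) unfolding well_ordered_model_universe_def by (elim conjE bexE exE)
  have ZFC: "ZFC_model V E"
    using assms(2) by (simp add: well_ordered_model_universe_def)
  have CV: "C \<subseteq> Pow V" using BG by (simp add: BG_model_def)
  have IC: "I \<in> C" "I \<subseteq> V" using wo CV by (auto simp: well_ordered_class_def)
  let ?S = "slice V E MM"
  have dset_slice: "dset {V} C E (\<lambda>M v. slice M E MM (v j))" for j
  proof -
    have slice: "slice M E MM a = {x \<in> M. rel M E MM a x}" for M a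
      unfolding slice_def by (auto dest: rel_bounded(2))
    have MMd: "dset {V} C E (\<lambda>M v. MM)"
      by (rule dset_const) (use MM CV in auto)
    show ?thesis
      unfolding slice by (intro dset_Collect dset_UNIV dfn_rel MMd dtm_var)
  qed
  have SV: "?S a \<subseteq> V" for a unfolding slice_def by (auto dest: rel_bounded(2))
  have SC: "?S a \<in> C" if a: "a \<in> V" for a
  proof -
    have A: "elts V E a \<in> C" "elts V E a \<subseteq> V" using BG a by (auto simp: BG_model_def elts_def)
    \<comment> \<open>\<open>comprehension\<close> offers only class parameters, so the index
      \<open>a\<close> is represented by the class of its elements.\<close>
    have "{x \<in> V. \<exists>y\<in>V. elts V E y = elts V E a \<and> x \<in> ?S y} \<in> C"
    proof (rule comprehension[OF BG])
      have "dset {V} C E (\<lambda>M v. elts V E a)" by (rule dset_const) (use A in auto)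
      then have "dfn {V} C E (\<lambda>M v. \<exists>y\<in>M. elts M E y = elts V E a \<and> v 0 \<in> slice M E MM y)"
        by (intro fo_intros dset_slice)
      then show "dfn {V} C E (\<lambda>M v. \<exists>y\<in>V. elts V E y = elts V E a \<and> v 0 \<in> ?S y)"
        by (rule iffD1[OF dfn_cong, rotated]) simp
    qed
    moreover have "y = a" if "y \<in> V" "elts V E y = elts V E a" for y
      using BG a that by (simp add: BG_model_def ax_extensionality_def)
    then have "{x \<in> V. \<exists>y\<in>V. elts V E y = elts V E a \<and> x \<in> ?S y} = ?S a"
      using a SV by blast
    ultimately show ?thesis by simp
  qed
  have "{x \<in> V. x = x} \<in> C"
    by (rule comprehension[OF BG]) (intro fo_intros)
  then have "V \<in> C" by simp
  then have "inner_model C E V V"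
    using ZFC unfolding inner_model_def by (auto simp: elts_def ordinal_def)
  then obtain M1 where M1: "inner_model C E V M1" "M1 \<subset> V" "\<exists>k\<in>M1. measurable_cardinal M1 E k"
    using smaller_inner_model_ex[OF BG _ k] by blast
  \<comment> \<open>By the indexing hypothesis, uniqueness of the index stands for the slice being a
    proper inner model.\<close>
  define X where "X = {a \<in> V. a \<in> I \<and> (\<forall>b\<in>I. ?S b = ?S a \<longrightarrow> b = a) \<and>
    (\<exists>k\<in>?S a. measurable_cardinal (?S a) E k)}"
  have index: "\<exists>b\<in>X. M = ?S b"
    if "inner_model C E V M" "M \<subset> V" "\<exists>k\<in>M. measurable_cardinal M E k" for M
  proof -
    have "M \<in> C" "proper_inner_model C E V M"
      using that by (auto simp: inner_model_def proper_inner_model_def)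
    then obtain a where a: "a \<in> I" "M = ?S a" "\<And>b. b \<in> I \<and> M = ?S b \<Longrightarrow> b = a"
      using iff by (metis (no_types, lifting))
    then have "a \<in> X" unfolding X_def using that(3) IC by auto
    then show ?thesis using a(2) by blast
  qed
  have "X \<in> C"
  proof -
    \<comment> \<open>A formula \<open>p\<close> that works in all structures can be relativised to
      every slice at once, although the slice varies with the index.\<close>
    obtain p where p: "class_params p \<subseteq> {}" "\<And>M v w. M \<in> UNIV \<Longrightarrow> range v \<subseteq> M \<Longrightarrow> range w \<subseteq> M \<Longrightarrow>
        measurable_cardinal M E (v 0) \<longleftrightarrow> sat M E (mix v w) p"
      by (rule dfnE[OF fo_measurable[of UNIV "{}" E]]) blast
    have "mix (\<lambda>_. x) (\<lambda>_. x) = (\<lambda>_. x)" for x :: 'a by (auto simp: mix_def)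
    then have sat: "measurable_cardinal M E x \<longleftrightarrow> sat M E (\<lambda>_. x) p" if "x \<in> M" for M x
      using p(2)[of M "\<lambda>_. x" "\<lambda>_. x"] that by auto
    have dI: "dset {V} C E (\<lambda>M v. I)" by (rule dset_const) (use IC in auto)
    have pC: "class_params p \<subseteq> C" using p(1) by blast
    have "dfn {V} C E (\<lambda>M v. v 0 \<in> I \<and>
        (\<forall>b\<in>I. slice M E MM b = slice M E MM (v 0) \<longrightarrow> b = v 0) \<and>
        (\<exists>k\<in>slice M E MM (v 0). sat (slice M E MM (v 0)) E (\<lambda>_. k) p))"
      by (intro fo_intros dI dset_slice sat_dfn_set[where f = "\<lambda>_. 0", OF pC])
    then have "dfn {V} C E (\<lambda>M v. v 0 \<in> I \<and> (\<forall>b\<in>I. ?S b = ?S (v 0) \<longrightarrow> b = v 0) \<and>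
        (\<exists>k\<in>?S (v 0). measurable_cardinal (?S (v 0)) E k))"
      by (rule iffD1[OF dfn_cong, rotated]) (simp add: sat cong: bex_cong)
    then show ?thesis unfolding X_def by (rule comprehension[OF BG])
  qed
  moreover have "X \<subseteq> I" unfolding X_def by blast
  moreover have "X \<noteq> {}" using index[OF M1] by blast
  ultimately obtain m where m: "m \<in> X" "\<forall>y\<in>X. m = y \<or> rel V E L m y"
    using wo unfolding well_ordered_class_def by meson
  have mI: "m \<in> I" "m \<in> V" and muniq: "\<forall>b\<in>I. ?S b = ?S m \<longrightarrow> b = m"
    and mmeas: "\<exists>k\<in>?S m. measurable_cardinal (?S m) E k"
    using m(1) unfolding X_def by auto
  \<comment> \<open>Now uniqueness of the index is turned back: as the slice is a class, the
    indexing hypothesis makes it an inner model, and the ultrapower can be formed in it.\<close>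
  have "\<exists>!a. a \<in> I \<and> ?S m = ?S a" using mI muniq by metis
  then have "proper_inner_model C E V (?S m)"
    by (rule iffD2[OF bspec[OF iff SC[OF mI(2)]]])
  then have Sm: "inner_model C E V (?S m)"
    by (simp add: proper_inner_model_def)
  obtain l where "l \<in> ?S m" "measurable_cardinal (?S m) E l" using mmeas by blast
  from smaller_inner_model_ex[OF BG Sm this]
  obtain M2 where M2: "inner_model C E V M2" "M2 \<subset> ?S m" "\<exists>k\<in>M2. measurable_cardinal M2 E k"
    by (elim exE conjE)
  have "M2 \<subset> V" using M2(2) SV by (rule psubset_subset_trans)
  from index[OF M2(1) this M2(3)] obtain b where b: "b \<in> X" "M2 = ?S b" by (elim bexE)
  then have "m = b \<or> rel V E L m b" using m(2) by blast
  moreover have "b \<in> I" using b(1) \<open>X \<subseteq> I\<close> by (rule rev_subsetD)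
  \<comment> \<open>Whether \<open>b\<close> equals \<open>m\<close> or comes after it, the slice of
    \<open>m\<close> is contained in \<open>M2\<close>, which is a proper part of that
    slice.\<close>
  ultimately have "?S m \<subseteq> M2" unfolding b(2) using mono mI(1) by auto
  then show False using M2(2) by (simp add: psubset_eq)
qed

end
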